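(* Let $G=(V,E)$ be a graph with a nearest neighbour random walk with transition probabilities $p(x,y)$ whose transition operator $T$ on $\ell_2(G)$ is selfadjoint, let $m\ge 2$ be the number of lamp states, and let $\tilde p$ and $\widetilde T$ be the transition probabilities and the transition operator of the associated switch-walk-switch lamplighter random walk. Let $C_x$ be the cluster of $x$ in Bernoulli site percolation on $G$ with parameter $p=1/m$. Then for every $x\in V$ and every $n$, $$\tilde p^{(n)}(\iota,x;\iota,x)=\mathbf{E}\,p_{C_x}^{(n)}(x,x),$$ and therefore the Plancherel measure of $\widetilde T$ (the spectral measure of $\widetilde T$ at $\delta_{(\iota,x)}$) coincides with the integrated density of states of the absorbing random walk on the percolation cluster $C_x$ (the expected spectral measure of $T_{C_x}$ at $\delta_x$).
   Context: Graphs are simple (no loops); $G$ is identified with its vertex set $V$, and $x\sim y$ denotes adjacency. A nearest neighbour random walk on $G$ is a Markov chain on $V$ with transition probabilities $p(x,y)\ge 0$, where $p(x,y)=0$ unless $y\sim x$, and $\sum_y p(x,y)=1$. Its transition operator on $\ell_2(G)=\{f:V\to\mathbf{C}:\sum_x|f(x)|^2<\infty\}$ is $Tf(x)=\sum_{y\sim x}p(x,y)f(y)$; it is assumed throughout to be selfadjoint (i.e. $p(x,y)=p(y,x)$). Lamplighter random walk: let $H$ be a finite set of $m=|H|$ lamp states, one of which is called "off" (black). A configuration is a finitely supported function $\eta:G\to H$ (i.e. equal to "off" outside a finite set); $\mathfrak{C}=H^{(G)}$ is the set of configurations, and $\iota\in\mathfrak{C}$ is the configuration with all lamps off. The switch-walk-switch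 lamplighter random walk is the Markov chain on $\mathfrak{C}\times G$ with transition probabilities $\tilde p(\xi,x;\eta,y)=p(x,y)/m^2$ if $y\sim x$ and $\xi,\eta$ coincide outside $\{x,y\}$, and $\tilde p(\xi,x;\eta,y)=0$ otherwise. Its transition operator on $\ell_2(\mathfrak{C}\times G)$ is $\widetilde Tf(\xi,x)=\sum_{(\eta,y)}\tilde p(\xi,x;\eta,y)f(\eta,y)$, and $\tilde p^{(n)}(\xi,x;\eta,y)$ denotes its $n$-step transition probabilities. Percolation: in Bernoulli site percolation with parameter $p\in(0,1)$ each vertex is independently open with probability $p$; $C_x$ denotes the connected component containing $x$ of the subgraph induced on the open vertices ($C_x=\emptyset$ if $x$ is not open). For a subset $C\subseteq V$, the absorbing random walk on $C$ has the (substochastic) transition matrix on $V$ given by $p_C(y,z)=p(y,z)$ if $y,z\in C$ and $p_C(y,z)=0$ otherwise; $p_C^{(n)}$ is the $n$-th power of this matrix, and $T_C$ is the corresponding operator on $\ell_2(G)$. For a bounded selfadjoint operator $S=\int t\,dE(t)$ and a unit vector $v$, the spectral measure of $S$ at $v$ is $d\mu(t)=\langle dE(t)v,v\rangle$. The expected spectral measure of $T_{C_x}$ at $\delta_x$ is the probability measure $B\mapsto\mathbf{E}[\mu_{C_x}(B)]$, where $\mu_{C_x}$ is the spectral measure of $T_{C_x}$ at $\delta_x$. *)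

theory Defs
  imports "HOL-Probability.Probability" "HOL-Library.Poly_Mapping"
begin

section \<open>Bounded operators and spectral measures on square-summable functions\<close>

text \<open>Operators are total maps on all functions; only their values on the set \<open>ell2\<close> matter.\<close>

definition ell2 :: "('a \<Rightarrow> complex) set" where
  "ell2 = {f. (\<lambda>x. (cmod (f x))\<^sup>2) summable_on UNIV}"

definition ell2_inner :: "('a \<Rightarrow> complex) \<Rightarrow> ('a \<Rightarrow> complex) \<Rightarrow> complex" where
  "ell2_inner f g = (\<Sum>\<^sub>\<infinity>x. f x * cnj (g x))"

definition ell2_norm :: "('a \<Rightarrow> complex) \<Rightarrow> real" where
  "ell2_norm f = sqrt (\<Sum>\<^sub>\<infinity>x. (cmod (f x))\<^sup>2)"

definition bounded_op :: "(('a \<Rightarrow> complex) \<Rightarrow> ('a \<Rightarrow> complex)) \<Rightarrow> bool" where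
  "bounded_op S \<longleftrightarrow>
     (\<forall>f\<in>ell2. S f \<in> ell2) \<and>
     (\<forall>f\<in>ell2. \<forall>g\<in>ell2. S (\<lambda>x. f x + g x) = (\<lambda>x. S f x + S g x)) \<and>
     (\<forall>c. \<forall>f\<in>ell2. S (\<lambda>x. c * f x) = (\<lambda>x. c * S f x)) \<and>
     (\<exists>M. \<forall>f\<in>ell2. ell2_norm (S f) \<le> M * ell2_norm f)"

definition selfadjoint_op :: "(('a \<Rightarrow> complex) \<Rightarrow> ('a \<Rightarrow> complex)) \<Rightarrow> bool" where
  "selfadjoint_op S \<longleftrightarrow> bounded_op S \<and>
     (\<forall>f\<in>ell2. \<forall>g\<in>ell2. ell2_inner (S f) g = ell2_inner f (S g))"

definition orthogonal_projection :: "(('a \<Rightarrow> complex) \<Rightarrow> ('a \<Rightarrow> complex)) \<Rightarrow> bool" where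
  "orthogonal_projection P \<longleftrightarrow> selfadjoint_op P \<and> (\<forall>f\<in>ell2. P (P f) = P f)"

text \<open>Countable additivity is in the strong operator topology.\<close>

definition projection_valued_measure ::
  "(real set \<Rightarrow> ('a \<Rightarrow> complex) \<Rightarrow> ('a \<Rightarrow> complex)) \<Rightarrow> bool" where
  "projection_valued_measure E \<longleftrightarrow>
     (\<forall>B\<in>sets borel. orthogonal_projection (E B)) \<and>
     (\<forall>f\<in>ell2. E UNIV f = f) \<and>
     (\<forall>A\<in>sets borel. \<forall>B\<in>sets borel. \<forall>f\<in>ell2. E (A \<inter> B) f = E A (E B f)) \<and>
     (\<forall>A::nat \<Rightarrow> real set. range A \<subseteq> sets borel \<longrightarrow> disjoint_family A \<longrightarrow>
        (\<forall>f\<in>ell2. (\<lambda>N. ell2_norm (\<lambda>x. E (\<Union>n. A n) f x - (\<Sum>n<N. E (A n) f x)))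
            \<longlonglongrightarrow> 0))"

text \<open>The scalar measure \<open>\<langle>dE(t)v,v\<rangle>\<close>; the inner product is real and nonnegative because
  \<open>E(B)\<close> is an orthogonal projection.\<close>

definition pvm_scalar_measure ::
  "(real set \<Rightarrow> ('a \<Rightarrow> complex) \<Rightarrow> ('a \<Rightarrow> complex)) \<Rightarrow> ('a \<Rightarrow> complex) \<Rightarrow> real measure" where
  "pvm_scalar_measure E v =
     measure_of UNIV (sets borel) (\<lambda>B. ennreal (Re (ell2_inner (E B v) v)))"

text \<open>\<open>S = \<integral>t dE(t)\<close> in the weak sense, for a compactly supported projection-valued measure.
  The quadratic form determines the sesquilinear form by polarization.\<close>

definition spectral_resolution ::
  "(('a \<Rightarrow> complex) \<Rightarrow> ('a \<Rightarrow> complex)) \<Rightarrow>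
   (real set \<Rightarrow> ('a \<Rightarrow> complex) \<Rightarrow> ('a \<Rightarrow> complex)) \<Rightarrow> bool" where
  "spectral_resolution S E \<longleftrightarrow>
     projection_valued_measure E \<and>
     (\<exists>a. \<forall>f\<in>ell2. E {-a..a} f = f) \<and>
     (\<forall>f\<in>ell2. ell2_inner (S f) f = complex_of_real (\<integral>t. t \<partial>pvm_scalar_measure E f))"

text \<open>Meaningful for a bounded selfadjoint \<open>S\<close> and \<open>v\<close> in \<open>ell2\<close>. \<open>E\<close> itself is unique only up
  to its values off the Borel sets and off \<open>ell2\<close>, so the description is of the measure.\<close>

definition spectral_measure ::
  "(('a \<Rightarrow> complex) \<Rightarrow> ('a \<Rightarrow> complex)) \<Rightarrow> ('a \<Rightarrow> complex) \<Rightarrow> real measure" where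
  "spectral_measure S v =
     (THE \<mu>. \<exists>E. spectral_resolution S E \<and> \<mu> = pvm_scalar_measure E v)"

section \<open>Random walks\<close>

text \<open>The vertex set is the whole type; it may be infinite, and no local finiteness or
  connectedness is assumed.\<close>

definition simple_graph :: "('v \<Rightarrow> 'v \<Rightarrow> bool) \<Rightarrow> bool" where
  "simple_graph adj \<longleftrightarrow> symp adj \<and> irreflp adj"

definition nearest_neighbour_walk :: "('v \<Rightarrow> 'v \<Rightarrow> bool) \<Rightarrow> ('v \<Rightarrow> 'v \<Rightarrow> real) \<Rightarrow> bool" where
  "nearest_neighbour_walk adj p \<longleftrightarrow>
     (\<forall>x y. 0 \<le> p x y) \<and>
     (\<forall>x y. \<not> adj y x \<longrightarrow> p x y = 0) \<and>
     (\<forall>x. ((\<lambda>y. p x y) has_sum 1) UNIV)"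

text \<open>For a nearest neighbour walk the terms with \<open>y\<close> not adjacent to \<open>x\<close> vanish.\<close>

definition transition_op :: "('s \<Rightarrow> 's \<Rightarrow> real) \<Rightarrow> ('s \<Rightarrow> complex) \<Rightarrow> ('s \<Rightarrow> complex)" where
  "transition_op p f = (\<lambda>x. \<Sum>\<^sub>\<infinity>y. complex_of_real (p x y) * f y)"

fun n_step :: "('s \<Rightarrow> 's \<Rightarrow> real) \<Rightarrow> nat \<Rightarrow> 's \<Rightarrow> 's \<Rightarrow> real" where
  "n_step p 0 x y = (if x = y then 1 else 0)"
| "n_step p (Suc n) x y = (\<Sum>\<^sub>\<infinity>z. p x z * n_step p n z y)"

section \<open>Switch-walk-switch lamplighter walk\<close>

text \<open>The type \<open>'h\<close> is the set of lamp states and \<open>0\<close> is the state ``off''. No algebraic structure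
  on \<open>'h\<close> is involved. Configurations are the finitely supported functions, and the all-off
  configuration \<open>\<iota>\<close> is the zero function.\<close>

definition lamplighter :: "('v \<Rightarrow> 'v \<Rightarrow> bool) \<Rightarrow> ('v \<Rightarrow> 'v \<Rightarrow> real) \<Rightarrow>
  (('v \<Rightarrow>\<^sub>0 'h::{finite,zero}) \<times> 'v) \<Rightarrow> (('v \<Rightarrow>\<^sub>0 'h) \<times> 'v) \<Rightarrow> real" where
  "lamplighter adj p = (\<lambda>(\<xi>, x) (\<eta>, y).
     if adj y x \<and> (\<forall>z. z \<notin> {x, y} \<longrightarrow> Poly_Mapping.lookup \<xi> z = Poly_Mapping.lookup \<eta> z)
     then p x y / (real CARD('h))\<^sup>2 else 0)"

section \<open>Site percolation and the absorbing walk\<close>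

definition site_percolation :: "real \<Rightarrow> ('v \<Rightarrow> bool) measure" where
  "site_percolation q = (\<Pi>\<^sub>M v\<in>UNIV. measure_pmf (bernoulli_pmf q))"

definition cluster :: "('v \<Rightarrow> 'v \<Rightarrow> bool) \<Rightarrow> 'v \<Rightarrow> ('v \<Rightarrow> bool) \<Rightarrow> 'v set" where
  "cluster adj x \<omega> = {y. \<omega> x \<and> (\<lambda>u v. adj u v \<and> \<omega> u \<and> \<omega> v)\<^sup>*\<^sup>* x y}"

definition absorbing :: "('v \<Rightarrow> 'v \<Rightarrow> real) \<Rightarrow> 'v set \<Rightarrow> 'v \<Rightarrow> 'v \<Rightarrow> real" where
  "absorbing p C y z = (if y \<in> C \<and> z \<in> C then p y z else 0)"

definition cluster_spectral_measure ::
  "('v \<Rightarrow> 'v \<Rightarrow> bool) \<Rightarrow> ('v \<Rightarrow> 'v \<Rightarrow> real) \<Rightarrow> 'v \<Rightarrow> ('v \<Rightarrow> bool) \<Rightarrow> real measure" where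
  "cluster_spectral_measure adj p x \<omega> =
     spectral_measure (transition_op (absorbing p (cluster adj x \<omega>))) (indicator {x})"

definition integrated_density_of_states ::
  "('v \<Rightarrow> 'v \<Rightarrow> bool) \<Rightarrow> ('v \<Rightarrow> 'v \<Rightarrow> real) \<Rightarrow> real \<Rightarrow> 'v \<Rightarrow> real measure" where
  "integrated_density_of_states adj p q x =
     measure_of UNIV (sets borel)
       (\<lambda>B. \<integral>\<^sup>+ \<omega>. emeasure (cluster_spectral_measure adj p x \<omega>) B \<partial>site_percolation q)"

end

theory Submission
  imports Defs
begin

text \<open>Condition the lamplighter on its path. The lamps visited are rerandomized, so the probability that all
  of them are off at the end of a path visiting \<open>k\<close> vertices is \<open>m\<^sup>-\<^sup>k\<close>, which is the probability that all
  these vertices are open in percolation with parameter \<open>1 / m\<close>. Summing over closed paths gives equal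
  return probabilities.

  The return probabilities are the moments of the two measures, which live on \<open>[-1, 1]\<close> and are therefore
  determined by them. That the spectral measures exist at all is the spectral theorem: for a bounded
  selfadjoint \<open>S\<close> the functional \<open>q \<mapsto> \<langle>q(S) f, f\<rangle>\<close> on polynomials is represented by a measure \<open>\<mu>\<^sub>f\<close> (Hausdorff
  moment problem), and \<open>E(B) f\<close> is the limit of \<open>q\<^sub>n(S) f\<close> for polynomials \<open>q\<^sub>n\<close> tending to the indicator
  of \<open>B\<close> in \<open>L\<^sup>2(\<mu>\<^sub>f)\<close>.\<close>

section \<open>The Hausdorff moment problem\<close>

text \<open>The spectral measure is a definite description over all spectral resolutions, so nothing
  can be said about it before both existence and uniqueness are settled, and its dependence on the
  percolation configuration is accessible only through moments. These are return probabilities,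
  measurable as limits of finite sums. All spectral theory is done over the reals:
  \<open>ell2\<close> is a real Hilbert space under the real part of its inner product. Complex
  linearity comes back because the spectral projections commute with every bounded operator that
  commutes with \<open>S\<close>, in particular with multiplication by \<open>\<i>\<close>. Vertices
  may have infinite degree, so the sum over paths is carried out as a recursion. The starting lamps
  are averaged over a finite set \<open>A\<close> containing the walker, while the target stays the
  single all-off configuration. This average and the percolation expectation restricted to the event
  that \<open>A\<close> is open obey the same recursion in the number of steps, with
  \<open>A\<close> growing by the vertex stepped to.\<close>

lemma power_mult_binomial_eq:
  fixes x :: "'a::comm_ring_1"
  assumes "j \<le> n"
  shows "of_nat (n choose j) * x ^ j =
    (\<Sum>k\<le>n. of_nat (k choose j) * (of_nat (n choose k) * (x ^ k * (1 - x) ^ (n - k))))"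
proof -
  \<comment> \<open>The inserted factor is 1; its expansion turns the monomial into Bernstein
    polynomials. The ring is general because \<open>x\<close> will be the polynomial
    \<open>[:0, 1:]\<close>.\<close>
  have "of_nat (n choose j) * x ^ j = of_nat (n choose j) * x ^ j * (x + (1 - x)) ^ (n - j)"
    by simp
  also have "\<dots> = (\<Sum>i\<le>n - j. of_nat (n choose j) * x ^ j *
      (of_nat ((n - j) choose i) * x ^ i * (1 - x) ^ (n - j - i)))"
    by (simp only: binomial_ring sum_distrib_left)
  also have "\<dots> = (\<Sum>i\<le>n - j. of_nat ((i + j) choose j) *
      (of_nat (n choose (i + j)) * (x ^ (i + j) * (1 - x) ^ (n - (i + j)))))"
  proof (rule sum.cong[OF refl])
    fix i assume i: "i \<in> {..n - j}"
    have "(n choose (i + j)) * ((i + j) choose j) = (n choose j) * ((n - j) choose i)"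
      using choose_mult[of j "i + j" n] i assms by simp
    then have e: "of_nat ((i + j) choose j) * of_nat (n choose (i + j)) =
        (of_nat (n choose j) * of_nat ((n - j) choose i) :: 'a)"
      by (metis mult.commute of_nat_mult)
    have "of_nat (n choose j) * x ^ j *
        (of_nat ((n - j) choose i) * x ^ i * (1 - x) ^ (n - j - i)) =
        (of_nat (n choose j) * of_nat ((n - j) choose i)) * (x ^ (i + j) * (1 - x) ^ (n - (i + j)))"
      by (simp add: power_add mult_ac add.commute)
    then show "of_nat (n choose j) * x ^ j *
        (of_nat ((n - j) choose i) * x ^ i * (1 - x) ^ (n - j - i)) =
        of_nat ((i + j) choose j) *
        (of_nat (n choose (i + j)) * (x ^ (i + j) * (1 - x) ^ (n - (i + j))))"
      by (simp only: e[symmetric] mult.assoc)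
  qed
  also have "\<dots> = (\<Sum>k\<in>{j..n}. of_nat (k choose j) *
      (of_nat (n choose k) * (x ^ k * (1 - x) ^ (n - k))))"
    using assms
    by (intro sum.reindex_bij_witness[where i="\<lambda>k. k - j" and j="\<lambda>i. i + j"]) auto
  also have "\<dots> = (\<Sum>k\<le>n. of_nat (k choose j) *
      (of_nat (n choose k) * (x ^ k * (1 - x) ^ (n - k))))"
    by (intro sum.mono_neutral_left) (auto simp: binomial_eq_0)
  finally show ?thesis .
qed

text \<open>Both terms are products of \<open>j\<close> factors of modulus at most 1, so the error
  is at most the sum of the factorwise errors. The hypothesis \<open>2 * j \<le> n\<close> keeps
  \<open>(k - i) / (n - i)\<close> of modulus at most 1 even when \<open>i > k\<close>.\<close>

lemma binomial_ratio_power_bound: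
  assumes "k \<le> n" "2 * j \<le> n" "0 < n"
  shows "\<bar>real (k choose j) / real (n choose j) - (real k / real n) ^ j\<bar> \<le>
    real j * (real j / (real n - real j))"
proof -
  have "real (k choose j) / real (n choose j) = (\<Prod>i<j. (real k - real i) / (real n - real i))"
    unfolding binomial_gbinomial gbinomial_prod_rev by (simp add: prod_dividef atLeast0LessThan)
  moreover have "(real k / real n) ^ j = (\<Prod>i<j. real k / real n)"
    by simp
  moreover have "norm ((\<Prod>i<j. (real k - real i) / (real n - real i)) - (\<Prod>i<j. real k / real n)) \<le>
      (\<Sum>i<j. norm ((real k - real i) / (real n - real i) - real k / real n))"
    using assms by (intro norm_prod_diff) (auto simp: divide_le_eq)
  moreover have "(\<Sum>i<j. norm ((real k - real i) / (real n - real i) - real k / real n)) \<le>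
      (\<Sum>i<j. real j / (real n - real j))"
  proof (rule sum_mono)
    fix i assume "i \<in> {..<j}"
    then have i: "i < j" by simp
    have "(real k - real i) / (real n - real i) - real k / real n =
        - (real i / (real n - real i) * ((real n - real k) / real n))"
      using i assms by (simp add: field_simps)
    then have "norm ((real k - real i) / (real n - real i) - real k / real n) =
        real i / (real n - real i) * ((real n - real k) / real n)"
      using i assms by (simp add: abs_mult)
    also have "\<dots> \<le> real j / (real n - real j) * 1"
      using i assms by (intro mult_mono frac_le) auto
    finally show "norm ((real k - real i) / (real n - real i) - real k / real n) \<le>
        real j / (real n - real j)" by simp
  qed
  ultimately show ?thesis by simp
qed

text \<open>Agrees with the identity on \<open>{0..1}\<close> but is bounded and continuous on the
  whole line, so that its powers are test functions for weak convergence.\<close>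

definition clamp01 :: "real \<Rightarrow> real" where
  "clamp01 t = max 0 (min 1 t)"

lemma clamp01_mem: "clamp01 t \<in> {0..1}"
  by (auto simp: clamp01_def)

lemma clamp01_eq: "t \<in> {0..1} \<Longrightarrow> clamp01 t = t"
  by (auto simp: clamp01_def)

lemma isCont_clamp01: "isCont clamp01 t"
  unfolding clamp01_def by (intro continuous_intros)

lemma measurable_clamp01 [measurable]: "clamp01 \<in> borel_measurable borel"
  unfolding clamp01_def by measurable

text \<open>The approximating measures put mass \<open>L (B\<^sub>n\<^sub>,\<^sub>k)\<close> on \<open>k / n\<close>, where \<open>B\<^sub>n\<^sub>,\<^sub>k\<close> are the
  Bernstein polynomials; their \<open>j\<close>-th factorial moments are exactly \<open>L (X ^ j)\<close>.\<close>

lemma hausdorff_moment_prob: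
  fixes L :: "real poly \<Rightarrow> real"
  assumes add: "\<And>p q. L (p + q) = L p + L q"
    and smult: "\<And>c p. L (smult c p) = c * L p"
    and pos: "\<And>k l. 0 \<le> L ([:0, 1:] ^ k * [:1, -1:] ^ l)"
    and one: "L 1 = 1"
  obtains M where "prob_space M" "sets M = sets borel" "AE t in M. t \<in> {0..1}"
    "\<And>j. (\<integral>t. t ^ j \<partial>M) = L ([:0, 1:] ^ j)"
proof -
  have L_sum: "L (\<Sum>i\<in>I. g i) = (\<Sum>i\<in>I. L (g i))" if "finite I" for g and I :: "nat set"
    using that
  proof (induction I)
    case empty
    show ?case using smult[of 0 0] by simp
  qed (simp add: add)
  define w where "w n k = real (n choose k) * L ([:0, 1:] ^ k * [:1, -1:] ^ (n - k))" for n k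
  have w_nonneg: "0 \<le> w n k" for n k
    by (simp add: w_def pos)
  have w_moment: "real (n choose j) * L ([:0, 1:] ^ j) = (\<Sum>k\<le>n. real (k choose j) * w n k)"
    if "j \<le> n" for n j
  proof -
    have X: "1 - [:0, 1:] = [:1, -1::real:]"
      by (simp add: one_pCons)
    have "L (of_nat (n choose j) * [:0, 1:] ^ j) =
        L (\<Sum>k\<le>n. of_nat (k choose j) * (of_nat (n choose k) * ([:0, 1:] ^ k * [:1, -1:] ^ (n - k))))"
      using power_mult_binomial_eq[OF that, of "[:0, 1::real:]"] by (simp only: X)
    then show ?thesis
      by (simp add: L_sum w_def of_nat_poly smult mult_ac)
  qed
  have w_sum: "(\<Sum>k\<le>n. w n k) = 1" for n
    using w_moment[of 0 n] one by simp
  \<comment> \<open>The index is shifted to \<open>Suc n\<close> so that the atoms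
    \<open>k / Suc n\<close> never divide by zero.\<close>
  define \<mu> where "\<mu> n = distr (point_measure {..Suc n} (\<lambda>k. ennreal (w (Suc n) k))) borel
      (\<lambda>k. real k / real (Suc n))" for n
  have int_\<mu>: "(\<integral>t. g t \<partial>\<mu> n) = (\<Sum>k\<le>Suc n. w (Suc n) k * g (real k / real (Suc n)))"
    if "g \<in> borel_measurable borel" for n and g :: "real \<Rightarrow> real"
    unfolding \<mu>_def using that
    by (subst integral_distr) (auto simp: lebesgue_integral_point_measure_finite w_nonneg)
  have emeasure_\<mu>: "emeasure (\<mu> n) A = 1" if "A \<in> sets borel" "{0..1} \<subseteq> A" for n A
  proof -
    have "(\<lambda>k. real k / real (Suc n)) -` A \<inter> {..Suc n} = {..Suc n}"
      using that by (auto simp: subset_iff divide_simps)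
    then have "emeasure (\<mu> n) A = (\<Sum>k\<le>Suc n. ennreal (w (Suc n) k))"
      unfolding \<mu>_def using that
      by (subst emeasure_distr) (auto simp: space_point_measure emeasure_point_measure_finite)
    also have "\<dots> = 1"
      using w_sum[of "Suc n"] by (subst sum_ennreal) (auto simp: w_nonneg)
    finally show ?thesis .
  qed
  have \<mu>_distr: "real_distribution (\<mu> n)" for n
  proof -
    have "prob_space (\<mu> n)"
      using emeasure_\<mu>[of UNIV n] by (intro prob_spaceI) (simp add: \<mu>_def)
    then show ?thesis
      unfolding real_distribution_def real_distribution_axioms_def by (simp add: \<mu>_def)
  qed
  \<comment> \<open>All the mass lies in \<open>{0..1}\<close>, so one interval serves every
    \<open>n\<close>; being half-open on the left, it must start below 0 to contain the atom at
    0.\<close>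
  have "tight \<mu>"
    unfolding tight_def
  proof (intro conjI allI impI)
    fix \<epsilon> :: real assume "0 < \<epsilon>"
    show "\<exists>a b. a < b \<and> (\<forall>n. 1 - \<epsilon> < measure (\<mu> n) {a<..b})"
    proof -
      have "\<forall>n. 1 - \<epsilon> < measure (\<mu> n) {-1<..1}"
        using emeasure_\<mu>[of "{-1<..1}"] \<open>0 < \<epsilon>\<close> by (simp add: measure_def subset_eq)
      then show ?thesis
        by (metis less_numeral_extra(1) neg_less_0_iff_less order_less_trans)
    qed
  qed (rule \<mu>_distr)
  then obtain r \<nu> where r: "strict_mono r" and \<nu>: "real_distribution \<nu>"
      and conv: "weak_conv_m (\<mu> \<circ> id \<circ> r) \<nu>"
    using tight_imp_convergent_subsubsequence[of \<mu> id] by (auto simp: strict_mono_id)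
  interpret \<nu>: real_distribution \<nu> by fact
  \<comment> \<open>Clamping forces the limit onto \<open>{0..1}\<close> without a separate study of
    its support, and the moments of \<open>M\<close> become the integrals that weak convergence
    computes.\<close>
  define M where "M = distr \<nu> borel clamp01"
  have M_prob: "prob_space M"
    unfolding M_def by (rule \<nu>.prob_space_distr) simp
  moreover have M_sets: "sets M = sets borel"
    by (simp add: M_def)
  moreover have "AE t in M. t \<in> {0..1}"
    unfolding M_def by (subst AE_distr_iff) (use clamp01_mem in auto)
  moreover have "(\<integral>t. t ^ j \<partial>M) = L ([:0, 1:] ^ j)" for j
  proof -
    have "filterlim (\<lambda>n. - real j + real (Suc n)) at_infinity sequentially"
      by (rule filterlim_at_top_imp_at_infinity)
        (rule filterlim_tendsto_add_at_top[OF tendsto_const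
          filterlim_compose[OF filterlim_real_sequentially filterlim_Suc]])
    then have "(\<lambda>n. real j / (- real j + real (Suc n))) \<longlonglongrightarrow> 0"
      by (rule tendsto_divide_0[OF tendsto_const])
    then have lim: "(\<lambda>n. real j * (real j / (real (Suc n) - real j))) \<longlonglongrightarrow> 0"
      by (auto intro: tendsto_mult_right_zero simp only: diff_conv_add_uminus add.commute)
    \<comment> \<open>Ordinary moments of the approximating measures. The factorial moments are
      exact, and the difference between the two kinds is of order \<open>1 / n\<close>.\<close>
    define m where "m n = (\<Sum>k\<le>Suc n. w (Suc n) k * (real k / real (Suc n)) ^ j)" for n
    have "(\<lambda>n. \<integral>t. clamp01 t ^ j \<partial>(\<mu> \<circ> id \<circ> r) n) \<longlonglongrightarrow> (\<integral>t. clamp01 t ^ j \<partial>\<nu>)"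
    proof (rule weak_conv_imp_integral_bdd_continuous_conv[OF _ \<nu> conv])
      show "real_distribution ((\<mu> \<circ> id \<circ> r) n)" for n by (simp add: \<mu>_distr)
      show "isCont (\<lambda>t. clamp01 t ^ j) t" for t
        by (intro continuous_intros isCont_clamp01)
      show "norm (clamp01 t ^ j) \<le> 1" for t
        using clamp01_mem[of t] by (simp add: power_le_one)
    qed
    moreover have "(\<integral>t. clamp01 t ^ j \<partial>\<mu> n) = m n" for n
      unfolding m_def
      by (subst int_\<mu>) (auto intro!: sum.cong simp: clamp01_eq divide_simps)
    moreover have "(\<lambda>n. m n - L ([:0, 1:] ^ j)) \<longlonglongrightarrow> 0"
    proof (rule Lim_null_comparison)
      show "\<forall>\<^sub>F n in sequentially. norm (m n - L ([:0, 1:] ^ j)) \<le> real j * (real j / (real (Suc n) - real j))"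
      proof (rule eventually_sequentiallyI[of "2 * j"])
        fix n assume n: "2 * j \<le> n"
        have "L ([:0, 1:] ^ j) = (\<Sum>k\<le>Suc n. real (k choose j) * w (Suc n) k) / real (Suc n choose j)"
          using w_moment[of j "Suc n"] n by (simp del: binomial_Suc_n add: divide_simps mult.commute)
        also have "\<dots> = (\<Sum>k\<le>Suc n. w (Suc n) k * (real (k choose j) / real (Suc n choose j)))"
          by (simp only: sum_divide_distrib) (simp add: mult.commute)
        finally have eq: "m n - L ([:0, 1:] ^ j) = - (\<Sum>k\<le>Suc n. w (Suc n) k *
            (real (k choose j) / real (Suc n choose j) - (real k / real (Suc n)) ^ j))"
          by (simp only: m_def sum_subtractf[symmetric] sum_negf[symmetric])
            (auto intro!: sum.cong simp: right_diff_distrib)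
        have "norm (m n - L ([:0, 1:] ^ j)) \<le> (\<Sum>k\<le>Suc n. norm (w (Suc n) k *
            (real (k choose j) / real (Suc n choose j) - (real k / real (Suc n)) ^ j)))"
          by (simp only: eq norm_minus_cancel norm_sum)
        also have "\<dots> \<le> (\<Sum>k\<le>Suc n. w (Suc n) k * (real j * (real j / (real (Suc n) - real j))))"
        proof (rule sum_mono)
          fix k assume "k \<in> {..Suc n}"
          then show "norm (w (Suc n) k * (real (k choose j) / real (Suc n choose j) - (real k / real (Suc n)) ^ j))
              \<le> w (Suc n) k * (real j * (real j / (real (Suc n) - real j)))"
            using binomial_ratio_power_bound[of k "Suc n" j] n w_nonneg[of "Suc n" k]
            unfolding real_norm_def abs_mult by (intro mult_mono) auto
        qed
        also have "\<dots> = real j * (real j / (real (Suc n) - real j))"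
          by (simp only: sum_distrib_right[symmetric] w_sum)
        finally show "norm (m n - L ([:0, 1:] ^ j)) \<le> real j * (real j / (real (Suc n) - real j))" .
      qed
      show "(\<lambda>n. real j * (real j / (real (Suc n) - real j))) \<longlonglongrightarrow> 0"
        by (rule lim)
    qed
    then have "m \<longlonglongrightarrow> L ([:0, 1:] ^ j)"
      by (simp add: LIM_zero_iff)
    then have "(\<lambda>n. m (r n)) \<longlonglongrightarrow> L ([:0, 1:] ^ j)"
      using LIMSEQ_subseq_LIMSEQ[OF _ r] by (simp add: o_def)
    ultimately have "(\<integral>t. clamp01 t ^ j \<partial>\<nu>) = L ([:0, 1:] ^ j)"
      by (intro LIMSEQ_unique[of "\<lambda>n. m (r n)"]) simp_all
    then show ?thesis
      unfolding M_def by (subst integral_distr) auto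
  qed
  ultimately show ?thesis by (rule that)
qed

section \<open>Polynomial approximation of compactly supported measures\<close>

text \<open>Boundedness is asked only on \<open>{-a..a}\<close>, where the measures live, so that
  polynomials qualify.\<close>

definition bounded_borel_on :: "real \<Rightarrow> (real \<Rightarrow> real) \<Rightarrow> bool" where
  "bounded_borel_on a h \<longleftrightarrow> h \<in> borel_measurable borel \<and> (\<exists>C. \<forall>t. \<bar>t\<bar> \<le> a \<longrightarrow> \<bar>h t\<bar> \<le> C)"

definition supported_measure :: "real \<Rightarrow> real measure \<Rightarrow> bool" where
  "supported_measure a M \<longleftrightarrow> finite_measure M \<and> sets M = sets borel \<and> (AE t in M. \<bar>t\<bar> \<le> a)"

lemma supported_measureD:
  assumes "supported_measure a M"
  shows "finite_measure M" "sets M = sets borel" "AE t in M. \<bar>t\<bar> \<le> a" "space M = UNIV"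
  using assms sets_eq_imp_space_eq[of M borel] by (auto simp: supported_measure_def)

lemma supported_measure_mono: "supported_measure a M \<Longrightarrow> a \<le> b \<Longrightarrow> supported_measure b M"
  unfolding supported_measure_def by (auto elim!: eventually_mono)

lemma bounded_borel_onI:
  "h \<in> borel_measurable borel \<Longrightarrow> (\<And>t. \<bar>t\<bar> \<le> a \<Longrightarrow> \<bar>h t\<bar> \<le> C) \<Longrightarrow> bounded_borel_on a h"
  by (auto simp: bounded_borel_on_def)

lemma bounded_borel_on_const: "bounded_borel_on a (\<lambda>t. c)"
  by (rule bounded_borel_onI[of _ _ "\<bar>c\<bar>"]) auto

lemma bounded_borel_on_indicator: "B \<in> sets borel \<Longrightarrow> bounded_borel_on a (indicator B)"
  by (rule bounded_borel_onI[of _ _ 1]) (auto simp: indicator_def)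

lemma bounded_borel_on_add:
  assumes "bounded_borel_on a f" "bounded_borel_on a g"
  shows "bounded_borel_on a (\<lambda>t. f t + g t)"
proof -
  obtain C D where "\<And>t. \<bar>t\<bar> \<le> a \<Longrightarrow> \<bar>f t\<bar> \<le> C" "\<And>t. \<bar>t\<bar> \<le> a \<Longrightarrow> \<bar>g t\<bar> \<le> D"
    using assms unfolding bounded_borel_on_def by blast
  then show ?thesis
    using assms by (intro bounded_borel_onI[of _ _ "C + D"]) (fastforce simp: bounded_borel_on_def)+
qed

lemma bounded_borel_on_mult:
  assumes "bounded_borel_on a f" "bounded_borel_on a g"
  shows "bounded_borel_on a (\<lambda>t. f t * g t)"
proof -
  obtain C D where "\<And>t. \<bar>t\<bar> \<le> a \<Longrightarrow> \<bar>f t\<bar> \<le> C" "\<And>t. \<bar>t\<bar> \<le> a \<Longrightarrow> \<bar>g t\<bar> \<le> D"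
    using assms unfolding bounded_borel_on_def by blast
  then have "\<bar>f t * g t\<bar> \<le> C * D" if "\<bar>t\<bar> \<le> a" for t
    using that by (simp add: abs_mult mult_mono')
  then show ?thesis
    using assms by (intro bounded_borel_onI[of _ _ "C * D"]) (auto simp: bounded_borel_on_def)
qed

lemma bounded_borel_on_diff:
  assumes "bounded_borel_on a f" "bounded_borel_on a g"
  shows "bounded_borel_on a (\<lambda>t. f t - g t)"
  using bounded_borel_on_add[OF assms(1) bounded_borel_on_mult[OF bounded_borel_on_const[of a "-1"] assms(2)]]
  by simp

lemma bounded_borel_on_continuous:
  assumes "continuous_on UNIV f"
  shows "bounded_borel_on a f"
proof -
  have "compact (f ` {-a..a})"
    using assms by (intro compact_continuous_image) (auto intro: continuous_on_subset)
  then obtain C where C: "\<forall>t\<in>{-a..a}. norm (f t) \<le> C"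
    by (meson bounded_iff compact_imp_bounded imageI)
  show ?thesis
    using C by (intro bounded_borel_onI[of _ _ C] borel_measurable_continuous_onI assms) (auto simp: abs_le_iff)
qed

lemma bounded_borel_on_poly: "bounded_borel_on a (poly q)"
  by (intro bounded_borel_on_continuous continuous_intros)

lemmas bounded_borel_on_intros = bounded_borel_on_const bounded_borel_on_indicator
  bounded_borel_on_add bounded_borel_on_mult bounded_borel_on_diff bounded_borel_on_poly

lemma bounded_borel_on_integrable:
  assumes "supported_measure a M" "bounded_borel_on a h"
  shows "integrable M h"
proof -
  interpret finite_measure M using supported_measureD(1)[OF assms(1)] .
  obtain C where C: "\<And>t. \<bar>t\<bar> \<le> a \<Longrightarrow> \<bar>h t\<bar> \<le> C" and h: "h \<in> borel_measurable borel"
    using assms(2) unfolding bounded_borel_on_def by blast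
  have "h \<in> borel_measurable M"
    using h by (subst measurable_cong_sets[OF supported_measureD(2)[OF assms(1)] refl])
  moreover have "AE t in M. norm (h t) \<le> C"
    using supported_measureD(3)[OF assms(1)] by eventually_elim (simp add: C)
  ultimately show ?thesis by (intro integrable_const_bound)
qed

lemma integral_poly_moments:
  assumes M: "supported_measure a M"
  shows "(\<integral>t. poly q t \<partial>M) = (\<Sum>i\<le>degree q. coeff q i * (\<integral>t. t ^ i \<partial>M))"
proof -
  have "(\<integral>t. poly q t \<partial>M) = (\<integral>t. (\<Sum>i\<le>degree q. coeff q i * t ^ i) \<partial>M)"
    by (simp add: poly_altdef)
  also have "\<dots> = (\<Sum>i\<le>degree q. coeff q i * (\<integral>t. t ^ i \<partial>M))"
  proof (subst Bochner_Integration.integral_sum)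
    fix i
    have "(\<lambda>t. coeff q i * t ^ i) = poly (monom (coeff q i) i)"
      by (auto simp: poly_monom)
    then show "integrable M (\<lambda>t. coeff q i * t ^ i)"
      using bounded_borel_on_integrable[OF M bounded_borel_on_poly] by metis
  qed simp
  finally show ?thesis .
qed

text \<open>Replaces Minkowski's inequality at the cost of a factor 2, which is why tolerances are
  split into quarters below. The gap between the two integrands is the square of
  \<open>f t + h t - 2 * g t\<close>.\<close>

lemma integral_sq_diff_triangle:
  assumes M: "supported_measure a M"
    and f: "bounded_borel_on a f" and g: "bounded_borel_on a g" and h: "bounded_borel_on a h"
  shows "(\<integral>t. (f t - h t)\<^sup>2 \<partial>M) \<le> 2 * (\<integral>t. (f t - g t)\<^sup>2 \<partial>M) + 2 * (\<integral>t. (g t - h t)\<^sup>2 \<partial>M)"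
proof -
  have i: "integrable M (\<lambda>t. (u t - v t)\<^sup>2)" if "bounded_borel_on a u" "bounded_borel_on a v" for u v
    unfolding power2_eq_square
    by (intro bounded_borel_on_integrable[OF M] bounded_borel_on_intros that)
  have "(f t - h t)\<^sup>2 \<le> 2 * (f t - g t)\<^sup>2 + 2 * (g t - h t)\<^sup>2" for t
    using zero_le_power2[of "f t + h t - 2 * g t"] by (simp add: power2_eq_square algebra_simps)
  then have "(\<integral>t. (f t - h t)\<^sup>2 \<partial>M) \<le> (\<integral>t. 2 * (f t - g t)\<^sup>2 + 2 * (g t - h t)\<^sup>2 \<partial>M)"
    by (intro integral_mono) (auto intro!: i f g h)
  also have "\<dots> = 2 * (\<integral>t. (f t - g t)\<^sup>2 \<partial>M) + 2 * (\<integral>t. (g t - h t)\<^sup>2 \<partial>M)"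
    by (simp add: i f g h)
  finally show ?thesis .
qed

text \<open>One polynomial serves all measures in \<open>I\<close> at once: linearity and symmetry
  of the spectral projections compare several vectors, whose measures must share an approximating
  sequence.\<close>

definition poly_approximable :: "real measure set \<Rightarrow> (real \<Rightarrow> real) \<Rightarrow> bool" where
  "poly_approximable I h \<longleftrightarrow> (\<forall>e>0. \<exists>q. \<forall>M\<in>I. (\<integral>t. (poly q t - h t)\<^sup>2 \<partial>M) < e)"

lemma poly_approximable_limit:
  assumes "finite I" and I: "\<And>M. M \<in> I \<Longrightarrow> supported_measure a M"
    and g: "\<And>k. bounded_borel_on a (g k)" "\<And>k. poly_approximable I (g k)"
    and h: "bounded_borel_on a h"
    and lim: "\<And>M. M \<in> I \<Longrightarrow> (\<lambda>k::nat. \<integral>t. (g k t - h t)\<^sup>2 \<partial>M) \<longlonglongrightarrow> 0"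
  shows "poly_approximable I h"
  unfolding poly_approximable_def
proof (intro allI impI)
  fix e :: real assume e: "0 < e"
  have "\<forall>\<^sub>F k in sequentially. \<forall>M\<in>I. (\<integral>t. (g k t - h t)\<^sup>2 \<partial>M) < e / 4"
    using \<open>finite I\<close> e order_tendstoD(2)[OF lim, of _ "e / 4"]
    by (subst eventually_ball_finite_distrib) auto
  then obtain k where k: "\<And>M. M \<in> I \<Longrightarrow> (\<integral>t. (g k t - h t)\<^sup>2 \<partial>M) < e / 4"
    unfolding eventually_sequentially by blast
  obtain q where q: "\<And>M. M \<in> I \<Longrightarrow> (\<integral>t. (poly q t - g k t)\<^sup>2 \<partial>M) < e / 4"
    using g(2)[of k] e unfolding poly_approximable_def by (elim allE[of _ "e / 4"]) auto
  have "(\<integral>t. (poly q t - h t)\<^sup>2 \<partial>M) < e" if "M \<in> I" for M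
    using integral_sq_diff_triangle[OF I[OF that] bounded_borel_on_poly[of a q] g(1)[of k] h] k[OF that] q[OF that]
    by simp
  then show "\<exists>q. \<forall>M\<in>I. (\<integral>t. (poly q t - h t)\<^sup>2 \<partial>M) < e" by blast
qed

lemma poly_approximable_dominated:
  assumes "finite I" and I: "\<And>M. M \<in> I \<Longrightarrow> supported_measure a M"
    and g: "\<And>k. g k \<in> borel_measurable borel" "\<And>k. poly_approximable I (g k)"
    and h: "h \<in> borel_measurable borel"
    and bound: "\<And>k t. \<bar>g k t\<bar> \<le> C" "\<And>t. \<bar>h t\<bar> \<le> C"
    and lim: "\<And>t. (\<lambda>k::nat. g k t) \<longlonglongrightarrow> h t"
  shows "poly_approximable I h"
proof (rule poly_approximable_limit[OF assms(1) I])
  show gb: "bounded_borel_on a (g k)" for k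
    using g(1) bound(1) by (rule bounded_borel_onI)
  show hb: "bounded_borel_on a h"
    using h bound(2) by (rule bounded_borel_onI)
  fix M assume M: "M \<in> I"
  interpret finite_measure M using supported_measureD(1)[OF I[OF M]] .
  have meas: "f \<in> borel_measurable M" if "f \<in> borel_measurable borel" for f :: "real \<Rightarrow> real"
    using that by (subst measurable_cong_sets[OF supported_measureD(2)[OF I[OF M]] refl])
  have "(\<lambda>k. \<integral>t. (g k t - h t)\<^sup>2 \<partial>M) \<longlonglongrightarrow> (\<integral>t. 0 \<partial>M)"
  proof (rule integral_dominated_convergence[where w="\<lambda>_. (2 * C)\<^sup>2"])
    show "AE t in M. (\<lambda>k. (g k t - h t)\<^sup>2) \<longlonglongrightarrow> 0"
      using tendsto_power[OF LIM_zero[OF lim], of _ 2] by simp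
    show "AE t in M. norm ((g k t - h t)\<^sup>2) \<le> (2 * C)\<^sup>2" for k
    proof (rule AE_I2)
      fix t
      have "\<bar>g k t - h t\<bar> \<le> 2 * C"
        using bound(1)[of k t] bound(2)[of t] by linarith
      then show "norm ((g k t - h t)\<^sup>2) \<le> (2 * C)\<^sup>2"
        using power_mono[of "\<bar>g k t - h t\<bar>" "2 * C" 2] by simp
    qed
  qed (auto intro!: meas borel_measurable_power borel_measurable_diff g(1) h)
  then show "(\<lambda>k. \<integral>t. (g k t - h t)\<^sup>2 \<partial>M) \<longlonglongrightarrow> 0" by simp
qed (use g(2) in auto)

text \<open>Weierstrass on \<open>{-a..a}\<close>. The sequence is chosen before the measure, and
  this uniformity is what carries measurability from moments to integrals of continuous functions
  when the measure is random.\<close>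

lemma continuous_poly_seq:
  assumes h: "continuous_on UNIV h"
  obtains q where "\<And>M. supported_measure a M \<Longrightarrow> (\<lambda>k. \<integral>t. (poly (q k) t - h t)\<^sup>2 \<partial>M) \<longlonglongrightarrow> 0"
proof -
  have "\<exists>q. \<forall>t\<in>{-a..a}. \<bar>h t - poly q t\<bar> < inverse (real (Suc k))" for k
  proof -
    have "continuous_on {-a..a} h"
      using h continuous_on_subset by blast
    then obtain g where "real_polynomial_function g"
        and g: "\<And>t. t \<in> {-a..a} \<Longrightarrow> \<bar>h t - g t\<bar> < inverse (real (Suc k))"
      by (rule Stone_Weierstrass_real_polynomial_function[OF compact_Icc, of _ _ _ "inverse (real (Suc k))"]) auto
    then obtain c n where "g = (\<lambda>x. \<Sum>i\<le>n. c i * x ^ i)"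
      using real_polynomial_function_iff_sum by blast
    then have "g t = poly (\<Sum>i\<le>n. monom (c i) i) t" for t
      by (simp add: poly_sum poly_monom)
    with g show ?thesis by metis
  qed
  then obtain q where q: "\<And>k t. t \<in> {-a..a} \<Longrightarrow> \<bar>h t - poly (q k) t\<bar> < inverse (real (Suc k))"
    by metis
  show ?thesis
  proof (rule that[of q])
    fix M assume M: "supported_measure a M"
    interpret finite_measure M using supported_measureD(1)[OF M] .
    show "(\<lambda>k. \<integral>t. (poly (q k) t - h t)\<^sup>2 \<partial>M) \<longlonglongrightarrow> 0"
    proof (rule tendsto_sandwich[OF always_eventually always_eventually tendsto_const])
      show "\<forall>k. (\<integral>t. (poly (q k) t - h t)\<^sup>2 \<partial>M) \<le> (inverse (real (Suc k)))\<^sup>2 * measure M UNIV"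
      proof
        fix k
        have "(\<integral>t. (poly (q k) t - h t)\<^sup>2 \<partial>M) \<le> (\<integral>t. (inverse (real (Suc k)))\<^sup>2 \<partial>M)"
        proof (rule integral_mono_AE)
          show "integrable M (\<lambda>t. (poly (q k) t - h t)\<^sup>2)"
            unfolding power2_eq_square
            by (intro bounded_borel_on_integrable[OF M] bounded_borel_on_intros
                bounded_borel_on_continuous h)
          show "AE t in M. (poly (q k) t - h t)\<^sup>2 \<le> (inverse (real (Suc k)))\<^sup>2"
            using supported_measureD(3)[OF M]
          proof eventually_elim
            case (elim t)
            then have "\<bar>poly (q k) t - h t\<bar> \<le> inverse (real (Suc k))"
              using q[of t k] by (simp add: abs_minus_commute abs_le_iff[of t] del: of_nat_Suc)
            then show ?case
              by (subst power2_le_iff_abs_le) auto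
          qed
        qed simp
        then show "(\<integral>t. (poly (q k) t - h t)\<^sup>2 \<partial>M) \<le> (inverse (real (Suc k)))\<^sup>2 * measure M UNIV"
          by (simp add: supported_measureD(4)[OF M] mult.commute)
      qed
      have "(\<lambda>k. (inverse (real (Suc k)))\<^sup>2 * measure M UNIV) \<longlonglongrightarrow> 0\<^sup>2 * measure M UNIV"
        by (intro tendsto_intros LIMSEQ_inverse_real_of_nat)
      then show "(\<lambda>k. (inverse (real (Suc k)))\<^sup>2 * measure M UNIV) \<longlonglongrightarrow> 0" by simp
    qed simp
  qed
qed

lemma poly_approximable_continuous:
  assumes "finite I" and I: "\<And>M. M \<in> I \<Longrightarrow> supported_measure a M"
    and h: "continuous_on UNIV h"
  shows "poly_approximable I h"
proof -
  obtain q where q: "\<And>M. supported_measure a M \<Longrightarrow> (\<lambda>k. \<integral>t. (poly (q k) t - h t)\<^sup>2 \<partial>M) \<longlonglongrightarrow> 0"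
    using continuous_poly_seq[OF h] by blast
  show ?thesis
  proof (rule poly_approximable_limit[OF assms(1) I, where g="\<lambda>k. poly (q k)"])
    show "poly_approximable I (poly (q k))" for k
      unfolding poly_approximable_def by (intro allI impI exI[of _ "q k"]) simp
  qed (auto intro: bounded_borel_on_poly bounded_borel_on_continuous h q I)
qed

lemma poly_approximable_add:
  assumes I: "\<And>M. M \<in> I \<Longrightarrow> supported_measure a M"
    and f: "bounded_borel_on a f" "poly_approximable I f"
    and g: "bounded_borel_on a g" "poly_approximable I g"
  shows "poly_approximable I (\<lambda>t. f t + g t)"
  unfolding poly_approximable_def
proof (intro allI impI)
  fix e :: real assume e: "0 < e"
  obtain p where p: "\<And>M. M \<in> I \<Longrightarrow> (\<integral>t. (poly p t - f t)\<^sup>2 \<partial>M) < e / 4"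
    using f(2) e unfolding poly_approximable_def by (elim allE[of _ "e / 4"]) auto
  obtain q where q: "\<And>M. M \<in> I \<Longrightarrow> (\<integral>t. (poly q t - g t)\<^sup>2 \<partial>M) < e / 4"
    using g(2) e unfolding poly_approximable_def by (elim allE[of _ "e / 4"]) auto
  have "(\<integral>t. (poly (p + q) t - (f t + g t))\<^sup>2 \<partial>M) < e" if "M \<in> I" for M
  proof -
    have "(\<integral>t. (poly (p + q) t - (f t + g t))\<^sup>2 \<partial>M) \<le>
        2 * (\<integral>t. (poly (p + q) t - (f t + poly q t))\<^sup>2 \<partial>M) +
        2 * (\<integral>t. ((f t + poly q t) - (f t + g t))\<^sup>2 \<partial>M)"
      by (intro integral_sq_diff_triangle[OF I[OF that]] bounded_borel_on_intros f g)
    also have "\<dots> < e"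
      using p[OF that] q[OF that] by simp
    finally show ?thesis .
  qed
  then show "\<exists>q. \<forall>M\<in>I. (\<integral>t. (poly q t - (f t + g t))\<^sup>2 \<partial>M) < e" by blast
qed

lemma tendsto_cts_step: "(\<lambda>k. cts_step c (c + inverse (real (Suc k))) t) \<longlonglongrightarrow> indicator {..c} t"
proof (cases "t \<le> c")
  case True
  then show ?thesis by (simp add: cts_step_def)
next
  case False
  then have "\<forall>\<^sub>F k in sequentially. inverse (real (Suc k)) < t - c"
    using order_tendstoD(2)[OF LIMSEQ_inverse_real_of_nat, of "t - c"] by simp
  then have "\<forall>\<^sub>F k in sequentially. cts_step c (c + inverse (real (Suc k))) t = indicator {..c} t"
    by eventually_elim (use False in \<open>auto simp: cts_step_def\<close>)
  then show ?thesis
    by (rule tendsto_eventually)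
qed

lemma cts_step_bounded: "c < d \<Longrightarrow> \<bar>cts_step c d t\<bar> \<le> 1"
  by (auto simp: cts_step_def divide_simps)

lemma continuous_on_cts_step: "c < d \<Longrightarrow> continuous_on UNIV (cts_step c d)"
  by (intro uniformly_continuous_imp_continuous cts_step_uniformly_continuous)

text \<open>A Dynkin system argument. Half-lines are limits of the continuous functions
  \<open>cts_step\<close>, complements correspond to \<open>1 - q\<close>, and disjoint unions to
  finite sums followed by dominated convergence.\<close>

theorem poly_approximable_indicator:
  assumes "finite I" and I: "\<And>M. M \<in> I \<Longrightarrow> supported_measure a M"
    and B: "B \<in> sets borel"
  shows "poly_approximable I (indicator B)"
proof -
  have sets: "A \<in> sets borel" if "A \<in> sigma_sets UNIV (range (\<lambda>c::real. {..c}))" for A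
    using that by (simp add: borel_eq_atMost)
  have "Int_stable (range (\<lambda>c::real. {..c}))"
    by (auto simp: Int_stable_def)
  moreover have "range (\<lambda>c::real. {..c}) \<subseteq> Pow UNIV"
    by simp
  moreover have "B \<in> sigma_sets UNIV (range (\<lambda>c::real. {..c}))"
    using B by (simp add: borel_eq_atMost)
  ultimately show ?thesis
  proof (induction rule: sigma_sets_induct_disjoint[consumes 3])
    case (basic A)
    then obtain c where A: "A = {..c}" by auto
    show ?case
      unfolding A
    proof (rule poly_approximable_dominated[OF assms(1) I, where C=1])
      show "(\<lambda>k. cts_step c (c + inverse (real (Suc k))) t) \<longlonglongrightarrow> indicator {..c} t" for t
        by (rule tendsto_cts_step)
      show "cts_step c (c + inverse (real (Suc k))) \<in> borel_measurable borel" for k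
        by (intro borel_measurable_continuous_onI continuous_on_cts_step) simp
      show "poly_approximable I (cts_step c (c + inverse (real (Suc k))))" for k
        by (intro poly_approximable_continuous[OF assms(1) I] continuous_on_cts_step) simp_all
    qed (auto intro!: cts_step_bounded)
  next
    case empty
    show ?case unfolding poly_approximable_def by (intro allI impI exI[of _ 0]) simp
  next
    case (compl A)
    show ?case
      unfolding poly_approximable_def
    proof (intro allI impI)
      fix e :: real assume "0 < e"
      then obtain q where q: "\<And>M. M \<in> I \<Longrightarrow> (\<integral>t. (poly q t - indicator A t)\<^sup>2 \<partial>M) < e"
        using compl.IH unfolding poly_approximable_def by blast
      have "(poly (1 - q) t - indicator (UNIV - A) t)\<^sup>2 = (poly q t - indicator A t)\<^sup>2" for t
        by (auto simp: indicator_def power2_eq_square algebra_simps)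
      with q have "\<forall>M\<in>I. (\<integral>t. (poly (1 - q) t - indicator (UNIV - A) t)\<^sup>2 \<partial>M) < e"
        by simp
      then show "\<exists>q. \<forall>M\<in>I. (\<integral>t. (poly q t - indicator (UNIV - A) t)\<^sup>2 \<partial>M) < e" ..
    qed
  next
    case (union A)
    have A: "A i \<in> sets borel" for i
      using union.hyps sets by blast
    show ?case
    proof (rule poly_approximable_dominated[OF assms(1) I, where C=1])
      show "poly_approximable I (indicator (\<Union>i<k. A i))" for k
      proof (induction k)
        case 0
        show ?case unfolding poly_approximable_def by (intro allI impI exI[of _ 0]) simp
      next
        case (Suc k)
        have "A k \<inter> (\<Union>i<k. A i) = {}"
        proof -
          have "A k \<inter> A i = {}" if "i < k" for i
            using disjoint_family_onD[OF union.hyps(1), of k i] that by simp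
          then show ?thesis by blast
        qed
        then have "indicator (\<Union>i<Suc k. A i) = (\<lambda>t. indicator (A k) t + indicator (\<Union>i<k. A i) t :: real)"
          by (simp add: lessThan_Suc indicator_add)
        then show ?case
          using poly_approximable_add[OF I bounded_borel_on_indicator[OF A] union.IH
              bounded_borel_on_indicator Suc] A by auto
      qed
      show "(\<lambda>k. indicator (\<Union>i<k. A i) t :: real) \<longlonglongrightarrow> indicator (\<Union>i. A i) t" for t
        by (rule LIMSEQ_indicator_UN)
    qed (use A in \<open>auto simp: indicator_def\<close>)
  qed
qed

lemma poly_indicator_seq:
  assumes "finite I" and I: "\<And>M. M \<in> I \<Longrightarrow> supported_measure a M" and B: "B \<in> sets borel"
  obtains q where "\<And>M. M \<in> I \<Longrightarrow> (\<lambda>n. \<integral>t. (poly (q n) t - indicator B t)\<^sup>2 \<partial>M) \<longlonglongrightarrow> 0"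
proof -
  have "\<exists>q. \<forall>M\<in>I. (\<integral>t. (poly q t - indicator B t)\<^sup>2 \<partial>M) < inverse (real (Suc n))" for n
    using poly_approximable_indicator[OF assms] unfolding poly_approximable_def by simp
  then obtain q where q: "\<And>n M. M \<in> I \<Longrightarrow> (\<integral>t. (poly (q n) t - indicator B t)\<^sup>2 \<partial>M) < inverse (real (Suc n))"
    by metis
  show ?thesis
  proof (rule that[of q])
    fix M assume "M \<in> I"
    then show "(\<lambda>n. \<integral>t. (poly (q n) t - indicator B t)\<^sup>2 \<partial>M) \<longlonglongrightarrow> 0"
      by (intro tendsto_sandwich[OF always_eventually always_eventually tendsto_const
            LIMSEQ_inverse_real_of_nat]) (use q in \<open>auto intro: less_imp_le simp del: of_nat_Suc\<close>)
  qed
qed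

text \<open>A weighted inequality between arithmetic and geometric mean stands in for
  Cauchy-Schwarz: the weight \<open>d\<close> makes the term with the square of \<open>f\<close>
  small, and mean square convergence then takes care of the other term.\<close>

lemma tendsto_integral_mult_L2:
  assumes M: "supported_measure a M" and h: "\<And>n. bounded_borel_on a (h n)" and g: "bounded_borel_on a g"
    and f: "bounded_borel_on a f"
    and lim: "(\<lambda>n. \<integral>t. (h n t - g t)\<^sup>2 \<partial>M) \<longlonglongrightarrow> 0"
  shows "(\<lambda>n. \<integral>t. f t * h n t \<partial>M) \<longlonglongrightarrow> (\<integral>t. f t * g t \<partial>M)"
proof (rule LIMSEQ_I)
  fix e :: real assume e: "0 < e"
  define U where "U = (\<integral>t. (f t)\<^sup>2 \<partial>M)"
  have U: "0 \<le> U" by (simp add: U_def)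
  \<comment> \<open>\<open>U + 1\<close> because \<open>U\<close> may vanish. The two error terms,
    \<open>d * U\<close> and the mean square divided by \<open>d\<close>, each get half of
    \<open>e\<close>.\<close>
  define d where "d = e / (2 * (U + 1))"
  have d: "0 < d" "d * U \<le> e / 2"
    using e U by (simp_all add: d_def field_simps)
  have "0 < d * (e / 2)"
    using d(1) e by simp
  then obtain N where N: "\<And>n. N \<le> n \<Longrightarrow> norm (\<integral>t. (h n t - g t)\<^sup>2 \<partial>M) < d * (e / 2)"
    using LIMSEQ_D[OF lim \<open>0 < d * (e / 2)\<close>] by (auto simp only: diff_zero)
  have amgm: "\<bar>x * y\<bar> \<le> d * x\<^sup>2 + y\<^sup>2 / d" for x y
  proof -
    have "0 \<le> (d * \<bar>x\<bar> - \<bar>y\<bar>)\<^sup>2" "0 \<le> d * \<bar>x\<bar> * \<bar>y\<bar>"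
      using d(1) by simp_all
    then have "d * \<bar>x\<bar> * \<bar>y\<bar> \<le> (d * \<bar>x\<bar>)\<^sup>2 + \<bar>y\<bar>\<^sup>2"
      unfolding power2_diff by linarith
    then have "d * \<bar>x * y\<bar> \<le> d * (d * x\<^sup>2 + y\<^sup>2 / d)"
      using d(1) by (simp add: abs_mult power2_eq_square algebra_simps)
    then show ?thesis
      using d(1) by simp
  qed
  have "norm ((\<integral>t. f t * h n t \<partial>M) - (\<integral>t. f t * g t \<partial>M)) < e" if n: "N \<le> n" for n
  proof -
    have int: "integrable M (\<lambda>t. f t * h n t)" "integrable M (\<lambda>t. f t * g t)"
        "integrable M (\<lambda>t. f t * (h n t - g t))" "integrable M (\<lambda>t. (f t)\<^sup>2)"
        "integrable M (\<lambda>t. (h n t - g t)\<^sup>2)"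
      unfolding power2_eq_square
      by (intro bounded_borel_on_integrable[OF M] bounded_borel_on_intros h f g)+
    have "(\<integral>t. f t * h n t \<partial>M) - (\<integral>t. f t * g t \<partial>M) = (\<integral>t. f t * (h n t - g t) \<partial>M)"
      using int by (simp add: right_diff_distrib)
    also have "norm \<dots> \<le> (\<integral>t. norm (f t * (h n t - g t)) \<partial>M)"
      by (rule integral_norm_bound)
    also have "\<dots> \<le> (\<integral>t. d * (f t)\<^sup>2 + (h n t - g t)\<^sup>2 / d \<partial>M)"
      unfolding real_norm_def
      by (intro integral_mono amgm integrable_abs int Bochner_Integration.integrable_add
          integrable_mult_right integrable_divide)
    also have "\<dots> = d * U + (\<integral>t. (h n t - g t)\<^sup>2 \<partial>M) / d"
      using int by (simp add: U_def)
    also have "\<dots> < e / 2 + e / 2"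
      using N[OF n] d by (intro add_le_less_mono) (simp_all add: pos_divide_less_eq mult.commute)
    finally show ?thesis by simp
  qed
  then show "\<exists>N. \<forall>n\<ge>N. norm ((\<integral>t. f t * h n t \<partial>M) - (\<integral>t. f t * g t \<partial>M)) < e" by blast
qed

text \<open>Determinacy of the moment problem on a compact interval: polynomials that approximate
  the indicator of \<open>B\<close> in mean square for both measures at once carry equality from
  polynomials to \<open>B\<close>.\<close>

theorem supported_measure_eqI:
  assumes M: "supported_measure a M" and N: "supported_measure a N"
    and eq: "\<And>q. (\<integral>t. poly q t \<partial>M) = (\<integral>t. poly q t \<partial>N)"
  shows "M = N"
proof (rule measure_eqI)
  show "sets M = sets N"
    using supported_measureD(2)[OF M] supported_measureD(2)[OF N] by simp
  fix B assume "B \<in> sets M"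
  then have B: "B \<in> sets borel"
    using supported_measureD(2)[OF M] by simp
  interpret M: finite_measure M using supported_measureD(1)[OF M] .
  interpret N: finite_measure N using supported_measureD(1)[OF N] .
  obtain q where q: "\<And>K. K \<in> {M, N} \<Longrightarrow> (\<lambda>n. \<integral>t. (poly (q n) t - indicator B t)\<^sup>2 \<partial>K) \<longlonglongrightarrow> 0"
    by (rule poly_indicator_seq[of "{M, N}" a B]) (use M N B in auto)
  have "(\<lambda>n. \<integral>t. 1 * poly (q n) t \<partial>K) \<longlonglongrightarrow> (\<integral>t. 1 * indicator B t \<partial>K)" if "K \<in> {M, N}" for K
    by (rule tendsto_integral_mult_L2[OF _ _ _ _ q[OF that], of a])
      (use that M N B in \<open>auto intro: bounded_borel_on_intros\<close>)
  then have lim: "(\<lambda>n. \<integral>t. poly (q n) t \<partial>K) \<longlonglongrightarrow> measure K B" if "K \<in> {M, N}" for K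
    using that supported_measureD(2)[OF M] supported_measureD(2)[OF N] B
    by (fastforce simp: supported_measureD(4)[OF M] supported_measureD(4)[OF N])
  have "measure M B = measure N B"
    using lim[of M] lim[of N] eq LIMSEQ_unique by auto
  then show "emeasure M B = emeasure N B"
    by (simp add: M.emeasure_eq_measure N.emeasure_eq_measure)
qed

section \<open>The spectral theorem in a real Hilbert space\<close>

text \<open>Horner's scheme for \<open>p(S) f\<close>, which makes the algebraic identities
  inductions along \<open>pCons\<close>.\<close>

definition poly_op :: "('a::real_vector \<Rightarrow> 'a) \<Rightarrow> real poly \<Rightarrow> 'a \<Rightarrow> 'a" where
  "poly_op S p = fold_coeffs (\<lambda>a g f. a *\<^sub>R f + S (g f)) p (\<lambda>_. 0)"

text \<open>Here \<open>b\<close> is any positive bound for the operator, not its norm; positivity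
  allows the division by \<open>2 * b\<close> in the rescaling to \<open>{0..1}\<close>.\<close>

locale bounded_selfadjoint =
  fixes S :: "'a::{real_inner, complete_space} \<Rightarrow> 'a" and b :: real
  assumes linear: "linear S"
    and selfadjoint: "inner (S f) g = inner f (S g)"
    and norm_le: "norm (S f) \<le> b * norm f"
    and b_pos: "0 < b"
begin

lemma bounded_linear: "bounded_linear S"
  by (rule bounded_linear_intro[where K=b])
    (simp_all add: linear_add[OF linear] linear_scale[OF linear] norm_le mult.commute)

lemma poly_op_0 [simp]: "poly_op S 0 f = 0"
  by (simp add: poly_op_def)

lemma poly_op_pCons [simp]: "poly_op S (pCons a p) f = a *\<^sub>R f + S (poly_op S p f)"
  by (cases "p = 0 \<and> a = 0") (auto simp: poly_op_def linear_0[OF linear])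

lemma poly_op_1 [simp]: "poly_op S 1 f = f"
  by (simp add: one_pCons linear_0[OF linear])

lemma linear_poly_op: "linear (poly_op S p)"
proof (induction p)
  case 0
  show ?case by (rule linearI) simp_all
next
  case (pCons a p)
  show ?case
    by (rule linearI)
      (simp_all add: linear_add[OF pCons(2)] linear_add[OF linear] linear_scale[OF pCons(2)]
        linear_scale[OF linear] algebra_simps)
qed

lemma poly_op_add: "poly_op S (p + q) f = poly_op S p f + poly_op S q f"
  by (induction p q rule: poly_induct2) (simp_all add: linear_add[OF linear] algebra_simps)

lemma poly_op_smult: "poly_op S (smult c p) f = c *\<^sub>R poly_op S p f"
  by (induction p) (simp_all add: linear_scale[OF linear] algebra_simps)

lemma poly_op_diff: "poly_op S (p - q) f = poly_op S p f - poly_op S q f"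
proof -
  have "p - q = p + smult (- 1) q" by simp
  then show ?thesis by (simp only: poly_op_add poly_op_smult) simp
qed

lemma poly_op_mult: "poly_op S (p * q) f = poly_op S p (poly_op S q f)"
  by (induction p) (simp_all add: poly_op_add poly_op_smult)

lemma poly_op_commute: "poly_op S p (poly_op S q f) = poly_op S q (poly_op S p f)"
  by (metis poly_op_mult mult.commute)

lemma inner_poly_op: "inner (poly_op S p f) g = inner f (poly_op S p g)"
proof (induction p arbitrary: f g)
  case (pCons a p)
  have "inner (S (poly_op S p f)) g = inner f (poly_op S p (S g))"
    by (simp add: selfadjoint pCons)
  also have "poly_op S p (S g) = S (poly_op S p g)"
    using poly_op_commute[of p "[:0, 1:]" g] by (simp add: linear_0[OF linear])
  finally show ?case by (simp add: inner_add_left inner_add_right)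
qed simp

lemma norm_poly_op: "(norm (poly_op S p f))\<^sup>2 = inner (poly_op S (p * p) f) f"
  by (simp add: poly_op_mult inner_poly_op power2_norm_eq_inner)

lemma poly_op_intertwine:
  assumes "linear J" "\<And>f. J (S f) = S (J f)"
  shows "poly_op S p (J f) = J (poly_op S p f)"
  by (induction p) (simp_all add: assms linear_0 linear_add linear_scale)

section \<open>Positive polynomials of the operator and the measure representing a vector\<close>

definition nonneg :: "real poly \<Rightarrow> bool" where
  "nonneg p \<longleftrightarrow> (\<forall>f. 0 \<le> inner (poly_op S p f) f)"

lemma inner_poly_op_square:
  "inner (poly_op S (q * q * p) f) f = inner (poly_op S p (poly_op S q f)) (poly_op S q f)"
proof -
  have "q * q * p = q * (p * q)" by (simp add: mult_ac)
  then have "inner (poly_op S (q * q * p) f) f = inner (poly_op S q (poly_op S p (poly_op S q f))) f"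
    by (simp only: poly_op_mult)
  then show ?thesis
    by (simp only: inner_poly_op[of q])
qed

lemma nonneg_square: "nonneg p \<Longrightarrow> nonneg (q * q * p)"
  unfolding nonneg_def by (simp only: inner_poly_op_square) simp

text \<open>Positivity of a product of commuting positive operators usually rests on square roots.
  Here \<open>u + v = 1\<close> gives \<open>u * v = u * u * v + v * v * u\<close>, a sum of
  positive terms, and from higher powers a square is split off that leaves both exponents at most
  1.\<close>

lemma nonneg_power:
  assumes "nonneg u" "nonneg v" "u + v = 1"
  shows "nonneg (u ^ k * v ^ l)"
proof -
  define r where "r = u ^ (k mod 2) * v ^ (l mod 2)"
  have "u * v = u * u * v + v * v * u"
  proof -
    have "u * v * 1 = u * u * v + v * v * u"
      by (simp only: assms(3)[symmetric]) (simp add: algebra_simps)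
    then show ?thesis by simp
  qed
  then have "nonneg (u * v)"
    using nonneg_square[of v u] nonneg_square[of u v] assms
    unfolding nonneg_def by (simp add: poly_op_add inner_add_left)
  moreover have "nonneg 1"
    by (simp add: nonneg_def)
  moreover have "k mod 2 = 0 \<or> k mod 2 = 1" "l mod 2 = 0 \<or> l mod 2 = 1"
    by auto
  ultimately have "nonneg r"
    using assms by (auto simp: r_def)
  then have "nonneg ((u ^ (k div 2) * v ^ (l div 2)) * (u ^ (k div 2) * v ^ (l div 2)) * r)"
    by (rule nonneg_square)
  moreover have "u ^ k = u ^ (k div 2) * u ^ (k div 2) * u ^ (k mod 2)"
      "v ^ l = v ^ (l div 2) * v ^ (l div 2) * v ^ (l mod 2)"
    by (metis div_mult_mod_eq mult_2_right power_add mult.commute)+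
  ultimately show ?thesis by (simp add: r_def mult_ac)
qed

lemma abs_inner_le: "\<bar>inner (S f) f\<bar> \<le> b * inner f f"
proof -
  have "\<bar>inner (S f) f\<bar> \<le> norm (S f) * norm f"
    by (rule Cauchy_Schwarz_ineq2)
  also have "\<dots> \<le> b * norm f * norm f"
    by (intro mult_right_mono norm_le) simp
  finally show ?thesis
    by (simp add: power2_norm_eq_inner[symmetric] power2_eq_square mult_ac)
qed

text \<open>The substitution \<open>t = 2 b u - b\<close> carries \<open>[-b, b]\<close> to \<open>[0, 1]\<close>.\<close>

lemma spectral_moment_measure:
  obtains M where "supported_measure b M" "\<And>q. (\<integral>t. poly q t \<partial>M) = inner (poly_op S q f) f"
proof (cases "f = 0")
  case True
  \<comment> \<open>The zero vector cannot be normalized to total mass 1, so it is treated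
    apart.\<close>
  have "supported_measure b (null_measure borel)"
    unfolding supported_measure_def
    by (auto intro!: finite_measureI AE_I'[of UNIV] simp: null_sets_def)
  moreover have "(\<integral>t. poly q t \<partial>null_measure borel) = inner (poly_op S q f) f" for q
    using True by simp
  ultimately show ?thesis by (rule that)
next
  case False
  define c where "c = inner f f"
  have c: "0 < c" using False by (simp add: c_def)
  \<comment> \<open>Polynomials for \<open>(b + S) / (2 * b)\<close> and
    \<open>(b - S) / (2 * b)\<close>; both are positive by \<open>abs_inner_le\<close>.\<close>
  define u v where "u = [:1 / 2, 1 / (2 * b):]" and "v = [:1 / 2, - 1 / (2 * b):]"
  have uv: "u + v = 1"
    by (simp add: u_def v_def one_pCons)
  have bd: "0 \<le> inner g g / 2 + inner (S g) g / (2 * b)" "inner (S g) g / (2 * b) \<le> inner g g / 2" for g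
    using abs_inner_le[of g] b_pos by (auto simp: abs_le_iff field_simps)
  have "nonneg u" "nonneg v"
    unfolding nonneg_def u_def v_def using bd
    by (simp_all add: linear_0[OF linear] linear_scale[OF linear] linear_neg[OF linear] inner_add_left inner_diff_left)
  then have pos: "nonneg (u ^ k * v ^ l)" for k l
    using nonneg_power uv by blast
  \<comment> \<open>Composition with \<open>u\<close> evaluates \<open>q\<close> at the rescaled
    operator; division by \<open>c\<close> normalizes the mass to 1.\<close>
  define L where "L q = inner (poly_op S (pcompose q u) f) f / c" for q
  have L_add: "L (p + q) = L p + L q" and L_smult: "L (smult a p) = a * L p" for p q a
    by (simp_all add: L_def pcompose_add pcompose_smult poly_op_add poly_op_smult inner_add_left
        add_divide_distrib)
  have "0 \<le> L ([:0, 1:] ^ k * [:1, -1:] ^ l)" for k l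
  proof -
    have pw: "pcompose (p ^ n) u = (pcompose p u) ^ n" for p n
      by (induction n) (simp_all add: pcompose_mult pcompose_1)
    have "pcompose [:1, -1:] u = v"
      by (simp add: pcompose_pCons u_def v_def one_pCons)
    moreover have "pcompose [:0, 1:] u = u"
      by (simp add: pcompose_pCons)
    ultimately have "pcompose ([:0, 1:] ^ k * [:1, -1:] ^ l) u = u ^ k * v ^ l"
      by (simp add: pcompose_mult pw)
    then show ?thesis
      using pos[of k l] c by (simp add: L_def nonneg_def)
  qed
  moreover have "L 1 = 1"
    using c by (simp add: L_def pcompose_1 c_def)
  ultimately obtain N where N: "prob_space N" "sets N = sets borel" "AE t in N. t \<in> {0..1}"
      "\<And>j. (\<integral>t. t ^ j \<partial>N) = L ([:0, 1:] ^ j)"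
    using hausdorff_moment_prob[of L] L_add L_smult by blast
  interpret N: prob_space N by fact
  have N_supp: "supported_measure 1 N"
    unfolding supported_measure_def
  proof (intro conjI N(2) N.finite_measure_axioms)
    show "AE t in N. \<bar>t\<bar> \<le> 1"
      using N(3) by eventually_elim auto
  qed
  have int_N: "(\<integral>t. poly q t \<partial>N) = L q" for q
  proof -
    have L_sum: "L (\<Sum>i\<in>I. g i) = (\<Sum>i\<in>I. L (g i))" if "finite I" for g and I :: "nat set"
      using that L_smult[of 0 0] by (induction I) (simp_all add: L_add)
    have "(\<integral>t. poly q t \<partial>N) = (\<Sum>i\<le>degree q. coeff q i * (\<integral>t. t ^ i \<partial>N))"
      by (rule integral_poly_moments[OF N_supp])
    also have "\<dots> = L (\<Sum>i\<le>degree q. smult (coeff q i) ([:0, 1:] ^ i))"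
      by (simp add: N(4) L_sum L_smult)
    also have "(\<Sum>i\<le>degree q. smult (coeff q i) ([:0, 1:] ^ i)) = q"
      by (metis (no_types, lifting) monom_altdef poly_as_sum_of_monoms sum.cong)
    finally show ?thesis .
  qed
  \<comment> \<open>Undoes both normalizations: the mass becomes \<open>c\<close> again, and the
    coordinate returns to \<open>{-b..b}\<close>.\<close>
  define M where "M = distr (density N (\<lambda>_. ennreal c)) borel (\<lambda>t. 2 * b * t - b)"
  have meas: "(\<lambda>t. 2 * b * t - b) \<in> measurable (density N (\<lambda>_. ennreal c)) borel"
    using N(2) by (subst measurable_cong_sets[of _ borel _ borel]) auto
  have "supported_measure b M"
    unfolding supported_measure_def
  proof (intro conjI)
    have "finite_measure (density N (\<lambda>_. ennreal c))"
      using N(2) by (intro finite_measureI) (auto simp: emeasure_density_const N.emeasure_eq_measure ennreal_mult_eq_top_iff)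
    then show "finite_measure M"
      unfolding M_def by (rule finite_measure.finite_measure_distr) (rule meas)
    have "AE t in density N (\<lambda>_. ennreal c). \<bar>2 * b * t - b\<bar> \<le> b"
    proof (subst AE_density)
      show "AE t in N. 0 < ennreal c \<longrightarrow> \<bar>2 * b * t - b\<bar> \<le> b"
        using N(3)
      proof eventually_elim
        case (elim t)
        then have "0 \<le> 2 * b * t" "2 * b * t \<le> 2 * b * 1"
          using b_pos by (auto intro: mult_left_mono)
        then show ?case by (simp add: abs_le_iff)
      qed
    qed simp
    then show "AE t in M. \<bar>t\<bar> \<le> b"
      unfolding M_def by (subst AE_distr_iff[OF meas]) auto
  qed (simp add: M_def)
  moreover have "(\<integral>t. poly q t \<partial>M) = inner (poly_op S q f) f" for q
  proof -
    have pm: "h \<in> borel_measurable N" if "h \<in> borel_measurable borel" for h :: "real \<Rightarrow> real"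
      using that by (subst measurable_cong_sets[OF N(2) refl])
    have "(\<integral>t. poly q t \<partial>M) = (\<integral>t. poly q (2 * b * t - b) \<partial>density N (\<lambda>_. ennreal c))"
      unfolding M_def
      by (rule integral_distr[OF meas]) (intro borel_measurable_continuous_onI continuous_intros)
    also have "\<dots> = (\<integral>t. c * poly (pcompose q [:- b, 2 * b:]) t \<partial>N)"
      using c by (subst integral_real_density)
        (auto simp: poly_pcompose algebra_simps intro!: pm borel_measurable_continuous_onI continuous_intros)
    also have "\<dots> = c * L (pcompose q [:- b, 2 * b:])"
      by (simp add: int_N)
    also have "pcompose (pcompose q [:- b, 2 * b:]) u = q"
    proof -
      have "pcompose [:- b, 2 * b:] u = [:0, 1:]"
        using b_pos by (simp add: pcompose_pCons u_def)
      then show ?thesis by (simp add: pcompose_assoc[symmetric])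
    qed
    then have "c * L (pcompose q [:- b, 2 * b:]) = inner (poly_op S q f) f"
      using c by (simp add: L_def)
    finally show ?thesis .
  qed
  ultimately show ?thesis by (rule that)
qed

section \<open>Spectral measures of vectors and spectral projections\<close>

definition spec_measure :: "'a \<Rightarrow> real measure" where
  "spec_measure f = (SOME M. supported_measure b M \<and>
     (\<forall>q. (\<integral>t. poly q t \<partial>M) = inner (poly_op S q f) f))"

lemma spec_measure: "supported_measure b (spec_measure f)"
    "(\<integral>t. poly q t \<partial>spec_measure f) = inner (poly_op S q f) f"
proof -
  have "\<exists>M. supported_measure b M \<and> (\<forall>q. (\<integral>t. poly q t \<partial>M) = inner (poly_op S q f) f)"
    using spectral_moment_measure[of f] by metis
  from someI_ex[OF this] show "supported_measure b (spec_measure f)"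
    "(\<integral>t. poly q t \<partial>spec_measure f) = inner (poly_op S q f) f"
    unfolding spec_measure_def by auto
qed

text \<open>Moments determine a compactly supported measure, so the choice in
  \<open>spec_measure\<close> is immaterial. The support radius \<open>a\<close> of \<open>M\<close>
  may differ from \<open>b\<close>.\<close>

lemma spec_measure_eqI:
  assumes "supported_measure a M" "\<And>q. (\<integral>t. poly q t \<partial>M) = inner (poly_op S q f) f"
  shows "spec_measure f = M"
  by (rule supported_measure_eqI[of "max a b"])
    (simp_all add: assms(2) spec_measure(2) supported_measure_mono[OF assms(1)]
      supported_measure_mono[OF spec_measure(1)])

abbreviation L2_conv :: "(nat \<Rightarrow> real poly) \<Rightarrow> real set \<Rightarrow> 'a \<Rightarrow> bool" where
  "L2_conv q B f \<equiv> (\<lambda>n. \<integral>t. (poly (q n) t - indicator B t)\<^sup>2 \<partial>spec_measure f) \<longlonglongrightarrow> 0"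

text \<open>The isometry from polynomials in \<open>L^2\<close> of the spectral measure to the
  Hilbert space; through it mean square approximation of functions becomes convergence of
  vectors.\<close>

lemma norm_poly_op_integral: "(norm (poly_op S p f))\<^sup>2 = (\<integral>t. (poly p t)\<^sup>2 \<partial>spec_measure f)"
  by (subst norm_poly_op) (simp add: spec_measure(2)[symmetric] power2_eq_square)

text \<open>The isometry turns mean square distance to a common indicator into distance of vectors.
  With \<open>p = q\<close> this yields convergence, with different sequences independence of the
  limit.\<close>

lemma L2_conv_Cauchy:
  assumes B: "B \<in> sets borel" and p: "L2_conv p B f" and q: "L2_conv q B f"
  shows "\<forall>e>0. \<exists>N. \<forall>m\<ge>N. \<forall>n\<ge>N. norm (poly_op S (p m) f - poly_op S (q n) f) < e"
proof (intro allI impI)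
  fix e :: real assume e: "0 < e"
  then have e': "0 < e\<^sup>2 / 4" by simp
  obtain N1 where N1: "\<And>n. n \<ge> N1 \<Longrightarrow> norm (\<integral>t. (poly (p n) t - indicator B t)\<^sup>2 \<partial>spec_measure f) < e\<^sup>2 / 4"
    using LIMSEQ_D[OF p e'] by auto
  obtain N2 where N2: "\<And>n. n \<ge> N2 \<Longrightarrow> norm (\<integral>t. (poly (q n) t - indicator B t)\<^sup>2 \<partial>spec_measure f) < e\<^sup>2 / 4"
    using LIMSEQ_D[OF q e'] by auto
  have "norm (poly_op S (p m) f - poly_op S (q n) f) < e" if "max N1 N2 \<le> m" "max N1 N2 \<le> n" for m n
  proof -
    have "(norm (poly_op S (p m) f - poly_op S (q n) f))\<^sup>2 =
        (\<integral>t. (poly (p m) t - poly (q n) t)\<^sup>2 \<partial>spec_measure f)"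
      by (simp add: poly_op_diff[symmetric] norm_poly_op_integral)
    also have "\<dots> \<le> 2 * (\<integral>t. (poly (p m) t - indicator B t)\<^sup>2 \<partial>spec_measure f) +
        2 * (\<integral>t. (indicator B t - poly (q n) t)\<^sup>2 \<partial>spec_measure f)"
      by (intro integral_sq_diff_triangle[OF spec_measure(1)] bounded_borel_on_intros B)
    also have "\<dots> < e\<^sup>2"
      using N1[of m] N2[of n] that by (simp add: power2_commute[of "indicator B _"])
    finally show ?thesis
      using e by (simp add: power2_less_imp_less)
  qed
  then show "\<exists>N. \<forall>m\<ge>N. \<forall>n\<ge>N. norm (poly_op S (p m) f - poly_op S (q n) f) < e" by blast
qed

lemma L2_conv_ex:
  assumes "finite F" "B \<in> sets borel"
  obtains q where "\<And>f. f \<in> F \<Longrightarrow> L2_conv q B f"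
  by (rule poly_indicator_seq[of "spec_measure ` F" b B]) (use assms spec_measure(1) in auto)

text \<open>The limit is specified for all approximating sequences at once, so that a later argument
  may pick a sequence suited to several vectors.\<close>

definition proj :: "real set \<Rightarrow> 'a \<Rightarrow> 'a" where
  "proj B f = (SOME h. \<forall>q. L2_conv q B f \<longrightarrow> (\<lambda>n. poly_op S (q n) f) \<longlonglongrightarrow> h)"

lemma proj_tendsto:
  assumes B: "B \<in> sets borel" and q: "L2_conv q B f"
  shows "(\<lambda>n. poly_op S (q n) f) \<longlonglongrightarrow> proj B f"
proof -
  have "Cauchy (\<lambda>n. poly_op S (q n) f)"
    using L2_conv_Cauchy[OF B q q] by (simp add: Cauchy_def dist_norm)
  then obtain h where h: "(\<lambda>n. poly_op S (q n) f) \<longlonglongrightarrow> h"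
    by (auto simp: Cauchy_convergent_iff convergent_def)
  have "\<forall>p. L2_conv p B f \<longrightarrow> (\<lambda>n. poly_op S (p n) f) \<longlonglongrightarrow> h"
  proof (intro allI impI)
    fix p assume p: "L2_conv p B f"
    have "(\<lambda>n. poly_op S (p n) f - poly_op S (q n) f) \<longlonglongrightarrow> 0"
      using L2_conv_Cauchy[OF B p q] by (fastforce intro!: LIMSEQ_I)
    from tendsto_add[OF this h] show "(\<lambda>n. poly_op S (p n) f) \<longlonglongrightarrow> h" by simp
  qed
  then have "\<forall>p. L2_conv p B f \<longrightarrow> (\<lambda>n. poly_op S (p n) f) \<longlonglongrightarrow> proj B f"
    unfolding proj_def by (rule someI)
  with q show ?thesis by blast
qed

text \<open>A single sequence approximates the indicator for all vectors involved, and the linearity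
  of \<open>poly_op S (q n)\<close> survives the limit. Symmetry and commutation follow the same
  pattern.\<close>

lemma proj_linear:
  assumes B: "B \<in> sets borel"
  shows "linear (proj B)"
proof (rule linearI)
  fix f g
  obtain q where q: "\<And>h. h \<in> {f, g, f + g} \<Longrightarrow> L2_conv q B h"
    by (rule L2_conv_ex[of "{f, g, f + g}" B]) (use B in auto)
  have "(\<lambda>n. poly_op S (q n) (f + g)) \<longlonglongrightarrow> proj B f + proj B g"
    using tendsto_add[OF proj_tendsto[OF B q[of f]] proj_tendsto[OF B q[of g]]]
    by (simp add: linear_add[OF linear_poly_op])
  then show "proj B (f + g) = proj B f + proj B g"
    using LIMSEQ_unique proj_tendsto[OF B q[of "f + g"]] by auto
next
  fix c f
  obtain q where q: "\<And>h. h \<in> {f, c *\<^sub>R f} \<Longrightarrow> L2_conv q B h"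
    by (rule L2_conv_ex[of "{f, c *\<^sub>R f}" B]) (use B in auto)
  have "(\<lambda>n. poly_op S (q n) (c *\<^sub>R f)) \<longlonglongrightarrow> c *\<^sub>R proj B f"
    using tendsto_scaleR[OF tendsto_const proj_tendsto[OF B q[of f]], of c]
    by (simp add: linear_scale[OF linear_poly_op])
  then show "proj B (c *\<^sub>R f) = c *\<^sub>R proj B f"
    using LIMSEQ_unique proj_tendsto[OF B q[of "c *\<^sub>R f"]] by auto
qed

lemma proj_selfadjoint:
  assumes B: "B \<in> sets borel"
  shows "inner (proj B f) g = inner f (proj B g)"
proof -
  obtain q where q: "\<And>h. h \<in> {f, g} \<Longrightarrow> L2_conv q B h"
    by (rule L2_conv_ex[of "{f, g}" B]) (use B in auto)
  have "(\<lambda>n. inner (poly_op S (q n) f) g) \<longlonglongrightarrow> inner (proj B f) g"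
    by (intro tendsto_inner tendsto_const proj_tendsto B q) simp
  moreover have "(\<lambda>n. inner f (poly_op S (q n) g)) \<longlonglongrightarrow> inner f (proj B g)"
    by (intro tendsto_inner tendsto_const proj_tendsto B q) simp
  ultimately show ?thesis
    by (simp add: inner_poly_op LIMSEQ_unique)
qed

text \<open>Three uses: \<open>J = S\<close> and then \<open>J = proj A\<close> make the projections
  commute with each other, and a complex scalar for \<open>J\<close> gives complex
  linearity.\<close>

lemma proj_commute:
  assumes B: "B \<in> sets borel" and J: "bounded_linear J" "\<And>f. J (S f) = S (J f)"
  shows "proj B (J f) = J (proj B f)"
proof -
  obtain q where q: "\<And>h. h \<in> {f, J f} \<Longrightarrow> L2_conv q B h"
    by (rule L2_conv_ex[of "{f, J f}" B]) (use B in auto)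
  have "(\<lambda>n. J (poly_op S (q n) f)) \<longlonglongrightarrow> J (proj B f)"
    by (intro bounded_linear.tendsto[OF J(1)] proj_tendsto B q) simp
  moreover have "(\<lambda>n. poly_op S (q n) (J f)) \<longlonglongrightarrow> proj B (J f)"
    by (intro proj_tendsto B q) simp
  ultimately show ?thesis
    using J by (simp add: poly_op_intertwine bounded_linear.linear LIMSEQ_unique)
qed

lemma proj_inner:
  assumes B: "B \<in> sets borel"
  shows "inner (proj B f) f = measure (spec_measure f) B"
proof -
  obtain q where q: "L2_conv q B f"
    by (rule L2_conv_ex[of "{f}" B]) (use B in auto)
  have "(\<lambda>n. inner (poly_op S (q n) f) f) \<longlonglongrightarrow> inner (proj B f) f"
    by (intro tendsto_inner tendsto_const proj_tendsto B q)
  moreover have "(\<lambda>n. \<integral>t. 1 * poly (q n) t \<partial>spec_measure f) \<longlonglongrightarrow> (\<integral>t. 1 * indicator B t \<partial>spec_measure f)"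
    by (rule tendsto_integral_mult_L2[OF spec_measure(1) _ _ _ q]) (intro bounded_borel_on_intros B)+
  ultimately show ?thesis
    using B supported_measureD(2,4)[OF spec_measure(1)[of f]]
    by (simp add: spec_measure(2) LIMSEQ_unique)
qed

text \<open>The two occurrences of \<open>proj B f\<close> are approximated one after the other,
  since \<open>tendsto_integral_mult_L2\<close> allows only one moving factor.\<close>

lemma proj_poly_inner:
  assumes B: "B \<in> sets borel"
  shows "inner (poly_op S p (proj B f)) (proj B f) = (\<integral>t. poly p t * indicator B t \<partial>spec_measure f)"
proof -
  obtain q where q: "L2_conv q B f"
    by (rule L2_conv_ex[of "{f}" B]) (use B in auto)
  have bl: "bounded_linear (poly_op S p)" for p
  proof (induction p)
    case 0
    show ?case by (simp add: poly_op_def)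
  next
    case (pCons a p)
    have "bounded_linear (\<lambda>f. a *\<^sub>R f + S (poly_op S p f))"
      by (intro bounded_linear_add bounded_linear_scaleR_right bounded_linear_compose[OF bounded_linear pCons(2)])
    then show ?case by simp
  qed
  have qf: "(\<lambda>n. poly_op S (q n) f) \<longlonglongrightarrow> proj B f"
    by (rule proj_tendsto[OF B q])
  have step: "inner (poly_op S p (poly_op S (q n) f)) (proj B f) =
      (\<integral>t. poly p t * indicator B t * poly (q n) t \<partial>spec_measure f)" for n
  proof -
    have "(\<lambda>m. inner (poly_op S p (poly_op S (q n) f)) (poly_op S (q m) f)) \<longlonglongrightarrow>
        inner (poly_op S p (poly_op S (q n) f)) (proj B f)"
      by (intro tendsto_inner tendsto_const qf)
    moreover have "inner (poly_op S p (poly_op S (q n) f)) (poly_op S (q m) f) =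
        (\<integral>t. poly p t * poly (q n) t * poly (q m) t \<partial>spec_measure f)" for m
    proof -
      have "inner (poly_op S p (poly_op S (q n) f)) (poly_op S (q m) f) =
          inner (poly_op S (q m * (p * q n)) f) f"
        by (simp only: poly_op_mult inner_poly_op[of "q m"])
      then show ?thesis
        by (simp add: spec_measure(2)[symmetric] mult_ac)
    qed
    moreover have "(\<lambda>m. \<integral>t. poly p t * poly (q n) t * poly (q m) t \<partial>spec_measure f) \<longlonglongrightarrow>
        (\<integral>t. poly p t * poly (q n) t * indicator B t \<partial>spec_measure f)"
      by (rule tendsto_integral_mult_L2[OF spec_measure(1) _ _ _ q]) (intro bounded_borel_on_intros B)+
    ultimately have "inner (poly_op S p (poly_op S (q n) f)) (proj B f) =
        (\<integral>t. poly p t * poly (q n) t * indicator B t \<partial>spec_measure f)"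
      using LIMSEQ_unique by simp
    then show ?thesis by (simp add: mult_ac)
  qed
  have "(\<lambda>n. inner (poly_op S p (poly_op S (q n) f)) (proj B f)) \<longlonglongrightarrow> inner (poly_op S p (proj B f)) (proj B f)"
    by (intro tendsto_inner tendsto_const bounded_linear.tendsto[OF bl] qf)
  moreover have "(\<lambda>n. \<integral>t. poly p t * indicator B t * poly (q n) t \<partial>spec_measure f) \<longlonglongrightarrow>
      (\<integral>t. poly p t * indicator B t * indicator B t \<partial>spec_measure f)"
    by (rule tendsto_integral_mult_L2[OF spec_measure(1) _ _ _ q]) (intro bounded_borel_on_intros B)+
  moreover have "poly p t * indicator B t * indicator B t = poly p t * indicator B t" for t
    by (simp add: indicator_def)
  ultimately show ?thesis
    using LIMSEQ_unique by (simp add: step)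
qed

text \<open>Moments identify the measure, and those of \<open>proj B f\<close> are given by
  \<open>proj_poly_inner\<close>. Multiplicativity of the projections rests on this restriction
  property.\<close>

lemma spec_measure_proj:
  assumes B: "B \<in> sets borel"
  shows "spec_measure (proj B f) = density (spec_measure f) (indicator B)"
proof (rule spec_measure_eqI)
  let ?\<mu> = "spec_measure f"
  have sets: "sets ?\<mu> = sets borel" "space ?\<mu> = UNIV"
    using supported_measureD[OF spec_measure(1)] by auto
  have Bm: "B \<in> sets ?\<mu>" using B sets by simp
  interpret finite_measure ?\<mu>
    using supported_measureD(1)[OF spec_measure(1)] .
  show "supported_measure b (density ?\<mu> (indicator B))"
    unfolding supported_measure_def
  proof (intro conjI)
    show "finite_measure (density ?\<mu> (indicator B))"
    proof (rule finite_measureI)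
      have "emeasure (density ?\<mu> (indicator B)) (space (density ?\<mu> (indicator B))) = emeasure ?\<mu> B"
        using Bm sets by (subst emeasure_density) (auto simp: indicator_def[symmetric])
      then show "emeasure (density ?\<mu> (indicator B)) (space (density ?\<mu> (indicator B))) \<noteq> \<infinity>"
        by simp
    qed
    show "AE t in density ?\<mu> (indicator B). \<bar>t\<bar> \<le> b"
      using supported_measureD(3)[OF spec_measure(1)[of f]] Bm
      by (subst AE_density) auto
  qed (simp add: sets)
  fix p
  have "(\<integral>t. poly p t \<partial>density ?\<mu> (indicator B)) = (\<integral>t. poly p t \<partial>density ?\<mu> (\<lambda>t. ennreal (indicator B t)))"
    by (simp add: ennreal_indicator)
  also have "\<dots> = (\<integral>t. indicator B t * poly p t \<partial>?\<mu>)"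
  proof (rule integral_real_density)
    show "poly p \<in> borel_measurable ?\<mu>"
      by (rule borel_measurable_integrable, rule bounded_borel_on_integrable[OF spec_measure(1)])
        (rule bounded_borel_on_poly)
  qed (use Bm in auto)
  finally show "(\<integral>t. poly p t \<partial>density ?\<mu> (indicator B)) = inner (poly_op S p (proj B f)) (proj B f)"
    by (simp add: proj_poly_inner[OF B] mult.commute)
qed

lemma measure_spec_measure_proj:
  assumes A: "A \<in> sets borel" and B: "B \<in> sets borel"
  shows "measure (spec_measure (proj B f)) A = measure (spec_measure f) (A \<inter> B)"
proof -
  have "sets (spec_measure f) = sets borel"
    using supported_measureD[OF spec_measure(1)] by auto
  then have "emeasure (density (spec_measure f) (indicator B)) A = emeasure (spec_measure f) (A \<inter> B)"
    using A B by (subst emeasure_density) (auto simp: indicator_inter_arith[symmetric] Int_commute)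
  then show ?thesis
    by (simp add: spec_measure_proj[OF B] measure_def)
qed

section \<open>The projections as a projection-valued measure\<close>

lemma proj_UNIV: "proj UNIV f = f"
proof -
  have "L2_conv (\<lambda>_. 1) UNIV f" by simp
  from proj_tendsto[OF _ this] show ?thesis
    by (simp add: LIMSEQ_const_iff)
qed

text \<open>The indicator is 1 almost everywhere, so the constant polynomial 1 is an approximating
  sequence.\<close>

lemma proj_interval: "proj {-b..b} f = f"
proof -
  have "AE t in spec_measure f. (poly 1 t - indicator {-b..b} t)\<^sup>2 = 0"
    using supported_measureD(3)[OF spec_measure(1)] by eventually_elim (auto simp: indicator_def abs_le_iff)
  then have "(\<integral>t. (poly 1 t - indicator {-b..b} t)\<^sup>2 \<partial>spec_measure f) = 0"
    by (rule integral_eq_zero_AE)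
  then have "L2_conv (\<lambda>_. 1) {-b..b} f" by simp
  from proj_tendsto[OF _ this] show ?thesis
    by (simp add: LIMSEQ_const_iff)
qed

lemma norm_proj:
  assumes B: "B \<in> sets borel"
  shows "(norm (proj B f))\<^sup>2 = measure (spec_measure f) B"
proof -
  have "(norm (proj B f))\<^sup>2 = inner (proj UNIV (proj B f)) (proj B f)"
    by (simp add: proj_UNIV power2_norm_eq_inner)
  also have "\<dots> = measure (spec_measure (proj B f)) UNIV"
    by (rule proj_inner) simp
  finally show ?thesis
    using measure_spec_measure_proj[OF _ B, of UNIV f] by simp
qed

lemma norm_proj_le:
  assumes B: "B \<in> sets borel"
  shows "norm (proj B f) \<le> norm f"
proof -
  interpret finite_measure "spec_measure f"
    using supported_measureD(1)[OF spec_measure(1)] .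
  have "measure (spec_measure f) B \<le> measure (spec_measure f) UNIV"
    using supported_measureD(2)[OF spec_measure(1)[of f]]
    by (intro finite_measure_mono) auto
  then have "(norm (proj B f))\<^sup>2 \<le> (norm (proj UNIV f))\<^sup>2"
    by (simp only: norm_proj[OF B] norm_proj[of UNIV, simplified])
  then show ?thesis
    by (simp add: proj_UNIV)
qed

lemma proj_bounded_linear: "B \<in> sets borel \<Longrightarrow> bounded_linear (proj B)"
  by (rule bounded_linear_intro[where K=1])
    (simp_all add: linear_add[OF proj_linear] linear_scale[OF proj_linear] norm_proj_le)

text \<open>Polarization. In a real space the quadratic form sees only the symmetric part of an
  operator, hence the symmetry assumptions on \<open>P\<close> and \<open>Q\<close>.\<close>

lemma selfadjoint_eq_if_quadratic_eq:
  fixes P Q :: "'a \<Rightarrow> 'a"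
  assumes P: "linear P" "\<And>f g. inner (P f) g = inner f (P g)"
    and Q: "linear Q" "\<And>f g. inner (Q f) g = inner f (Q g)"
    and eq: "\<And>f. inner (P f) f = inner (Q f) f"
  shows "P f = Q f"
proof -
  have "inner (P f) g = inner (Q f) g" for g
  proof -
    have "inner (P g) f = inner (P f) g" "inner (Q g) f = inner (Q f) g"
      by (metis P(2) inner_commute, metis Q(2) inner_commute)
    then show ?thesis
      using eq[of "f + g"] eq[of f] eq[of g]
      by (simp add: linear_add[OF P(1)] linear_add[OF Q(1)] inner_add_left inner_add_right)
  qed
  then have "inner (P f - Q f) (P f - Q f) = 0"
    by (simp add: inner_diff_left)
  then show ?thesis by simp
qed

text \<open>The product \<open>proj A (proj B f)\<close> is not yet known to be symmetric, so
  polarization is applied to the symmetric sandwich with \<open>proj B\<close> on both sides.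
  Commutation and idempotence then remove the extra factor.\<close>

lemma proj_Int:
  assumes A: "A \<in> sets borel" and B: "B \<in> sets borel"
  shows "proj (A \<inter> B) f = proj A (proj B f)"
proof -
  have AB: "A \<inter> B \<in> sets borel" using A B by simp
  have eq: "proj B (proj A (proj B f)) = proj (A \<inter> B) f"
    if A: "A \<in> sets borel" for A f
  proof (rule selfadjoint_eq_if_quadratic_eq[where P="\<lambda>f. proj B (proj A (proj B f))" and Q="proj (A \<inter> B)"])
    have AB: "A \<inter> B \<in> sets borel" using A B by simp
    show "linear (\<lambda>f. proj B (proj A (proj B f)))"
      by (rule linearI) (simp_all add: linear_add[OF proj_linear] linear_scale[OF proj_linear] A B)
    show "linear (proj (A \<inter> B))" by (rule proj_linear[OF AB])
    fix f g
    show "inner (proj B (proj A (proj B f))) g = inner f (proj B (proj A (proj B g)))"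
      by (simp add: proj_selfadjoint A B)
    show "inner (proj (A \<inter> B) f) g = inner f (proj (A \<inter> B) g)"
      by (rule proj_selfadjoint[OF AB])
    have "inner (proj B (proj A (proj B f))) f = measure (spec_measure (proj B f)) A"
      by (simp add: proj_selfadjoint[OF B] proj_inner[OF A])
    then show "inner (proj B (proj A (proj B f))) f = inner (proj (A \<inter> B) f) f"
      by (simp add: measure_spec_measure_proj[OF A B] proj_inner[OF AB])
  qed
  have S_comm: "proj A (S f) = S (proj A f)" for f
    by (rule proj_commute[OF A bounded_linear refl])
  have "proj B (proj A (proj B f)) = proj A (proj B (proj B f))"
    by (rule proj_commute[OF B proj_bounded_linear[OF A] S_comm])
  \<comment> \<open>With \<open>UNIV\<close> in the middle the sandwich identity is
    idempotence.\<close>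
  moreover have "proj B (proj B f) = proj B f"
    using eq[of UNIV f] by (simp add: proj_UNIV)
  ultimately show ?thesis
    using eq[OF A, of f] by simp
qed

lemma proj_disjoint_Un:
  assumes A: "A \<in> sets borel" and B: "B \<in> sets borel" and disj: "A \<inter> B = {}"
  shows "proj (A \<union> B) f = proj A f + proj B f"
proof (rule selfadjoint_eq_if_quadratic_eq[where P="proj (A \<union> B)" and Q="\<lambda>f. proj A f + proj B f"])
  have AB: "A \<union> B \<in> sets borel" using A B by simp
  show "linear (proj (A \<union> B))" by (rule proj_linear[OF AB])
  show "linear (\<lambda>f. proj A f + proj B f)"
    by (rule linearI) (simp_all add: linear_add[OF proj_linear] linear_scale[OF proj_linear] A B scaleR_add_right)
  fix f g
  show "inner (proj (A \<union> B) f) g = inner f (proj (A \<union> B) g)"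
    by (rule proj_selfadjoint[OF AB])
  show "inner (proj A f + proj B f) g = inner f (proj A g + proj B g)"
    by (simp add: inner_add_left inner_add_right proj_selfadjoint A B)
  interpret finite_measure "spec_measure f"
    using supported_measureD(1)[OF spec_measure(1)] .
  show "inner (proj (A \<union> B) f) f = inner (proj A f + proj B f) f"
    using A B disj supported_measureD(2)[OF spec_measure(1)[of f]]
    by (simp add: inner_add_left proj_inner finite_measure_Union)
qed

text \<open>By \<open>norm_proj\<close> the squared norm of the remainder is the spectral measure of
  the tail of the union, and the tails decrease to the empty set.\<close>

lemma proj_countably_additive:
  assumes A: "range A \<subseteq> sets borel" "disjoint_family A"
  shows "(\<lambda>n. norm (proj (\<Union>i. A i) f - (\<Sum>i<n. proj (A i) f))) \<longlonglongrightarrow> 0"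
proof -
  have Ai: "A i \<in> sets borel" for i using A(1) by auto
  have fin: "(\<Sum>i<n. proj (A i) f) = proj (\<Union>i<n. A i) f" for n
  proof (induction n)
    case 0
    have "proj {} f = 0"
      using norm_proj[of "{}" f] by simp
    then show ?case by simp
  next
    case (Suc n)
    have "(\<Union>i<n. A i) \<inter> A n = {}"
    proof -
      have "A n \<inter> A i = {}" if "i < n" for i
        using disjoint_family_onD[OF A(2), of n i] that by simp
      then show ?thesis by blast
    qed
    then have "proj ((\<Union>i<n. A i) \<union> A n) f = proj (\<Union>i<n. A i) f + proj (A n) f"
      using Ai by (intro proj_disjoint_Un) auto
    then show ?case by (simp add: Suc lessThan_Suc Un_commute)
  qed
  interpret finite_measure "spec_measure f"
    using supported_measureD(1)[OF spec_measure(1)] .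
  have sets: "sets (spec_measure f) = sets borel"
    using supported_measureD(2)[OF spec_measure(1)] .
  let ?T = "\<lambda>n. (\<Union>i. A i) - (\<Union>i<n. A i)"
  have T: "?T n \<in> sets borel" for n
    using Ai by auto
  have "proj (\<Union>i. A i) f - (\<Sum>i<n. proj (A i) f) = proj (?T n) f" for n
  proof -
    have "proj ((\<Union>i<n. A i) \<union> ?T n) f = proj (\<Union>i<n. A i) f + proj (?T n) f"
      using T[of n] Ai by (intro proj_disjoint_Un) auto
    moreover have "(\<Union>i<n. A i) \<union> ?T n = (\<Union>i. A i)" by auto
    ultimately show ?thesis by (simp add: fin)
  qed
  moreover have "(\<lambda>n. norm (proj (?T n) f)) \<longlonglongrightarrow> 0"
  proof -
    have "(\<lambda>n. measure (spec_measure f) (?T n)) \<longlonglongrightarrow> measure (spec_measure f) (\<Inter>n. ?T n)"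
      using T sets by (intro finite_Lim_measure_decseq) (auto simp: decseq_def)
    moreover have "measure (spec_measure f) (\<Inter>n. ?T n) = 0"
    proof -
      have "(\<Inter>n. ?T n) = {}" by auto
      then show ?thesis by (simp only: measure_empty)
    qed
    ultimately have "(\<lambda>n. (norm (proj (?T n) f))\<^sup>2) \<longlonglongrightarrow> 0"
      by (simp only: norm_proj[OF T])
    then have "(\<lambda>n. sqrt ((norm (proj (?T n) f))\<^sup>2)) \<longlonglongrightarrow> sqrt 0"
      by (rule tendsto_real_sqrt)
    then show ?thesis by simp
  qed
  ultimately show ?thesis by simp
qed

lemma inner_spec_measure: "inner (S f) f = (\<integral>t. t \<partial>spec_measure f)"
  using spec_measure(2)[of f "[:0, 1:]"] by (simp add: linear_0[OF linear])

end

section \<open>Uniqueness of the spectral measure\<close>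

text \<open>Polarization against \<open>R f\<close>, rescaled to the norm of \<open>f\<close>,
  followed by the parallelogram law; because the two norms are equal, the factor 4 cancels
  exactly.\<close>

lemma norm_le_if_quadratic_form_le:
  fixes R :: "'a::real_inner \<Rightarrow> 'a"
  assumes "linear R" and sym: "\<And>f g. inner (R f) g = inner f (R g)"
    and bound: "\<And>f. \<bar>inner (R f) f\<bar> \<le> c * (norm f)\<^sup>2"
  shows "norm (R f) \<le> c * norm f"
proof (cases "R f = 0 \<or> f = 0")
  case True
  moreover have "0 \<le> c * norm f"
  proof (cases "f = 0")
    case False
    have "0 \<le> c * (norm f)\<^sup>2"
      using bound[of f] by linarith
    then show ?thesis
      using False by (simp add: zero_le_mult_iff)
  qed simp
  ultimately show ?thesis
    using linear_0[OF assms(1)] by auto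
next
  case False
  define g where "g = (norm f / norm (R f)) *\<^sub>R R f"
  have ng: "norm g = norm f"
    using False by (simp add: g_def)
  have "4 * inner (R f) g = inner (R (f + g)) (f + g) - inner (R (f - g)) (f - g)"
  proof -
    have "inner (R g) f = inner (R f) g"
      by (metis inner_commute sym)
    then show ?thesis
      by (simp add: linear_add[OF assms(1)] linear_diff[OF assms(1)] inner_add_left inner_add_right
          inner_diff_left inner_diff_right)
  qed
  also have "\<dots> \<le> c * (norm (f + g))\<^sup>2 + c * (norm (f - g))\<^sup>2"
    using bound[of "f + g"] bound[of "f - g"] by linarith
  also have "\<dots> = 2 * c * ((norm f)\<^sup>2 + (norm g)\<^sup>2)"
    by (simp add: power2_norm_eq_inner inner_add_left inner_add_right inner_diff_left
        inner_diff_right inner_commute algebra_simps)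
  also have "\<dots> = 4 * (c * norm f * norm f)"
    by (simp add: ng power2_eq_square)
  finally have "inner (R f) g \<le> c * norm f * norm f" by simp
  moreover have "inner (R f) g = norm f * norm (R f)"
    using False by (simp add: g_def power2_norm_eq_inner[symmetric] power2_eq_square)
  ultimately have "norm (R f) * norm f \<le> (c * norm f) * norm f"
    by (simp add: mult_ac)
  then show ?thesis
    using False by simp
qed

locale pvm =
  fixes P :: "real set \<Rightarrow> 'a::real_inner \<Rightarrow> 'a"
  assumes lin: "B \<in> sets borel \<Longrightarrow> linear (P B)"
    and sym: "B \<in> sets borel \<Longrightarrow> inner (P B f) g = inner f (P B g)"
    and univ: "P UNIV f = f"
    and int: "A \<in> sets borel \<Longrightarrow> B \<in> sets borel \<Longrightarrow> P (A \<inter> B) f = P A (P B f)"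
    and countably_additive: "range X \<subseteq> sets borel \<Longrightarrow> disjoint_family X \<Longrightarrow>
      (\<lambda>n::nat. norm (P (\<Union>i. X i) f - (\<Sum>i<n. P (X i) f))) \<longlonglongrightarrow> 0"
begin

definition scalar_measure :: "'a \<Rightarrow> real measure" where
  "scalar_measure f = measure_of UNIV (sets borel) (\<lambda>B. ennreal (inner (P B f) f))"

lemma inner_nonneg:
  assumes "B \<in> sets borel"
  shows "0 \<le> inner (P B f) f"
proof -
  have "inner (P B f) f = inner (P B (P B f)) f"
    using int[OF assms assms, of f] by simp
  also have "\<dots> = inner (P B f) (P B f)"
    by (rule sym[OF assms])
  finally show ?thesis by simp
qed

lemma sums: "range A \<subseteq> sets borel \<Longrightarrow> disjoint_family A \<Longrightarrow> (\<lambda>i. P (A i) f) sums P (\<Union>i. A i) f"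
  unfolding sums_def using countably_additive[of A f]
  by (subst LIM_zero_iff[symmetric], subst tendsto_norm_zero_iff[symmetric]) (simp add: norm_minus_commute)

lemma empty [simp]: "P {} f = 0"
proof -
  \<comment> \<open>Empty sets form a disjoint family with empty union, so a constant series
    converges, which forces its term to vanish.\<close>
  have "(\<lambda>i::nat. P {} f) sums P {} f"
    using sums[of "\<lambda>_. {}" f] by (simp add: disjoint_family_on_def)
  then have "summable (\<lambda>i::nat. P {} f)" by (rule sums_summable)
  then show ?thesis by (simp add: summable_const_iff)
qed

lemma sets_scalar_measure [simp]: "sets (scalar_measure f) = sets borel"
  using sets.sigma_sets_eq[of "borel :: real measure"] by (simp add: scalar_measure_def)

lemma space_scalar_measure [simp]: "space (scalar_measure f) = UNIV"
  by (simp add: scalar_measure_def)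

lemma emeasure_scalar_measure:
  assumes "B \<in> sets borel"
  shows "emeasure (scalar_measure f) B = ennreal (inner (P B f) f)"
proof -
  let ?m = "\<lambda>B. ennreal (inner (P B f) f)"
  have "countably_additive (sets borel) ?m"
    unfolding countably_additive_def
  proof (intro allI impI)
    fix A :: "nat \<Rightarrow> real set"
    assume A: "range A \<subseteq> sets borel" "disjoint_family A"
    have "(\<lambda>i. inner (P (A i) f) f) sums inner (P (\<Union>i. A i) f) f"
      by (rule bounded_linear.sums[OF bounded_linear_inner_left sums[OF A]])
    then show "suminf (\<lambda>i. ?m (A i)) = ?m (\<Union>i. A i)"
      using A by (intro suminf_ennreal_eq inner_nonneg) auto
  qed
  moreover have "positive (sets borel) ?m"
    by (simp add: positive_def)
  ultimately show ?thesis
    unfolding scalar_measure_def using assms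
    by (intro emeasure_measure_of_sigma) (auto simp: sets.sigma_algebra_axioms[of borel, simplified])
qed

sublocale scalar: finite_measure "scalar_measure f"
  by (rule finite_measureI) (simp add: emeasure_scalar_measure)

lemma measure_scalar_measure: "B \<in> sets borel \<Longrightarrow> measure (scalar_measure f) B = inner (P B f) f"
  by (simp add: measure_def emeasure_scalar_measure inner_nonneg)

lemma supported_scalar_measure:
  assumes "P {-a..a} f = f"
  shows "supported_measure a (scalar_measure f)"
  unfolding supported_measure_def
proof (intro conjI)
  have "measure (scalar_measure f) {-a..a} = measure (scalar_measure f) UNIV"
    using assms by (simp add: measure_scalar_measure univ)
  then have "measure (scalar_measure f) (UNIV - {-a..a}) = 0"
    using scalar.finite_measure_compl[of "{-a..a}" f] by simp
  then have "UNIV - {-a..a} \<in> null_sets (scalar_measure f)"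
    by (intro null_setsI) (auto simp: scalar.emeasure_eq_measure)
  then show "AE t in scalar_measure f. \<bar>t\<bar> \<le> a"
    by (rule AE_I') auto
qed (simp_all add: scalar.finite_measure_axioms)

lemma sum_proj:
  assumes "finite J" "\<And>j. j \<in> J \<Longrightarrow> A j \<in> sets borel" "disjoint_family_on A J"
  shows "(\<Sum>j\<in>J. P (A j) f) = P (\<Union>j\<in>J. A j) f"
  using assms
proof (induction J)
  case (insert j J)
  let ?U = "\<Union>j\<in>J. A j"
  have U: "?U \<in> sets borel" "A j \<in> sets borel" "A j \<inter> ?U = {}"
    using insert by (auto simp: disjoint_family_on_def)
  have "P (A j \<union> ?U) f = P (A j) f + P ?U f"
  proof -
    \<comment> \<open>Finite additivity is countable additivity for the sequence \<open>A j\<close>,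
      \<open>?U\<close>, \<open>{}\<close>, \<open>{}\<close>, and so on.\<close>
    have "disjoint_family (binaryset (A j) ?U)"
      using U(3) by (auto simp: disjoint_family_on_def binaryset_def)
    moreover have "range (binaryset (A j) ?U) \<subseteq> sets borel"
      using U(1,2) by (simp add: range_binaryset_eq)
    ultimately have "(\<lambda>i. P (binaryset (A j) ?U i) f) sums P (A j \<union> ?U) f"
      using sums[of "binaryset (A j) ?U" f] by (simp only: UN_binaryset_eq)
    moreover have "(\<lambda>i. P (binaryset (A j) ?U i) f) sums (\<Sum>i<2. P (binaryset (A j) ?U i) f)"
      by (rule sums_finite) (auto simp: binaryset_def)
    ultimately show ?thesis
      by (simp add: sums_unique2[of "\<lambda>i. P (binaryset (A j) ?U i) f"] binaryset_def numeral_2_eq_2)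
  qed
  moreover have "(\<Sum>j\<in>J. P (A j) f) = P ?U f"
    using insert by (auto simp: disjoint_family_on_def)
  ultimately show ?case
    using insert by simp
qed simp

end

text \<open>\<open>S\<close> is approximated in norm by \<open>\<Sum>j. (j / k) P {t. \<lfloor>k t\<rfloor> = j}\<close>, on which polynomials are computed
  termwise.\<close>

locale selfadjoint_pvm = bounded_selfadjoint S b + pvm P
  for S :: "'a::{real_inner, complete_space} \<Rightarrow> 'a" and b and P :: "real set \<Rightarrow> 'a \<Rightarrow> 'a" +
  fixes a :: real
  assumes support: "P {-a..a} f = f"
    and resolution: "inner (S f) f = (\<integral>t. t \<partial>scalar_measure f)"
begin

text \<open>The assumption \<open>resolution\<close> gives first moments only. Through quadratic
  forms it makes the step operators close to \<open>S\<close> in norm. The pieces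
  \<open>P (B k j)\<close> are orthogonal idempotents, so \<open>D k q\<close> obeys the Horner
  recursion of \<open>poly_op\<close>, and the limit in \<open>k\<close> identifies all
  moments.\<close>

lemma integral_poly_scalar_measure:
  "(\<integral>t. poly q t \<partial>scalar_measure f) = inner (poly_op S q f) f"
proof -
  \<comment> \<open>\<open>st k\<close> rounds down to the grid of mesh \<open>1 / Suc k\<close>.
    Its level sets are the \<open>B k j\<close>, and those indexed by \<open>J k\<close> cover
    \<open>{-a..a}\<close>, which makes the sums finite.\<close>
  define st where "st k t = real_of_int \<lfloor>real (Suc k) * t\<rfloor> / real (Suc k)" for k t
  define B where "B k j = {t::real. \<lfloor>real (Suc k) * t\<rfloor> = j}" for k j
  define J where "J k = {\<lfloor>real (Suc k) * (-a)\<rfloor>..\<lfloor>real (Suc k) * a\<rfloor>}" for k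
  define D where "D k q f = (\<Sum>j\<in>J k. poly q (real_of_int j / real (Suc k)) *\<^sub>R P (B k j) f)" for k q f
  have finJ: "finite (J k)" for k by (simp add: J_def)
  have B: "B k j \<in> sets borel" for k j
    unfolding B_def by measurable
  have disj: "disjoint_family_on (B k) I" for k I
    by (auto simp: disjoint_family_on_def B_def)
  have PB_lin: "linear (P (B k j))" for k j by (rule lin[OF B])
  have cover: "{-a..a} \<subseteq> (\<Union>j\<in>J k. B k j)" for k
  proof
    fix t assume "t \<in> {-a..a}"
    then have "-a \<le> t" "t \<le> a" by auto
    then have "real (Suc k) * (-a) \<le> real (Suc k) * t" "real (Suc k) * t \<le> real (Suc k) * a"
      by (simp_all only: mult_left_mono of_nat_0_le_iff)
    then show "t \<in> (\<Union>j\<in>J k. B k j)"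
      by (auto simp: J_def B_def simp del: of_nat_Suc mult_minus_right intro: floor_mono)
  qed
  have sumB: "(\<Sum>j\<in>J k. P (B k j) f) = f" for k f
  proof -
    have U: "(\<Union>j\<in>J k. B k j) \<in> sets borel"
      using finJ B by auto
    have "(\<Sum>j\<in>J k. P (B k j) f) = P (\<Union>j\<in>J k. B k j) (P {-a..a} f)"
      by (simp add: sum_proj[OF finJ B disj] support)
    also have "\<dots> = P ((\<Union>j\<in>J k. B k j) \<inter> {-a..a}) f"
      by (rule int[symmetric, OF U]) simp
    also have "(\<Union>j\<in>J k. B k j) \<inter> {-a..a} = {-a..a}"
      using cover[of k] by blast
    finally show ?thesis by (simp add: support)
  qed
  have PBB: "P (B k i) (P (B k j) f) = (if i = j then P (B k i) f else 0)" for k i j f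
  proof -
    have "B k i \<inter> B k j = (if i = j then B k i else {})"
      by (auto simp: B_def)
    then show ?thesis
      using int[OF B B, of k i k j f] by (auto split: if_splits)
  qed
  have D_linear: "linear (D k q)" for k q
    by (rule linearI)
      (simp_all add: D_def linear_add[OF PB_lin] linear_scale[OF PB_lin] scaleR_add_right
        sum.distrib scaleR_sum_right mult_ac)
  \<comment> \<open>The constant term uses \<open>sumB\<close>: the finitely many pieces already add
    up to the identity.\<close>
  have D_pCons: "D k (pCons c q) f = c *\<^sub>R f + D k [:0, 1:] (D k q f)" for k c q f
  proof -
    have "P (B k j) (D k q f) = poly q (real_of_int j / real (Suc k)) *\<^sub>R P (B k j) f" if "j \<in> J k" for j
      using that finJ[of k] by (simp add: D_def linear_sum[OF PB_lin] linear_scale[OF PB_lin] PBB if_distrib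
          cong: if_cong)
    then have "D k [:0, 1:] (D k q f) =
        (\<Sum>j\<in>J k. (real_of_int j / real (Suc k) * poly q (real_of_int j / real (Suc k))) *\<^sub>R P (B k j) f)"
      unfolding D_def[of k "[:0, 1:]"] by (intro sum.cong) simp_all
    moreover have "c *\<^sub>R f = (\<Sum>j\<in>J k. c *\<^sub>R P (B k j) f)"
      by (simp add: scaleR_sum_right[symmetric] sumB)
    ultimately show ?thesis
      by (simp add: D_def[of k "pCons c q"] scaleR_add_left sum.distrib)
  qed
  have D_sym: "inner (D k q f) g = inner f (D k q g)" for k q f g
    by (simp add: D_def inner_sum_left inner_sum_right sym[OF B])
  have st_meas: "st k \<in> borel_measurable borel" for k
    unfolding st_def by measurable
  have st_approx: "\<bar>t - st k t\<bar> \<le> inverse (real (Suc k))" for k t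
  proof -
    have "real_of_int \<lfloor>real (Suc k) * t\<rfloor> \<le> real (Suc k) * t"
        "real (Suc k) * t \<le> real_of_int \<lfloor>real (Suc k) * t\<rfloor> + 1"
      by linarith+
    then have "st k t \<le> t" "t \<le> st k t + inverse (real (Suc k))"
      unfolding st_def by (simp_all add: field_simps del: of_nat_Suc)
    then show ?thesis by linarith
  qed
  have supp: "supported_measure a (scalar_measure f)" for f
    by (rule supported_scalar_measure[OF support])
  have bb_poly_st: "bounded_borel_on a (\<lambda>t. poly q (st k t))" for k q
  proof -
    \<comment> \<open>Rounding may leave \<open>{-a..a}\<close>, but by at most 1.\<close>
    obtain C where C: "\<And>t. \<bar>t\<bar> \<le> \<bar>a\<bar> + 1 \<Longrightarrow> \<bar>poly q t\<bar> \<le> C"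
      using bounded_borel_on_poly[of "\<bar>a\<bar> + 1" q] unfolding bounded_borel_on_def by blast
    show ?thesis
    proof (rule bounded_borel_onI)
      show "(\<lambda>t. poly q (st k t)) \<in> borel_measurable borel"
        by (rule measurable_compose[OF st_meas borel_measurable_continuous_onI]) (intro continuous_intros)
      show "\<bar>poly q (st k t)\<bar> \<le> C" if "\<bar>t\<bar> \<le> a" for t
      proof -
        have "inverse (real (Suc k)) \<le> 1"
          by (simp add: field_simps)
        then show ?thesis
          using st_approx[of t k] that by (intro C) linarith
      qed
    qed
  qed
  have D_integral: "inner (D k q f) f = (\<integral>t. poly q (st k t) \<partial>scalar_measure f)" for k q f
  proof -
    have "(\<integral>t. poly q (st k t) \<partial>scalar_measure f) =
        (\<integral>t. (\<Sum>j\<in>J k. poly q (real_of_int j / real (Suc k)) * indicator (B k j) t) \<partial>scalar_measure f)"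
    proof (rule integral_cong_AE)
      show "AE t in scalar_measure f. poly q (st k t) =
          (\<Sum>j\<in>J k. poly q (real_of_int j / real (Suc k)) * indicator (B k j) t)"
        using supported_measureD(3)[OF supp]
      proof eventually_elim
        case (elim t)
        then have "t \<in> (\<Union>j\<in>J k. B k j)"
          using cover[of k] by (auto simp: abs_le_iff subset_iff)
        then have "\<lfloor>real (Suc k) * t\<rfloor> \<in> J k"
          by (auto simp: B_def)
        then have "{j. j \<in> J k \<and> t \<in> B k j} = {\<lfloor>real (Suc k) * t\<rfloor>}"
          by (auto simp: B_def)
        then show ?case
          using finJ[of k] by (simp add: st_def del: of_nat_Suc)
      qed
      show "(\<lambda>t. poly q (st k t)) \<in> borel_measurable (scalar_measure f)"
        by (rule borel_measurable_integrable, rule bounded_borel_on_integrable[OF supp bb_poly_st])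
    qed (use B in \<open>auto intro!: borel_measurable_sum borel_measurable_times borel_measurable_indicator\<close>)
    also have "\<dots> = (\<Sum>j\<in>J k. poly q (real_of_int j / real (Suc k)) * measure (scalar_measure f) (B k j))"
    proof (subst Bochner_Integration.integral_sum)
      show "integrable (scalar_measure f) (\<lambda>t. poly q (real_of_int j / real (Suc k)) * indicator (B k j) t)" for j
        by (intro bounded_borel_on_integrable[OF supp] bounded_borel_on_intros B)
    qed (use B in simp)
    also have "\<dots> = inner (D k q f) f"
      by (simp add: D_def inner_sum_left measure_scalar_measure[OF B])
    finally show ?thesis ..
  qed
  \<comment> \<open>The comparison must be uniform in the vector, because it will be applied to
    \<open>D k q f\<close>, which moves with \<open>k\<close>.\<close>
  have norm_S_D: "norm (S f - D k [:0, 1:] f) \<le> inverse (real (Suc k)) * norm f" for k f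
  proof (rule norm_le_if_quadratic_form_le[of "\<lambda>f. S f - D k [:0, 1:] f"])
    show "linear (\<lambda>f. S f - D k [:0, 1:] f)"
      by (rule linear_compose_sub[OF linear D_linear])
    show "inner (S f - D k [:0, 1:] f) g = inner f (S g - D k [:0, 1:] g)" for f g
      by (simp add: inner_diff_left inner_diff_right selfadjoint D_sym)
    fix f
    have st_int: "integrable (scalar_measure f) (st k)" "integrable (scalar_measure f) (\<lambda>t. t)"
    proof -
      have "poly [:0, 1:] = (\<lambda>t::real. t)" by auto
      then show "integrable (scalar_measure f) (\<lambda>t. t)"
        using bounded_borel_on_integrable[OF supp bounded_borel_on_poly[of a "[:0, 1:]"]] by simp
    qed (use bounded_borel_on_integrable[OF supp bb_poly_st[of "[:0, 1:]" k]] in simp)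
    have "inner (S f - D k [:0, 1:] f) f = (\<integral>t. t - st k t \<partial>scalar_measure f)"
      using st_int by (simp add: inner_diff_left resolution D_integral)
    also have "\<bar>\<dots>\<bar> \<le> (\<integral>t. \<bar>t - st k t\<bar> \<partial>scalar_measure f)"
      using integral_norm_bound[of "scalar_measure f" "\<lambda>t. t - st k t"] by simp
    also have "\<dots> \<le> (\<integral>t. inverse (real (Suc k)) \<partial>scalar_measure f)"
      by (rule integral_mono) (use st_int st_approx in auto)
    also have "\<dots> = inverse (real (Suc k)) * (norm f)\<^sup>2"
      by (simp add: measure_scalar_measure univ power2_norm_eq_inner mult.commute)
    finally show "\<bar>inner (S f - D k [:0, 1:] f) f\<bar> \<le> inverse (real (Suc k)) * (norm f)\<^sup>2" .
  qed
  have "(\<lambda>k. D k q f) \<longlonglongrightarrow> poly_op S q f" for q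
  proof (induction q)
    case 0
    show ?case by (simp add: D_def)
  next
    case (pCons c q)
    have "(\<lambda>k. inverse (real (Suc k)) * norm (D k q f)) \<longlonglongrightarrow> 0 * norm (poly_op S q f)"
      by (intro tendsto_mult LIMSEQ_inverse_real_of_nat tendsto_norm pCons)
    then have z: "(\<lambda>k. inverse (real (Suc k)) * norm (D k q f)) \<longlonglongrightarrow> 0"
      by (simp only: mult_zero_left)
    have "(\<lambda>k. S (D k q f) - D k [:0, 1:] (D k q f)) \<longlonglongrightarrow> 0"
      by (rule Lim_null_comparison[OF always_eventually z]) (intro allI norm_S_D)
    from tendsto_diff[OF bounded_linear.tendsto[OF bounded_linear pCons(2)] this]
    have "(\<lambda>k. D k [:0, 1:] (D k q f)) \<longlonglongrightarrow> S (poly_op S q f)" by simp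
    then show ?case
      unfolding D_pCons[of _ c q f] poly_op_pCons by (intro tendsto_add tendsto_const)
  qed
  then have lim1: "(\<lambda>k. inner (D k q f) f) \<longlonglongrightarrow> inner (poly_op S q f) f"
    by (intro tendsto_inner tendsto_const)
  have lim2: "(\<lambda>k. \<integral>t. poly q (st k t) \<partial>scalar_measure f) \<longlonglongrightarrow> (\<integral>t. poly q t \<partial>scalar_measure f)"
  proof -
    obtain C where C: "\<And>t. \<bar>t\<bar> \<le> \<bar>a\<bar> + 1 \<Longrightarrow> \<bar>poly q t\<bar> \<le> C"
      using bounded_borel_on_poly[of "\<bar>a\<bar> + 1" q] unfolding bounded_borel_on_def by blast
    show ?thesis
    proof (rule integral_dominated_convergence[where w="\<lambda>_. C"])
      show "poly q \<in> borel_measurable (scalar_measure f)"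
        by (rule borel_measurable_integrable, rule bounded_borel_on_integrable[OF supp bounded_borel_on_poly])
      show "(\<lambda>t. poly q (st k t)) \<in> borel_measurable (scalar_measure f)" for k
        by (rule borel_measurable_integrable, rule bounded_borel_on_integrable[OF supp bb_poly_st])
      show "AE t in scalar_measure f. (\<lambda>k. poly q (st k t)) \<longlonglongrightarrow> poly q t"
      proof (rule AE_I2)
        fix t
        have "(\<lambda>k. t - st k t) \<longlonglongrightarrow> 0"
          by (rule Lim_null_comparison[OF always_eventually LIMSEQ_inverse_real_of_nat])
            (simp add: st_approx del: of_nat_Suc)
        from tendsto_diff[OF tendsto_const[of t] this] have "(\<lambda>k. st k t) \<longlonglongrightarrow> t" by simp
        then show "(\<lambda>k. poly q (st k t)) \<longlonglongrightarrow> poly q t"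
          by (rule tendsto_poly)
      qed
      show "AE t in scalar_measure f. norm (poly q (st k t)) \<le> C" for k
        using supported_measureD(3)[OF supp]
      proof eventually_elim
        case (elim t)
        have "inverse (real (Suc k)) \<le> 1"
          by (simp add: field_simps)
        then show ?case
          using st_approx[of t k] elim by (simp del: of_nat_Suc, intro C) linarith
      qed
    qed simp
  qed
  show ?thesis
    using LIMSEQ_unique[OF lim1] lim2 by (simp add: D_integral)
qed

theorem scalar_measure_eq_spec_measure: "scalar_measure f = spec_measure f"
  by (rule spec_measure_eqI[symmetric, OF supported_scalar_measure[OF support] integral_poly_scalar_measure])

end

section \<open>The Hilbert space of square-summable functions\<close>

lemma ell2_add: 
  assumes "f \<in> ell2" "g \<in> ell2"
  shows "(\<lambda>x. f x + g x) \<in> ell2"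
proof -
  have "(\<lambda>x. 2 * (cmod (f x))\<^sup>2 + 2 * (cmod (g x))\<^sup>2) summable_on UNIV"
    using assms unfolding ell2_def by (intro summable_on_add summable_on_cmult_right) auto
  moreover have "(cmod (f x + g x))\<^sup>2 \<le> 2 * (cmod (f x))\<^sup>2 + 2 * (cmod (g x))\<^sup>2" for x
  proof -
    have "(cmod (f x + g x))\<^sup>2 \<le> (cmod (f x) + cmod (g x))\<^sup>2"
      by (intro power_mono norm_triangle_ineq) simp
    also have "\<dots> \<le> 2 * (cmod (f x))\<^sup>2 + 2 * (cmod (g x))\<^sup>2"
      using zero_le_power2[of "cmod (f x) - cmod (g x)"] by (simp add: power2_eq_square algebra_simps)
    finally show ?thesis .
  qed
  ultimately show ?thesis
    unfolding ell2_def by (auto intro: summable_on_comparison_test)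
qed

lemma ell2_scale: "f \<in> ell2 \<Longrightarrow> (\<lambda>x. c * f x) \<in> ell2"
  unfolding ell2_def by (simp add: norm_mult power_mult_distrib summable_on_cmult_right)

lemma ell2_zero: "(\<lambda>_. 0) \<in> ell2"
  by (simp add: ell2_def)

lemma ell2_mult_summable:
  assumes "f \<in> ell2" "g \<in> ell2"
  shows "(\<lambda>x. norm (f x * cnj (g x))) summable_on UNIV"
proof (rule summable_on_comparison_test)
  show "(\<lambda>x. (cmod (f x))\<^sup>2 + (cmod (g x))\<^sup>2) summable_on UNIV"
    using assms unfolding ell2_def by (intro summable_on_add) auto
  show "norm (f x * cnj (g x)) \<le> (cmod (f x))\<^sup>2 + (cmod (g x))\<^sup>2" for x
    using zero_le_power2[of "cmod (f x) - cmod (g x)"] zero_le_power2[of "cmod (f x)"] zero_le_power2[of "cmod (g x)"]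
    unfolding power2_diff norm_mult complex_mod_cnj by linarith
qed simp

lemma ell2_inner_add_left:
  assumes "f \<in> ell2" "g \<in> ell2" "h \<in> ell2"
  shows "ell2_inner (\<lambda>x. f x + g x) h = ell2_inner f h + ell2_inner g h"
proof -
  have "(\<Sum>\<^sub>\<infinity>x. f x * cnj (h x) + g x * cnj (h x)) =
      (\<Sum>\<^sub>\<infinity>x. f x * cnj (h x)) + (\<Sum>\<^sub>\<infinity>x. g x * cnj (h x))"
    by (rule infsum_add) (rule abs_summable_summable, rule ell2_mult_summable, fact, fact)+
  then show ?thesis
    by (simp add: ell2_inner_def distrib_right)
qed

lemma ell2_inner_scale_left: "ell2_inner (\<lambda>x. c * f x) g = c * ell2_inner f g"
  unfolding ell2_inner_def mult.assoc by (rule infsum_cmult_right')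

lemma ell2_inner_scale_right: "ell2_inner f (\<lambda>x. c * g x) = cnj c * ell2_inner f g"
proof -
  have "ell2_inner f (\<lambda>x. c * g x) = (\<Sum>\<^sub>\<infinity>x. cnj c * (f x * cnj (g x)))"
    by (simp add: ell2_inner_def mult_ac)
  then show ?thesis by (simp only: ell2_inner_def infsum_cmult_right')
qed

lemma ell2_inner_commute: "ell2_inner f g = cnj (ell2_inner g f)"
  unfolding ell2_inner_def infsum_cnj[symmetric] by (simp add: mult.commute)

text \<open>No summability is assumed: a sum that does not exist has the value 0 on both
  sides.\<close>

lemma infsum_complex_of_real:
  "(\<Sum>\<^sub>\<infinity>x\<in>A. complex_of_real (f x)) = complex_of_real (\<Sum>\<^sub>\<infinity>x\<in>A. f x)"
proof (cases "f summable_on A")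
  case True
  then show ?thesis
    by (intro infsumI has_sum_of_real has_sum_infsum)
next
  case False
  then have "\<not> (\<lambda>x. complex_of_real (f x)) summable_on A"
    using summable_on_Re[of "\<lambda>x. complex_of_real (f x)" A] by auto
  with False show ?thesis
    by (simp add: infsum_not_exists)
qed

lemma ell2_inner_self: "ell2_inner f f = complex_of_real ((ell2_norm f)\<^sup>2)"
proof -
  have "0 \<le> (\<Sum>\<^sub>\<infinity>x. (cmod (f x))\<^sup>2)"
    by (rule infsum_nonneg) simp
  then show ?thesis
    by (simp add: ell2_inner_def ell2_norm_def complex_norm_square[symmetric] flip: of_real_power infsum_complex_of_real)
qed

lemma cmod_le_ell2_norm:
  assumes "f \<in> ell2"
  shows "cmod (f x) \<le> ell2_norm f"
proof -
  have "sum (\<lambda>x. (cmod (f x))\<^sup>2) {x} \<le> (\<Sum>\<^sub>\<infinity>x. (cmod (f x))\<^sup>2)"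
    using assms unfolding ell2_def by (intro finite_sum_le_infsum) auto
  then show ?thesis
    unfolding ell2_norm_def by (intro real_le_rsqrt) simp
qed

text \<open>Both for a pointwise limit and for the image under a transition operator, the bound is
  first obtained on finite sets of coordinates.\<close>

lemma ell2_if_finite_sums_le:
  assumes "\<And>F. finite F \<Longrightarrow> (\<Sum>x\<in>F. (cmod (f x))\<^sup>2) \<le> c\<^sup>2" "0 \<le> c"
  shows "f \<in> ell2" "ell2_norm f \<le> c"
proof -
  have s: "(\<lambda>x. (cmod (f x))\<^sup>2) summable_on UNIV"
    using assms by (intro nonneg_bdd_above_summable_on) (auto intro!: bdd_aboveI)
  then show "f \<in> ell2" by (simp add: ell2_def)
  have "(\<Sum>\<^sub>\<infinity>x. (cmod (f x))\<^sup>2) \<le> c\<^sup>2"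
    using s assms by (intro infsum_le_finite_sums) auto
  then show "ell2_norm f \<le> c"
    unfolding ell2_norm_def using assms(2) real_le_lsqrt by (metis infsum_nonneg zero_le_power2)
qed

section \<open>Square-summable functions as a complete real inner product space\<close>

typedef 'a l2 = "ell2 :: ('a \<Rightarrow> complex) set"
  using ell2_zero by blast

setup_lifting type_definition_l2

text \<open>Scalars are restricted to the reals, and the inner product is the real part of the
  complex one, which leaves the norm unchanged.\<close>

instantiation l2 :: (type) real_inner
begin

lift_definition zero_l2 :: "'a l2" is "\<lambda>_. 0" by (rule ell2_zero)
lift_definition plus_l2 :: "'a l2 \<Rightarrow> 'a l2 \<Rightarrow> 'a l2" is "\<lambda>f g x. f x + g x" by (rule ell2_add)
lift_definition uminus_l2 :: "'a l2 \<Rightarrow> 'a l2" is "\<lambda>f x. - f x" using ell2_scale[of _ "-1"] by simp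
lift_definition minus_l2 :: "'a l2 \<Rightarrow> 'a l2 \<Rightarrow> 'a l2" is "\<lambda>f g x. f x - g x"
  using ell2_add[OF _ ell2_scale[of _ "-1"]] by simp
lift_definition scaleR_l2 :: "real \<Rightarrow> 'a l2 \<Rightarrow> 'a l2" is "\<lambda>c f x. complex_of_real c * f x" by (rule ell2_scale)
lift_definition inner_l2 :: "'a l2 \<Rightarrow> 'a l2 \<Rightarrow> real" is "\<lambda>f g. Re (ell2_inner f g)" .
lift_definition norm_l2 :: "'a l2 \<Rightarrow> real" is ell2_norm .
definition dist_l2 :: "'a l2 \<Rightarrow> 'a l2 \<Rightarrow> real" where "dist_l2 f g = norm (f - g)"
definition sgn_l2 :: "'a l2 \<Rightarrow> 'a l2" where "sgn_l2 f = inverse (norm f) *\<^sub>R f"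
definition uniformity_l2 :: "('a l2 \<times> 'a l2) filter" where
  "uniformity_l2 = (INF e\<in>{0<..}. principal {(f, g). dist f g < e})"
definition open_l2 :: "'a l2 set \<Rightarrow> bool" where
  "open_l2 U = (\<forall>f\<in>U. eventually (\<lambda>(f', g). f' = f \<longrightarrow> g \<in> U) uniformity)"

instance
proof
  fix f g h :: "'a l2" and r s :: real
  show "f + g + h = f + (g + h)" by transfer (simp add: add.assoc)
  show "f + g = g + f" by transfer (simp add: add.commute)
  show "0 + f = f" by transfer simp
  show "- f + f = 0" by transfer simp
  show "f - g = f + - g" by transfer simp
  show "r *\<^sub>R (f + g) = r *\<^sub>R f + r *\<^sub>R g" by transfer (simp add: distrib_left)
  show "(r + s) *\<^sub>R f = r *\<^sub>R f + s *\<^sub>R f" by transfer (simp add: distrib_right)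
  show "r *\<^sub>R s *\<^sub>R f = (r * s) *\<^sub>R f" by transfer (simp add: mult.assoc)
  show "1 *\<^sub>R f = f" by transfer simp
  show "dist f g = norm (f - g)" by (rule dist_l2_def)
  show "sgn f = inverse (norm f) *\<^sub>R f" by (rule sgn_l2_def)
  show "uniformity = (INF e\<in>{0<..}. principal {(f, g :: 'a l2). dist f g < e})" by (rule uniformity_l2_def)
  show "open U = (\<forall>f\<in>U. eventually (\<lambda>(f', g). f' = f \<longrightarrow> g \<in> U) uniformity)" for U :: "'a l2 set"
    by (rule open_l2_def)
  show "inner f g = inner g f"
    by transfer (subst ell2_inner_commute, simp)
  show "inner (f + g) h = inner f h + inner g h"
    by transfer (simp add: ell2_inner_add_left)
  show "inner (r *\<^sub>R f) g = r * inner f g"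
    by transfer (simp add: ell2_inner_scale_left)
  show "0 \<le> inner f f"
    by transfer (simp add: ell2_inner_self)
  show "(inner f f = 0) = (f = 0)"
  proof transfer
    fix f :: "'a \<Rightarrow> complex" assume f: "f \<in> ell2"
    have "f = (\<lambda>_. 0)" if "ell2_norm f = 0"
      using cmod_le_ell2_norm[OF f] that by auto
    moreover have "ell2_norm (\<lambda>_::'a. 0) = 0" by (simp add: ell2_norm_def)
    ultimately show "(Re (ell2_inner f f) = 0) = (f = (\<lambda>_. 0))"
      by (auto simp: ell2_inner_self)
  qed
  show "norm f = sqrt (inner f f)"
    by transfer (simp add: ell2_inner_self ell2_norm_def infsum_nonneg)
qed

end

text \<open>Coordinates converge, and the Cauchy bound passes to the limit on finite sets of
  coordinates, hence to the whole sum.\<close>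

instance l2 :: (type) complete_space
proof
  fix X :: "nat \<Rightarrow> 'a l2" assume X: "Cauchy X"
  have "Cauchy (\<lambda>n. Rep_l2 (X n) x)" for x
  proof (rule CauchyI)
    fix e :: real assume "0 < e"
    then obtain N where N: "\<And>m n. m \<ge> N \<Longrightarrow> n \<ge> N \<Longrightarrow> norm (X m - X n) < e"
      using CauchyD[OF X] by blast
    have "norm (Rep_l2 (X m) x - Rep_l2 (X n) x) \<le> norm (X m - X n)" for m n
      using cmod_le_ell2_norm[OF Rep_l2[of "X m - X n"], of x] by (simp add: minus_l2.rep_eq norm_l2.rep_eq)
    then show "\<exists>N. \<forall>m\<ge>N. \<forall>n\<ge>N. norm (Rep_l2 (X m) x - Rep_l2 (X n) x) < e"
      using N by (meson order_le_less_trans)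
  qed
  then obtain g where g: "\<And>x. (\<lambda>n. Rep_l2 (X n) x) \<longlonglongrightarrow> g x"
    unfolding Cauchy_convergent_iff convergent_def by metis
  have bound: "\<exists>N. \<forall>m\<ge>N. (\<lambda>x. Rep_l2 (X m) x - g x) \<in> ell2 \<and> ell2_norm (\<lambda>x. Rep_l2 (X m) x - g x) \<le> e"
    if e: "0 < e" for e
  proof -
    obtain N where N: "\<And>m n. m \<ge> N \<Longrightarrow> n \<ge> N \<Longrightarrow> norm (X m - X n) < e"
      using CauchyD[OF X e] by blast
    have "(\<Sum>x\<in>F. (cmod (Rep_l2 (X m) x - g x))\<^sup>2) \<le> e\<^sup>2" if m: "m \<ge> N" and F: "finite F" for m F
    proof (rule tendsto_upperbound)
      show "(\<lambda>n. \<Sum>x\<in>F. (cmod (Rep_l2 (X m) x - Rep_l2 (X n) x))\<^sup>2) \<longlonglongrightarrow>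
          (\<Sum>x\<in>F. (cmod (Rep_l2 (X m) x - g x))\<^sup>2)"
        by (intro tendsto_intros g)
      show "\<forall>\<^sub>F n in sequentially. (\<Sum>x\<in>F. (cmod (Rep_l2 (X m) x - Rep_l2 (X n) x))\<^sup>2) \<le> e\<^sup>2"
        using eventually_ge_at_top[of N]
      proof eventually_elim
        case (elim n)
        let ?d = "Rep_l2 (X m - X n)"
        have "(\<Sum>x\<in>F. (cmod (?d x))\<^sup>2) \<le> (\<Sum>\<^sub>\<infinity>x. (cmod (?d x))\<^sup>2)"
          using Rep_l2[of "X m - X n"] F unfolding ell2_def by (intro finite_sum_le_infsum) auto
        also have "\<dots> = (norm (X m - X n))\<^sup>2"
          by (simp add: norm_l2.rep_eq ell2_norm_def infsum_nonneg)
        also have "\<dots> \<le> e\<^sup>2"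
          using N[OF m elim] by (intro power_mono) auto
        finally show ?case by (simp add: minus_l2.rep_eq)
      qed
    qed simp
    then show ?thesis
      using e by (intro exI[of _ N]) (auto intro!: ell2_if_finite_sums_le)
  qed
  obtain M where M: "(\<lambda>x. Rep_l2 (X M) x - g x) \<in> ell2"
    using bound[of 1] by auto
  \<comment> \<open>The limit \<open>g\<close> is square-summable as the difference of
    \<open>X M\<close> and \<open>X M - g\<close>.\<close>
  have "(\<lambda>x. Rep_l2 (X M) x + (-1) * (Rep_l2 (X M) x - g x)) \<in> ell2"
    by (intro ell2_add Rep_l2 ell2_scale M)
  then have G: "Rep_l2 (Abs_l2 g) = g"
    by (simp add: Abs_l2_inverse)
  have "X \<longlonglongrightarrow> Abs_l2 g"
  proof (rule LIMSEQ_I)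
    fix e :: real assume "0 < e"
    then obtain N where "\<forall>m\<ge>N. ell2_norm (\<lambda>x. Rep_l2 (X m) x - g x) \<le> e / 2"
      using bound[of "e / 2"] by auto
    then have "\<forall>m\<ge>N. norm (X m - Abs_l2 g) \<le> e / 2"
      by (simp add: norm_l2.rep_eq minus_l2.rep_eq G)
    then show "\<exists>N. \<forall>m\<ge>N. norm (X m - Abs_l2 g) < e"
      using \<open>0 < e\<close> by (intro exI[of _ N]) force
  qed
  then show "convergent X" by (auto simp: convergent_def)
qed

section \<open>Complex scalars and the passage of operators to \<open>l2\<close>\<close>

lift_definition cscale :: "complex \<Rightarrow> 'a l2 \<Rightarrow> 'a l2" is "\<lambda>c f x. c * f x" by (rule ell2_scale)

lemma norm_cscale: "norm (cscale c f) = cmod c * norm f"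
  by transfer (simp add: ell2_norm_def norm_mult power_mult_distrib infsum_cmult_right' real_sqrt_mult)

lemma bounded_linear_cscale: "bounded_linear (cscale c)"
proof (rule bounded_linear_intro[where K="cmod c"])
  fix f g :: "'a l2" and r
  show "cscale c (f + g) = cscale c f + cscale c g"
    by transfer (simp add: distrib_left)
  show "cscale c (r *\<^sub>R f) = r *\<^sub>R cscale c f"
    by transfer (simp add: mult_ac)
  show "norm (cscale c f) \<le> norm f * cmod c"
    by (simp add: norm_cscale mult.commute)
qed

text \<open>Pairing with \<open>cscale \<i> g\<close> exposes the imaginary part, so real symmetry
  together with commutation with \<open>cscale \<i>\<close> amounts to complex symmetry.\<close>

lemma inner_cscale_ii: "inner f (cscale \<i> g) = Im (ell2_inner (Rep_l2 f) (Rep_l2 g))"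
  by transfer (simp add: ell2_inner_scale_right)

definition l2_op :: "(('a \<Rightarrow> complex) \<Rightarrow> ('a \<Rightarrow> complex)) \<Rightarrow> 'a l2 \<Rightarrow> 'a l2" where
  "l2_op S f = Abs_l2 (S (Rep_l2 f))"

lemma Rep_l2_op: "bounded_op S \<Longrightarrow> Rep_l2 (l2_op S f) = S (Rep_l2 f)"
  unfolding l2_op_def bounded_op_def using Rep_l2 by (subst Abs_l2_inverse) auto

lemma l2_op_linear:
  assumes "bounded_op S"
  shows "linear (l2_op S)"
proof (rule linearI)
  fix f g :: "'a l2" and r :: real
  have "S (Rep_l2 (f + g)) = (\<lambda>x. S (Rep_l2 f) x + S (Rep_l2 g) x)"
    using assms Rep_l2[of f] Rep_l2[of g] unfolding bounded_op_def plus_l2.rep_eq by blast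
  then show "l2_op S (f + g) = l2_op S f + l2_op S g"
    by (simp add: Rep_l2_inject[symmetric] Rep_l2_op[OF assms] plus_l2.rep_eq)
  have "S (Rep_l2 (r *\<^sub>R f)) = (\<lambda>x. of_real r * S (Rep_l2 f) x)"
    using assms Rep_l2[of f] unfolding bounded_op_def scaleR_l2.rep_eq by blast
  then show "l2_op S (r *\<^sub>R f) = r *\<^sub>R l2_op S f"
    by (simp add: Rep_l2_inject[symmetric] Rep_l2_op[OF assms] scaleR_l2.rep_eq)
qed

lemma l2_op_cscale:
  assumes "bounded_op S"
  shows "l2_op S (cscale c f) = cscale c (l2_op S f)"
proof -
  have "S (Rep_l2 (cscale c f)) = (\<lambda>x. c * S (Rep_l2 f) x)"
    using assms Rep_l2[of f] unfolding bounded_op_def cscale.rep_eq by blast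
  then show ?thesis
    by (simp add: Rep_l2_inject[symmetric] Rep_l2_op[OF assms] cscale.rep_eq)
qed

lemma l2_op_selfadjoint:
  assumes "selfadjoint_op S"
  shows "inner (l2_op S f) g = inner f (l2_op S g)"
  using assms Rep_l2[of f] Rep_l2[of g] unfolding selfadjoint_op_def
  by (simp add: inner_l2.rep_eq Rep_l2_op)

lemma l2_op_bounded:
  assumes "bounded_op S"
  obtains b where "0 < b" "\<And>f. norm (l2_op S f) \<le> b * norm f"
proof -
  obtain M where M: "\<forall>f\<in>ell2. ell2_norm (S f) \<le> M * ell2_norm f"
    using assms unfolding bounded_op_def by blast
  have "norm (l2_op S f) \<le> max M 1 * norm f" for f
  proof -
    have "norm (l2_op S f) \<le> M * norm f"
      using M Rep_l2[of f] by (simp add: norm_l2.rep_eq Rep_l2_op[OF assms])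
    also have "\<dots> \<le> max M 1 * norm f"
      by (intro mult_right_mono) auto
    finally show ?thesis .
  qed
  then show ?thesis by (intro that[of "max M 1"]) auto
qed

lemma Re_Im_ell2_inner:
  "ell2_inner (Rep_l2 f) (Rep_l2 g) = Complex (inner f g) (inner f (cscale \<i> g))"
  using inner_cscale_ii[of f g] by (simp add: complex_eq_iff inner_l2.rep_eq)

lemma bounded_selfadjoint_l2_op:
  assumes "selfadjoint_op S" "0 < b" "\<And>f. norm (l2_op S f) \<le> b * norm f"
  shows "bounded_selfadjoint (l2_op S) b"
  using assms l2_op_linear[of S] l2_op_selfadjoint[OF assms(1)]
  by (intro bounded_selfadjoint.intro) (auto simp: selfadjoint_op_def)

lemma sum_Rep_l2: "Rep_l2 (\<Sum>i\<in>I. X i) x = (\<Sum>i\<in>I. Rep_l2 (X i) x)"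
  by (induction I rule: infinite_finite_induct) (simp_all add: zero_l2.rep_eq plus_l2.rep_eq)

text \<open>Transported to \<open>l2\<close>, the resolution becomes an instance of
  \<open>selfadjoint_pvm\<close>, whose scalar measures depend on the operator alone.\<close>

lemma spectral_resolution_unique:
  assumes S: "selfadjoint_op S" and b: "0 < b" "\<And>f. norm (l2_op S f) \<le> b * norm f"
    and E: "spectral_resolution S E" and v: "v \<in> ell2"
  shows "pvm_scalar_measure E v = bounded_selfadjoint.spec_measure (l2_op S) b (Abs_l2 v)"
proof -
  interpret S: bounded_selfadjoint "l2_op S" b
    by (rule bounded_selfadjoint_l2_op[OF S b])
  have pv: "projection_valued_measure E"
    using E by (simp add: spectral_resolution_def)
  have sa: "selfadjoint_op (E B)" if "B \<in> sets borel" for B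
    using pv that unfolding projection_valued_measure_def orthogonal_projection_def by blast
  then have bo: "bounded_op (E B)" if "B \<in> sets borel" for B
    using that unfolding selfadjoint_op_def by blast
  obtain a where a: "\<And>f. f \<in> ell2 \<Longrightarrow> E {-a..a} f = f"
    using E unfolding spectral_resolution_def by blast
  define P where "P B = l2_op (E B)" for B
  interpret P: pvm P
  proof (rule pvm.intro)
    fix f g A B and X :: "nat \<Rightarrow> real set"
    show "linear (P B)" if "B \<in> sets borel"
      unfolding P_def by (rule l2_op_linear[OF bo[OF that]])
    show "inner (P B f) g = inner f (P B g)" if "B \<in> sets borel"
      unfolding P_def by (rule l2_op_selfadjoint[OF sa[OF that]])
    show "P UNIV f = f"
      using pv Rep_l2[of f] unfolding projection_valued_measure_def P_def
      by (simp add: Rep_l2_inject[symmetric] Rep_l2_op[OF bo])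
    show "P (A \<inter> B) f = P A (P B f)" if "A \<in> sets borel" "B \<in> sets borel"
    proof -
      have "E (A \<inter> B) (Rep_l2 f) = E A (E B (Rep_l2 f))"
        using pv Rep_l2[of f] that unfolding projection_valued_measure_def by blast
      then show ?thesis
        using that by (simp add: P_def Rep_l2_inject[symmetric] Rep_l2_op[OF bo])
    qed
    show "(\<lambda>n. norm (P (\<Union>i. X i) f - (\<Sum>i<n. P (X i) f))) \<longlonglongrightarrow> 0"
      if X: "range X \<subseteq> sets borel" "disjoint_family X"
    proof -
      have XB: "X i \<in> sets borel" for i using X by auto
      have U: "(\<Union>i. X i) \<in> sets borel" using XB by auto
      have "(\<lambda>N. ell2_norm (\<lambda>x. E (\<Union>n. X n) (Rep_l2 f) x - (\<Sum>n<N. E (X n) (Rep_l2 f) x))) \<longlonglongrightarrow> 0"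
        using pv Rep_l2[of f] X unfolding projection_valued_measure_def by blast
      then show ?thesis
        by (simp add: P_def norm_l2.rep_eq minus_l2.rep_eq sum_Rep_l2 Rep_l2_op[OF bo] U XB)
    qed
  qed
  have scalar: "P.scalar_measure f = pvm_scalar_measure E (Rep_l2 f)" for f
    unfolding P.scalar_measure_def pvm_scalar_measure_def
  proof (rule measure_of_eq)
    fix B :: "real set" assume "B \<in> sigma_sets UNIV (sets borel)"
    then have B: "B \<in> sets borel"
      using sets.sigma_sets_eq[of "borel :: real measure"] by simp
    show "ennreal (inner (P B f) f) = ennreal (Re (ell2_inner (E B (Rep_l2 f)) (Rep_l2 f)))"
      by (simp add: P_def inner_l2.rep_eq Rep_l2_op[OF bo[OF B]])
  qed simp
  interpret SP: selfadjoint_pvm "l2_op S" b P a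
  proof
    fix f
    show "P {-a..a} f = f"
      by (simp add: P_def Rep_l2_inject[symmetric] Rep_l2_op[OF bo] a Rep_l2)
    have "ell2_inner (S (Rep_l2 f)) (Rep_l2 f) =
        complex_of_real (\<integral>t. t \<partial>pvm_scalar_measure E (Rep_l2 f))"
      using E Rep_l2[of f] unfolding spectral_resolution_def by blast
    then show "inner (l2_op S f) f = (\<integral>t. t \<partial>P.scalar_measure f)"
      using S by (simp add: inner_l2.rep_eq Rep_l2_op selfadjoint_op_def scalar)
  qed
  have "pvm_scalar_measure E v = P.scalar_measure (Abs_l2 v)"
    by (simp add: scalar Abs_l2_inverse[OF v])
  then show ?thesis
    by (simp add: SP.scalar_measure_eq_spec_measure)
qed

text \<open>The real spectral projections commute with complex scalars because the operator does.
  This upgrades real linearity and real symmetry to the complex notions that a resolution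
  demands.\<close>

lemma spectral_resolution_exists:
  assumes S: "selfadjoint_op S"
  shows "\<exists>E. spectral_resolution S E"
proof -
  have boS: "bounded_op S" using S by (simp add: selfadjoint_op_def)
  obtain b where b: "0 < b" "\<And>f. norm (l2_op S f) \<le> b * norm f"
    using l2_op_bounded[OF boS] by blast
  interpret S: bounded_selfadjoint "l2_op S" b
    by (rule bounded_selfadjoint_l2_op[OF S b])
  define E where "E B f = Rep_l2 (S.proj B (Abs_l2 f))" for B f
  have Abs_add: "Abs_l2 (\<lambda>x. f x + g x) = Abs_l2 f + Abs_l2 g" if "f \<in> ell2" "g \<in> ell2"
      for f g :: "'a \<Rightarrow> complex"
    using that by (simp add: Rep_l2_inject[symmetric] plus_l2.rep_eq Abs_l2_inverse ell2_add)
  have Abs_scale: "Abs_l2 (\<lambda>x. c * f x) = cscale c (Abs_l2 f)" if "f \<in> ell2" for c and f :: "'a \<Rightarrow> complex"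
    using that by (simp add: Rep_l2_inject[symmetric] cscale.rep_eq Abs_l2_inverse ell2_scale)
  have proj_cscale: "S.proj B (cscale c f) = cscale c (S.proj B f)" if "B \<in> sets borel" for B c f
    using S.proj_commute[OF that bounded_linear_cscale] l2_op_cscale[OF boS] by metis
  have inner_E: "ell2_inner (E B f) g = Complex (inner (S.proj B (Abs_l2 f)) (Abs_l2 g))
      (inner (S.proj B (Abs_l2 f)) (cscale \<i> (Abs_l2 g)))" if "f \<in> ell2" "g \<in> ell2" for B f g
    using Re_Im_ell2_inner[of "S.proj B (Abs_l2 f)" "Abs_l2 g"] that by (simp add: E_def Abs_l2_inverse)
  have inner_E': "ell2_inner f (E B g) = Complex (inner (Abs_l2 f) (S.proj B (Abs_l2 g)))
      (inner (Abs_l2 f) (cscale \<i> (S.proj B (Abs_l2 g))))" if "f \<in> ell2" "g \<in> ell2" for B f g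
    using Re_Im_ell2_inner[of "Abs_l2 f" "S.proj B (Abs_l2 g)"] that by (simp add: E_def Abs_l2_inverse)
  have E_bounded: "bounded_op (E B)" if B: "B \<in> sets borel" for B
    unfolding bounded_op_def
  proof (intro conjI ballI allI exI)
    fix f g :: "'a \<Rightarrow> complex" and c
    assume f: "f \<in> ell2"
    show "E B f \<in> ell2" by (simp add: E_def Rep_l2)
    show "E B (\<lambda>x. c * f x) = (\<lambda>x. c * E B f x)"
      using f by (simp add: E_def Abs_scale proj_cscale[OF B] cscale.rep_eq)
    show "ell2_norm (E B f) \<le> 1 * ell2_norm f"
      using S.norm_proj_le[OF B, of "Abs_l2 f"] f by (simp add: E_def norm_l2.rep_eq Abs_l2_inverse)
    assume g: "g \<in> ell2"
    show "E B (\<lambda>x. f x + g x) = (\<lambda>x. E B f x + E B g x)"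
      using f g by (simp add: E_def Abs_add linear_add[OF S.proj_linear[OF B]] plus_l2.rep_eq)
  qed
  have E_proj: "orthogonal_projection (E B)" if B: "B \<in> sets borel" for B
    unfolding orthogonal_projection_def selfadjoint_op_def
  proof (intro conjI ballI E_bounded[OF B])
    fix f g :: "'a \<Rightarrow> complex" assume f: "f \<in> ell2"
    show "E B (E B f) = E B f"
      using S.proj_Int[OF B B, of "Abs_l2 f"] by (simp add: E_def Rep_l2_inverse)
    assume g: "g \<in> ell2"
    show "ell2_inner (E B f) g = ell2_inner f (E B g)"
      using f g by (simp add: inner_E inner_E' S.proj_selfadjoint[OF B] proj_cscale[OF B])
  qed
  have pv: "projection_valued_measure E"
    unfolding projection_valued_measure_def
  proof (intro conjI ballI allI impI E_proj)
    fix f :: "'a \<Rightarrow> complex" assume f: "f \<in> ell2"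
    show "E UNIV f = f"
      using f by (simp add: E_def S.proj_UNIV Abs_l2_inverse)
    show "E (A \<inter> B) f = E A (E B f)" if "A \<in> sets borel" "B \<in> sets borel" for A B
      using S.proj_Int[OF that] by (simp add: E_def Rep_l2_inverse)
    fix A :: "nat \<Rightarrow> real set" assume A: "range A \<subseteq> sets borel" "disjoint_family A"
    show "(\<lambda>N. ell2_norm (\<lambda>x. E (\<Union>n. A n) f x - (\<Sum>n<N. E (A n) f x))) \<longlonglongrightarrow> 0"
      using S.proj_countably_additive[OF A, of "Abs_l2 f"]
      by (simp add: E_def norm_l2.rep_eq minus_l2.rep_eq sum_Rep_l2)
  qed
  have scalar: "pvm_scalar_measure E f = S.spec_measure (Abs_l2 f)" if f: "f \<in> ell2" for f
  proof -
    let ?\<mu> = "S.spec_measure (Abs_l2 f)"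
    have \<mu>: "sets ?\<mu> = sets borel" "space ?\<mu> = UNIV" "finite_measure ?\<mu>"
      using supported_measureD[OF S.spec_measure(1)] by auto
    have "pvm_scalar_measure E f = measure_of UNIV (sets borel) (emeasure ?\<mu>)"
      unfolding pvm_scalar_measure_def
    proof (rule measure_of_eq)
      fix B :: "real set" assume "B \<in> sigma_sets UNIV (sets borel)"
      then have B: "B \<in> sets borel"
        using sets.sigma_sets_eq[of "borel :: real measure"] by simp
      then show "ennreal (Re (ell2_inner (E B f) f)) = emeasure ?\<mu> B"
        using f \<mu>(3) by (simp add: inner_E S.proj_inner finite_measure.emeasure_eq_measure)
    qed simp
    then show ?thesis
      using measure_of_of_measure[of ?\<mu>] \<mu> by simp
  qed
  have "spectral_resolution S E"
    unfolding spectral_resolution_def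
  proof (intro conjI pv exI ballI)
    fix f :: "'a \<Rightarrow> complex" assume f: "f \<in> ell2"
    show "E {-b..b} f = f"
      using f by (simp add: E_def S.proj_interval Abs_l2_inverse)
    \<comment> \<open>The resolution equates complex numbers, so the quadratic form must also be
      shown to be real.\<close>
    have "Im (ell2_inner (S f) f) = 0"
    proof -
      have "ell2_inner (S f) f = ell2_inner f (S f)"
        using S f by (simp add: selfadjoint_op_def)
      then have "ell2_inner (S f) f = cnj (ell2_inner (S f) f)"
        by (metis ell2_inner_commute)
      then have "Im (ell2_inner (S f) f) = - Im (ell2_inner (S f) f)"
        by (metis cnj.simps(2))
      then show ?thesis by simp
    qed
    moreover have "Re (ell2_inner (S f) f) = (\<integral>t. t \<partial>S.spec_measure (Abs_l2 f))"
      using f by (simp add: S.inner_spec_measure[symmetric] inner_l2.rep_eq Rep_l2_op[OF boS] Abs_l2_inverse)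
    ultimately show "ell2_inner (S f) f = complex_of_real (\<integral>t. t \<partial>pvm_scalar_measure E f)"
      using f by (simp add: complex_eq_iff scalar)
  qed
  then show ?thesis by blast
qed

text \<open>Existence of a resolution supplies a candidate for the description, and every resolution
  yields this same scalar measure.\<close>

theorem spectral_measure_eq_spec_measure:
  assumes S: "selfadjoint_op S" and b: "0 < b" "\<And>f. norm (l2_op S f) \<le> b * norm f" and v: "v \<in> ell2"
  shows "spectral_measure S v = bounded_selfadjoint.spec_measure (l2_op S) b (Abs_l2 v)"
  unfolding spectral_measure_def
proof (rule the_equality)
  obtain E where "spectral_resolution S E"
    using spectral_resolution_exists[OF S] by blast
  then show "\<exists>E. spectral_resolution S E \<and>
      bounded_selfadjoint.spec_measure (l2_op S) b (Abs_l2 v) = pvm_scalar_measure E v"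
    using spectral_resolution_unique[OF S b _ v] by metis
next
  fix \<mu> assume "\<exists>E. spectral_resolution S E \<and> \<mu> = pvm_scalar_measure E v"
  then show "\<mu> = bounded_selfadjoint.spec_measure (l2_op S) b (Abs_l2 v)"
    using spectral_resolution_unique[OF S b _ v] by blast
qed

section \<open>Transition operators of symmetric kernels\<close>

lemma indicator_ell2: "(indicator {x} :: 'a \<Rightarrow> complex) \<in> ell2"
proof -
  have "(\<lambda>y. (cmod (indicator {x} y))\<^sup>2) summable_on UNIV \<longleftrightarrow> (\<lambda>y. (cmod (indicator {x} y))\<^sup>2) summable_on {x}"
    by (rule summable_on_cong_neutral) auto
  then show ?thesis by (simp add: ell2_def)
qed

lemma ell2_inner_indicator: "ell2_inner f (indicator {x}) = f x"
proof -
  have "ell2_inner f (indicator {x}) = (\<Sum>\<^sub>\<infinity>y\<in>{x}. f y * cnj (indicator {x} y))"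
    unfolding ell2_inner_def by (rule infsum_cong_neutral) auto
  then show ?thesis by simp
qed

text \<open>Summability is carried along because the induction step needs it.\<close>

lemma sum_infsum_swap:
  fixes f :: "'i \<Rightarrow> 's \<Rightarrow> real"
  assumes "finite I" "\<And>i. i \<in> I \<Longrightarrow> f i summable_on A"
  shows "(\<Sum>i\<in>I. \<Sum>\<^sub>\<infinity>y\<in>A. f i y) = (\<Sum>\<^sub>\<infinity>y\<in>A. \<Sum>i\<in>I. f i y) \<and>
    (\<lambda>y. \<Sum>i\<in>I. f i y) summable_on A"
  using assms by (induction I) (simp_all add: infsum_add summable_on_add)

locale substochastic_kernel =
  fixes k :: "'s \<Rightarrow> 's \<Rightarrow> real"
  assumes nonneg: "0 \<le> k x y"
    and row_summable: "k x summable_on UNIV"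
    and row_le: "(\<Sum>\<^sub>\<infinity>y. k x y) \<le> 1"
begin

lemma finite_row_le: "finite F \<Longrightarrow> (\<Sum>y\<in>F. k x y) \<le> 1"
  using finite_sum_le_infsum[OF row_summable[of x], of F] row_le[of x] nonneg by fastforce

lemma le_one: "k x y \<le> 1"
  using finite_row_le[of "{y}" x] by simp

lemma mult_summable:
  assumes "\<And>y. 0 \<le> g y" "\<And>y. g y \<le> 1"
  shows "(\<lambda>y. k x y * g y) summable_on UNIV"
  by (rule summable_on_comparison_test[OF row_summable[of x]])
    (auto intro: mult_nonneg_nonneg nonneg assms mult_left_le)

lemma mult_infsum_bounds:
  assumes "\<And>y. 0 \<le> g y" "\<And>y. g y \<le> 1"
  shows "0 \<le> (\<Sum>\<^sub>\<infinity>y. k x y * g y)" "(\<Sum>\<^sub>\<infinity>y. k x y * g y) \<le> 1"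
proof -
  show "0 \<le> (\<Sum>\<^sub>\<infinity>y. k x y * g y)"
    by (intro infsum_nonneg mult_nonneg_nonneg nonneg assms)
  have "(\<Sum>\<^sub>\<infinity>y. k x y * g y) \<le> (\<Sum>\<^sub>\<infinity>y. k x y)"
    by (intro infsum_mono mult_summable row_summable assms) (auto intro: mult_left_le nonneg assms)
  then show "(\<Sum>\<^sub>\<infinity>y. k x y * g y) \<le> 1"
    using row_le[of x] by linarith
qed

lemma n_step_bounds: "0 \<le> n_step k n x y" "n_step k n x y \<le> 1"
  by (induction n arbitrary: x) (auto intro: mult_infsum_bounds)

end

locale symmetric_kernel = substochastic_kernel +
  assumes sym: "k x y = k y x"
begin

lemma weighted_square_summable:
  assumes "f \<in> ell2"
  shows "(\<lambda>y. k x y * (cmod (f y))\<^sup>2) summable_on UNIV"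
  by (rule summable_on_comparison_test[of "\<lambda>y. (cmod (f y))\<^sup>2"])
    (use assms in \<open>auto simp: ell2_def intro: mult_left_le_one_le mult_nonneg_nonneg nonneg le_one\<close>)

lemma weighted_summable:
  assumes "f \<in> ell2"
  shows "(\<lambda>y. norm (complex_of_real (k x y) * f y)) summable_on UNIV"
proof (rule summable_on_comparison_test)
  show "(\<lambda>y. k x y + k x y * (cmod (f y))\<^sup>2) summable_on UNIV"
    by (intro summable_on_add row_summable weighted_square_summable assms)
  show "norm (complex_of_real (k x y) * f y) \<le> k x y + k x y * (cmod (f y))\<^sup>2" for y
  proof -
    have "cmod (f y) \<le> 1 + (cmod (f y))\<^sup>2"
      using zero_le_power2[of "cmod (f y) - 1"] norm_ge_zero[of "f y"]
      unfolding power2_diff power_one by linarith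
    then have "k x y * cmod (f y) \<le> k x y * (1 + (cmod (f y))\<^sup>2)"
      by (intro mult_left_mono nonneg)
    then show ?thesis
      by (simp add: norm_mult nonneg distrib_left)
  qed
qed simp

text \<open>First half of the Schur test: Cauchy-Schwarz for row weights of total mass at most 1.
  The weighted mean \<open>a\<close> is paired with itself, and
  \<open>2 * a * c \<le> c^2 + a^2\<close> is summed over \<open>c = cmod (f y)\<close>.\<close>

lemma transition_op_square_le:
  assumes f: "f \<in> ell2"
  shows "(cmod (transition_op k f x))\<^sup>2 \<le> (\<Sum>\<^sub>\<infinity>y. k x y * (cmod (f y))\<^sup>2)"
proof -
  define a where "a = (\<Sum>\<^sub>\<infinity>y. k x y * cmod (f y))"
  have s: "(\<lambda>y. k x y * cmod (f y)) summable_on UNIV"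
    using weighted_summable[OF f, of x] by (simp add: norm_mult nonneg)
  have "cmod (transition_op k f x) \<le> a"
    using norm_infsum_bound[OF weighted_summable[OF f, of x]]
    by (simp add: transition_op_def a_def norm_mult nonneg)
  moreover have "a\<^sup>2 \<le> (\<Sum>\<^sub>\<infinity>y. k x y * (cmod (f y))\<^sup>2)"
  proof -
    have "2 * a * a = (\<Sum>\<^sub>\<infinity>y. 2 * a * (k x y * cmod (f y)))"
      unfolding a_def by (rule infsum_cmult_right'[symmetric])
    also have "\<dots> \<le> (\<Sum>\<^sub>\<infinity>y. k x y * (cmod (f y))\<^sup>2 + a\<^sup>2 * k x y)"
    proof (rule infsum_mono)
      fix y
      have "2 * a * cmod (f y) \<le> (cmod (f y))\<^sup>2 + a\<^sup>2"
        using zero_le_power2[of "cmod (f y) - a"] by (simp add: power2_diff mult_ac)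
      then have "k x y * (2 * a * cmod (f y)) \<le> k x y * ((cmod (f y))\<^sup>2 + a\<^sup>2)"
        by (intro mult_left_mono nonneg)
      then show "2 * a * (k x y * cmod (f y)) \<le> k x y * (cmod (f y))\<^sup>2 + a\<^sup>2 * k x y"
        by (simp add: algebra_simps)
    qed (intro summable_on_cmult_right summable_on_add weighted_square_summable row_summable f s)+
    also have "\<dots> = (\<Sum>\<^sub>\<infinity>y. k x y * (cmod (f y))\<^sup>2) + a\<^sup>2 * (\<Sum>\<^sub>\<infinity>y. k x y)"
      by (simp add: infsum_add weighted_square_summable[OF f] summable_on_cmult_right row_summable
          infsum_cmult_right')
    also have "\<dots> \<le> (\<Sum>\<^sub>\<infinity>y. k x y * (cmod (f y))\<^sup>2) + a\<^sup>2"
      using mult_left_le[OF row_le[of x] zero_le_power2[of a]] by simp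
    finally show ?thesis by (simp add: power2_eq_square)
  qed
  ultimately show ?thesis
    using power_mono[of "cmod (transition_op k f x)" a 2] by simp
qed

text \<open>Second half of the Schur test: by symmetry the columns also sum to at most 1. A finite
  outer sum avoids exchanging two infinite ones.\<close>

lemma transition_op_finite_sum_le:
  assumes f: "f \<in> ell2" and F: "finite F"
  shows "(\<Sum>x\<in>F. (cmod (transition_op k f x))\<^sup>2) \<le> (ell2_norm f)\<^sup>2"
proof -
  note sum_swap = sum_infsum_swap[OF F, of "\<lambda>x y. k x y * (cmod (f y))\<^sup>2", OF weighted_square_summable[OF f]]
  have "(\<Sum>x\<in>F. (cmod (transition_op k f x))\<^sup>2) \<le> (\<Sum>x\<in>F. (\<Sum>\<^sub>\<infinity>y. k x y * (cmod (f y))\<^sup>2))"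
    by (intro sum_mono transition_op_square_le f)
  also have "\<dots> = (\<Sum>\<^sub>\<infinity>y. (\<Sum>x\<in>F. k x y * (cmod (f y))\<^sup>2))"
    using sum_swap by blast
  also have "\<dots> \<le> (\<Sum>\<^sub>\<infinity>y. (cmod (f y))\<^sup>2)"
  proof (rule infsum_mono)
    show "(\<Sum>x\<in>F. k x y * (cmod (f y))\<^sup>2) \<le> (cmod (f y))\<^sup>2" for y
      unfolding sum_distrib_right[symmetric]
      using finite_row_le[OF F, of y] by (intro mult_left_le_one_le sum_nonneg nonneg) (simp_all add: sym[of _ y])
  qed (use sum_swap f in \<open>auto simp: ell2_def\<close>)
  also have "\<dots> = (ell2_norm f)\<^sup>2"
    by (simp add: ell2_norm_def infsum_nonneg)
  finally show ?thesis .
qed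

lemma ell2_norm_nonneg: "0 \<le> ell2_norm f"
  by (simp add: ell2_norm_def infsum_nonneg)

lemma transition_op_ell2:
  assumes "f \<in> ell2"
  shows "transition_op k f \<in> ell2" "ell2_norm (transition_op k f) \<le> ell2_norm f"
  using ell2_if_finite_sums_le[OF transition_op_finite_sum_le[OF assms] ell2_norm_nonneg] by auto

lemma bounded_op_transition_op: "bounded_op (transition_op k)"
  unfolding bounded_op_def
proof (intro conjI ballI allI exI[of _ 1])
  fix f g :: "'a \<Rightarrow> complex" and c assume f: "f \<in> ell2"
  show "transition_op k f \<in> ell2" "ell2_norm (transition_op k f) \<le> 1 * ell2_norm f"
    using transition_op_ell2[OF f] by auto
  show "transition_op k (\<lambda>x. c * f x) = (\<lambda>x. c * transition_op k f x)"
    unfolding transition_op_def mult.left_commute[of _ c] by (simp only: infsum_cmult_right')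
  assume g: "g \<in> ell2"
  show "transition_op k (\<lambda>x. f x + g x) = (\<lambda>x. transition_op k f x + transition_op k g x)"
    unfolding transition_op_def distrib_left
    by (rule ext, rule infsum_add) (rule abs_summable_summable, rule weighted_summable, fact)+
qed

text \<open>Together with its mirror image this is the majorant that makes the double sum for
  selfadjointness converge absolutely.\<close>

lemma pair_summable:
  assumes g: "g \<in> ell2"
  shows "(\<lambda>(x, y). k x y * (cmod (g x))\<^sup>2) summable_on UNIV \<times> UNIV"
proof (rule summable_on_SigmaI)
  show "((\<lambda>y. case (x, y) of (x, y) \<Rightarrow> k x y * (cmod (g x))\<^sup>2) has_sum
      (\<Sum>\<^sub>\<infinity>y. k x y) * (cmod (g x))\<^sup>2) UNIV" for x
    using has_sum_cmult_left[OF has_sum_infsum[OF row_summable[of x]]] by simp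
  show "(\<lambda>x. (\<Sum>\<^sub>\<infinity>y. k x y) * (cmod (g x))\<^sup>2) summable_on UNIV"
  proof (rule summable_on_comparison_test[of "\<lambda>y. (cmod (g y))\<^sup>2"])
    have "0 \<le> infsum (k x) UNIV" for x
      by (intro infsum_nonneg nonneg)
    then show "(\<Sum>\<^sub>\<infinity>y. k x y) * (cmod (g x))\<^sup>2 \<le> (cmod (g x))\<^sup>2"
        "0 \<le> (\<Sum>\<^sub>\<infinity>y. k x y) * (cmod (g x))\<^sup>2" for x
      using row_le[of x] by (simp_all add: mult_left_le_one_le)
  qed (use g in \<open>simp add: ell2_def\<close>)
qed (auto intro: mult_nonneg_nonneg nonneg)

lemma selfadjoint_transition_op: "selfadjoint_op (transition_op k)"
  unfolding selfadjoint_op_def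
proof (intro conjI ballI bounded_op_transition_op)
  fix f g :: "'a \<Rightarrow> complex" assume f: "f \<in> ell2" and g: "g \<in> ell2"
  have "(\<lambda>(y, x). k x y * (cmod (f y))\<^sup>2) summable_on UNIV \<times> UNIV"
    using pair_summable[OF f] by (simp add: sym)
  then have "(\<lambda>(x, y). k x y * (cmod (f y))\<^sup>2) summable_on UNIV \<times> UNIV"
    using summable_on_swap[of "\<lambda>(y, x). k x y * (cmod (f y))\<^sup>2" UNIV UNIV] by (simp add: case_prod_unfold)
  then have "(\<lambda>(x, y). k x y * (cmod (f y))\<^sup>2 + k x y * (cmod (g x))\<^sup>2) summable_on UNIV \<times> UNIV"
    using summable_on_add[OF _ pair_summable[OF g]] by (simp add: case_prod_unfold)
  then have "(\<lambda>p. norm (case p of (x, y) \<Rightarrow> complex_of_real (k x y) * f y * cnj (g x))) summable_on UNIV \<times> UNIV"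
  proof (rule summable_on_comparison_test)
    fix p :: "'a \<times> 'a"
    obtain x y where p: "p = (x, y)" by (cases p)
    have "cmod (f y) * cmod (g x) \<le> (cmod (f y))\<^sup>2 + (cmod (g x))\<^sup>2"
      using zero_le_power2[of "cmod (f y) - cmod (g x)"] zero_le_power2[of "cmod (f y)"] zero_le_power2[of "cmod (g x)"]
      unfolding power2_diff by linarith
    then have "k x y * (cmod (f y) * cmod (g x)) \<le> k x y * ((cmod (f y))\<^sup>2 + (cmod (g x))\<^sup>2)"
      by (intro mult_left_mono nonneg)
    then show "norm (case p of (x, y) \<Rightarrow> complex_of_real (k x y) * f y * cnj (g x)) \<le>
        (case p of (x, y) \<Rightarrow> k x y * (cmod (f y))\<^sup>2 + k x y * (cmod (g x))\<^sup>2)"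
      by (simp add: p norm_mult nonneg distrib_left mult.assoc)
  qed simp
  then have summable: "(\<lambda>(x, y). complex_of_real (k x y) * f y * cnj (g x)) summable_on UNIV \<times> UNIV"
    by (rule abs_summable_summable)
  have "ell2_inner (transition_op k f) g = (\<Sum>\<^sub>\<infinity>x. \<Sum>\<^sub>\<infinity>y. complex_of_real (k x y) * f y * cnj (g x))"
    by (simp add: ell2_inner_def transition_op_def infsum_cmult_left')
  also have "\<dots> = (\<Sum>\<^sub>\<infinity>y. \<Sum>\<^sub>\<infinity>x. complex_of_real (k x y) * f y * cnj (g x))"
    by (rule infsum_swap_banach[OF summable])
  also have "\<dots> = (\<Sum>\<^sub>\<infinity>y. f y * (\<Sum>\<^sub>\<infinity>x. cnj (complex_of_real (k y x) * g x)))"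
    by (simp add: infsum_cmult_right'[symmetric] mult_ac sym del: infsum_cnj)
  also have "\<dots> = ell2_inner f (transition_op k g)"
    by (simp only: ell2_inner_def transition_op_def infsum_cnj)
  finally show "ell2_inner (transition_op k f) g = ell2_inner f (transition_op k g)" .
qed

lemma n_step_transition_op:
  "transition_op k (\<lambda>x. complex_of_real (n_step k n x y)) = (\<lambda>x. complex_of_real (n_step k (Suc n) x y))"
  unfolding transition_op_def n_step.simps of_real_mult[symmetric] infsum_complex_of_real ..

text \<open>Row and column sums at most 1 make the operator a contraction, whence the radius 1. The
  moments are the pairings of the point mass with its images under the powers of the
  operator.\<close>

theorem spectral_measure_transition_op:
  defines "\<mu> x \<equiv> spectral_measure (transition_op k) (indicator {x})"
  shows "supported_measure 1 (\<mu> x)" "(\<integral>t. t ^ n \<partial>\<mu> x) = n_step k n x x"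
proof -
  let ?T = "transition_op k" and ?d = "Abs_l2 (indicator {x})"
  have b: "norm (l2_op ?T f) \<le> 1 * norm f" for f
    using transition_op_ell2(2)[OF Rep_l2[of f]]
    by (simp add: norm_l2.rep_eq Rep_l2_op[OF bounded_op_transition_op])
  interpret T: bounded_selfadjoint "l2_op ?T" 1
    by (rule bounded_selfadjoint_l2_op[OF selfadjoint_transition_op _ b]) simp
  have \<mu>: "\<mu> x = T.spec_measure ?d"
    unfolding \<mu>_def
    by (rule spectral_measure_eq_spec_measure[OF selfadjoint_transition_op _ b indicator_ell2]) simp
  show "supported_measure 1 (\<mu> x)"
    unfolding \<mu> by (rule T.spec_measure)
  \<comment> \<open>Powers applied to the point mass at \<open>x\<close> vary the starting point
    \<open>z\<close> and keep the target \<open>x\<close>, in line with the recursion of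
    \<open>n_step\<close> on the first step.\<close>
  have step: "Rep_l2 (poly_op (l2_op ?T) ([:0, 1:] ^ n) ?d) = (\<lambda>z. complex_of_real (n_step k n z x))" for n
  proof (induction n)
    case 0
    show ?case by (simp only: power_0 T.poly_op_1 Abs_l2_inverse[OF indicator_ell2]) (auto simp: indicator_def)
  next
    case (Suc n)
    have "poly_op (l2_op ?T) ([:0, 1:] ^ Suc n) ?d =
        poly_op (l2_op ?T) [:0, 1:] (poly_op (l2_op ?T) ([:0, 1:] ^ n) ?d)"
      unfolding power_Suc by (rule T.poly_op_mult)
    also have "\<dots> = l2_op ?T (poly_op (l2_op ?T) ([:0, 1:] ^ n) ?d)"
      by (simp add: linear_0[OF T.linear])
    finally show ?case
      by (simp only: Rep_l2_op[OF bounded_op_transition_op] Suc n_step_transition_op)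
  qed
  have "(\<integral>t. t ^ n \<partial>\<mu> x) = (\<integral>t. poly ([:0, 1:] ^ n) t \<partial>\<mu> x)"
    by simp
  also have "\<dots> = inner (poly_op (l2_op ?T) ([:0, 1:] ^ n) ?d) ?d"
    unfolding \<mu> by (rule T.spec_measure)
  also have "\<dots> = n_step k n x x"
    by (simp add: inner_l2.rep_eq step Abs_l2_inverse indicator_ell2 ell2_inner_indicator)
  finally show "(\<integral>t. t ^ n \<partial>\<mu> x) = n_step k n x x" .
qed

end

section \<open>The lamplighter walk and clusters\<close>

text \<open>The configurations reachable from \<open>\<xi>\<close> by switching lamps in
  \<open>S\<close>. Uniform weights on \<open>agree_off A 0\<close> model random lamps on
  \<open>A\<close> with all others off.\<close>

definition agree_off :: "'v set \<Rightarrow> ('v \<Rightarrow>\<^sub>0 'h::zero) \<Rightarrow> ('v \<Rightarrow>\<^sub>0 'h) set" where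
  "agree_off S \<xi> = {\<eta>. \<forall>z. z \<notin> S \<longrightarrow> Poly_Mapping.lookup \<xi> z = Poly_Mapping.lookup \<eta> z}"

lemma agree_off_sym: "\<eta> \<in> agree_off S \<xi> \<longleftrightarrow> \<xi> \<in> agree_off S \<eta>"
  by (auto simp: agree_off_def)

lemma agree_off_card:
  fixes \<xi> :: "'v \<Rightarrow>\<^sub>0 'h::{finite,zero}"
  assumes S: "finite S"
  shows "finite (agree_off S \<xi>)" "card (agree_off S \<xi>) = CARD('h) ^ card S"
proof -
  let ?r = "\<lambda>\<eta>. restrict (Poly_Mapping.lookup \<eta>) S"
  have "bij_betw ?r (agree_off S \<xi>) (S \<rightarrow>\<^sub>E (UNIV :: 'h set))"
    unfolding bij_betw_def
  proof (intro conjI inj_onI subset_antisym subsetI)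
    fix \<eta> \<zeta> assume *: "\<eta> \<in> agree_off S \<xi>" "\<zeta> \<in> agree_off S \<xi>" "?r \<eta> = ?r \<zeta>"
    have "Poly_Mapping.lookup \<eta> z = Poly_Mapping.lookup \<zeta> z" for z
    proof (cases "z \<in> S")
      case True
      then show ?thesis using fun_cong[OF *(3), of z] by simp
    next
      case False
      then show ?thesis using *(1,2) by (auto simp: agree_off_def)
    qed
    then show "\<eta> = \<zeta>" by (intro poly_mapping_eqI)
  next
    fix h assume h: "h \<in> S \<rightarrow>\<^sub>E (UNIV :: 'h set)"
    define f where "f z = (if z \<in> S then h z else Poly_Mapping.lookup \<xi> z)" for z
    have "finite {z. f z \<noteq> 0}"
      by (rule finite_subset[of _ "S \<union> {z. Poly_Mapping.lookup \<xi> z \<noteq> 0}"])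
        (auto simp: f_def S)
    then have f: "Poly_Mapping.lookup (Abs_poly_mapping f) = f"
      by (rule lookup_Abs_poly_mapping)
    have "Abs_poly_mapping f \<in> agree_off S \<xi>"
      by (simp add: agree_off_def f) (simp add: f_def)
    moreover have "h = ?r (Abs_poly_mapping f)"
      unfolding f using h by (auto simp: f_def restrict_def fun_eq_iff PiE_def extensional_def)
    ultimately show "h \<in> ?r ` agree_off S \<xi>" by blast
  qed auto
  then show "finite (agree_off S \<xi>)" "card (agree_off S \<xi>) = CARD('h) ^ card S"
    using S by (simp_all add: bij_betw_finite bij_betw_same_card finite_PiE card_PiE)
qed

text \<open>If \<open>x \<in> A\<close>, a uniformly random configuration on \<open>A\<close> rerandomized at \<open>x\<close> and \<open>y\<close> is uniformly
  random on \<open>insert y A\<close>.\<close>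

lemma sum_agree_off_step:
  fixes F :: "('v \<Rightarrow>\<^sub>0 'h::{finite,zero}) \<Rightarrow> real"
  assumes A: "finite A" "x \<in> A" "x \<noteq> y"
  shows "(1 / real CARD('h)) ^ card A * (\<Sum>\<xi>\<in>agree_off A 0. (\<Sum>\<eta>\<in>agree_off {x, y} \<xi>. F \<eta>) / (real CARD('h))\<^sup>2) =
    (1 / real CARD('h)) ^ card (insert y A) * (\<Sum>\<eta>\<in>agree_off (insert y A) 0. F \<eta>)"
proof -
  let ?m = "real CARD('h)"
  have m: "?m \<noteq> 0" by simp
  have fin: "finite (agree_off B \<xi>)" if "finite B" for B and \<xi> :: "'v \<Rightarrow>\<^sub>0 'h"
    using agree_off_card(1)[OF that] .
  \<comment> \<open>The reachability relation is symmetric, so the double sum can be organized by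
    \<open>\<eta>\<close>, whose predecessors are then counted.\<close>
  have sub: "agree_off {x, y} \<xi> = {\<eta> \<in> agree_off (insert y A) 0. \<xi> \<in> agree_off {x, y} \<eta>}"
    if "\<xi> \<in> agree_off A 0" for \<xi> :: "'v \<Rightarrow>\<^sub>0 'h"
    using that A by (auto simp: agree_off_def)
  have "(\<Sum>\<xi>\<in>agree_off A 0. (\<Sum>\<eta>\<in>agree_off {x, y} \<xi>. F \<eta>)) =
      (\<Sum>\<xi>\<in>agree_off A 0. \<Sum>\<eta> | \<eta> \<in> agree_off (insert y A) 0 \<and> \<xi> \<in> agree_off {x, y} \<eta>. F \<eta>)"
    by (rule sum.cong) (use sub in auto)
  also have "\<dots> = (\<Sum>\<eta>\<in>agree_off (insert y A) 0. \<Sum>\<xi> | \<xi> \<in> agree_off A 0 \<and> \<xi> \<in> agree_off {x, y} \<eta>. F \<eta>)"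
    using A by (intro sum.swap_restrict fin) auto
  also have "\<dots> = (\<Sum>\<eta>\<in>agree_off (insert y A) 0. (if y \<in> A then ?m\<^sup>2 else ?m) * F \<eta>)"
  proof (rule sum.cong)
    fix \<eta> :: "'v \<Rightarrow>\<^sub>0 'h" assume \<eta>: "\<eta> \<in> agree_off (insert y A) 0"
    have "card {\<xi> \<in> agree_off A 0. \<xi> \<in> agree_off {x, y} \<eta>} = (if y \<in> A then CARD('h)\<^sup>2 else CARD('h))"
    proof (cases "y \<in> A")
      case True
      then have "{\<xi> \<in> agree_off A 0. \<xi> \<in> agree_off {x, y} \<eta>} = agree_off {x, y} \<eta>"
        using \<eta> A by (auto simp: agree_off_def) metis
      then show ?thesis
        using True A(3) agree_off_card(2)[of "{x, y}" \<eta>] by (simp add: power2_eq_square)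
    next
      case False
      \<comment> \<open>A predecessor must have lamp \<open>y\<close> off, so only lamp
        \<open>x\<close> is free; switching \<open>y\<close> off in \<open>\<eta>\<close> gives a
        base point.\<close>
      have "{\<xi> \<in> agree_off A 0. \<xi> \<in> agree_off {x, y} \<eta>} = agree_off {x} (Poly_Mapping.update y 0 \<eta>)"
        using False \<eta> A by (auto simp: agree_off_def lookup_update)
      then show ?thesis
        using False agree_off_card(2)[of "{x}" "Poly_Mapping.update y 0 \<eta>"] by simp
    qed
    then show "(\<Sum>\<xi> | \<xi> \<in> agree_off A 0 \<and> \<xi> \<in> agree_off {x, y} \<eta>. F \<eta>) = (if y \<in> A then ?m\<^sup>2 else ?m) * F \<eta>"
      by simp
  qed simp
  finally have "(\<Sum>\<xi>\<in>agree_off A 0. (\<Sum>\<eta>\<in>agree_off {x, y} \<xi>. F \<eta>)) =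
      (if y \<in> A then ?m\<^sup>2 else ?m) * (\<Sum>\<eta>\<in>agree_off (insert y A) 0. F \<eta>)"
    by (simp add: sum_distrib_left)
  then have "(1 / ?m) ^ card A * (\<Sum>\<xi>\<in>agree_off A 0. (\<Sum>\<eta>\<in>agree_off {x, y} \<xi>. F \<eta>) / ?m\<^sup>2) =
      (1 / ?m) ^ card A * ((if y \<in> A then ?m\<^sup>2 else ?m) / ?m\<^sup>2) * (\<Sum>\<eta>\<in>agree_off (insert y A) 0. F \<eta>)"
    by (simp add: sum_divide_distrib[symmetric])
  \<comment> \<open>The counting factor falls short of the square by one power exactly when
    \<open>y\<close> is new, which is when the cardinality grows by one.\<close>
  also have "(1 / ?m) ^ card A * ((if y \<in> A then ?m\<^sup>2 else ?m) / ?m\<^sup>2) = (1 / ?m) ^ card (insert y A)"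
    using A m by (simp add: insert_absorb power2_eq_square)
  finally show ?thesis .
qed

text \<open>Both \<open>w y * g y\<close> and \<open>w y * (1 - g y)\<close> have nonnegative tails,
  and these add up to the tail of \<open>w\<close>. The bound does not involve \<open>g\<close>,
  hence is uniform over percolation configurations.\<close>

lemma infsum_weighted_tail:
  fixes w g :: "'s \<Rightarrow> real"
  assumes w: "\<And>y. 0 \<le> w y" "w summable_on UNIV" and g: "\<And>y. 0 \<le> g y" "\<And>y. g y \<le> 1"
    and F: "finite F"
  shows "\<bar>(\<Sum>\<^sub>\<infinity>y. w y * g y) - (\<Sum>y\<in>F. w y * g y)\<bar> \<le> (\<Sum>\<^sub>\<infinity>y. w y) - (\<Sum>y\<in>F. w y)"
proof -
  have s: "(\<lambda>y. w y * g y) summable_on UNIV" "(\<lambda>y. w y * (1 - g y)) summable_on UNIV"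
    by (rule summable_on_comparison_test[OF w(2)];
        use w g in \<open>auto intro!: mult_nonneg_nonneg mult_left_le\<close>)+
  have "(\<Sum>y\<in>F. w y * g y) \<le> (\<Sum>\<^sub>\<infinity>y. w y * g y)"
      "(\<Sum>y\<in>F. w y * (1 - g y)) \<le> (\<Sum>\<^sub>\<infinity>y. w y * (1 - g y))"
    by (rule finite_sum_le_infsum[OF _ F]; use s w g in \<open>auto intro!: mult_nonneg_nonneg\<close>)+
  moreover have "(\<Sum>\<^sub>\<infinity>y. w y * g y + w y * (1 - g y)) = (\<Sum>\<^sub>\<infinity>y. w y * g y) + (\<Sum>\<^sub>\<infinity>y. w y * (1 - g y))"
    by (rule infsum_add[OF s])
  then have "(\<Sum>\<^sub>\<infinity>y. w y) = (\<Sum>\<^sub>\<infinity>y. w y * g y) + (\<Sum>\<^sub>\<infinity>y. w y * (1 - g y))"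
    by (simp add: distrib_left[symmetric])
  moreover have "(\<Sum>y\<in>F. w y) = (\<Sum>y\<in>F. w y * g y) + (\<Sum>y\<in>F. w y * (1 - g y))"
    by (simp add: sum.distrib[symmetric] distrib_left[symmetric])
  ultimately show ?thesis by linarith
qed

text \<open>The index set may be uncountable, so the sum is a limit over the net of finite sets.
  Finite sets chosen by the tail of \<open>w\<close> alone turn it into the limit of a sequence,
  which preserves measurability.\<close>

lemma borel_measurable_infsum_weighted:
  fixes w :: "'s \<Rightarrow> real" and g :: "'s \<Rightarrow> 'w \<Rightarrow> real"
  assumes w: "\<And>y. 0 \<le> w y" "w summable_on UNIV" and g: "\<And>y \<omega>. 0 \<le> g y \<omega>" "\<And>y \<omega>. g y \<omega> \<le> 1"
    and meas: "\<And>y. g y \<in> borel_measurable M"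
  shows "(\<lambda>\<omega>. \<Sum>\<^sub>\<infinity>y. w y * g y \<omega>) \<in> borel_measurable M"
proof -
  have "\<exists>F. finite F \<and> (\<Sum>\<^sub>\<infinity>y. w y) - (\<Sum>y\<in>F. w y) < inverse (real (Suc n))" for n
  proof -
    have "(sum w \<longlongrightarrow> (\<Sum>\<^sub>\<infinity>y. w y)) (finite_subsets_at_top UNIV)"
      using has_sum_infsum[OF w(2)] by (simp add: has_sum_def)
    then have "\<forall>\<^sub>F F in finite_subsets_at_top UNIV. (\<Sum>\<^sub>\<infinity>y. w y) - inverse (real (Suc n)) < sum w F"
      by (rule order_tendstoD) simp
    then obtain F where "finite F" "(\<Sum>\<^sub>\<infinity>y. w y) - inverse (real (Suc n)) < sum w F"
      unfolding eventually_finite_subsets_at_top by blast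
    then show ?thesis by (intro exI[of _ F]) simp
  qed
  then obtain F where F: "\<And>n. finite (F n)"
      "\<And>n. (\<Sum>\<^sub>\<infinity>y. w y) - (\<Sum>y\<in>F n. w y) < inverse (real (Suc n))"
    by metis
  show ?thesis
  proof (rule borel_measurable_LIMSEQ_real)
    show "(\<lambda>\<omega>. \<Sum>y\<in>F n. w y * g y \<omega>) \<in> borel_measurable M" for n
      by (intro borel_measurable_sum borel_measurable_times borel_measurable_const meas)
    fix \<omega>
    have "(\<lambda>n. (\<Sum>y\<in>F n. w y * g y \<omega>) - (\<Sum>\<^sub>\<infinity>y. w y * g y \<omega>)) \<longlonglongrightarrow> 0"
    proof (rule Lim_null_comparison[OF always_eventually LIMSEQ_inverse_real_of_nat], rule allI)
      fix n
      show "norm ((\<Sum>y\<in>F n. w y * g y \<omega>) - (\<Sum>\<^sub>\<infinity>y. w y * g y \<omega>)) \<le> inverse (real (Suc n))"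
        using infsum_weighted_tail[where g="\<lambda>y. g y \<omega>", OF w g F(1)[of n]] F(2)[of n]
        unfolding real_norm_def abs_minus_commute[of "\<Sum>y\<in>F n. w y * g y \<omega>"] by linarith
    qed
    then show "(\<lambda>n. \<Sum>y\<in>F n. w y * g y \<omega>) \<longlonglongrightarrow> (\<Sum>\<^sub>\<infinity>y. w y * g y \<omega>)"
      by (simp add: LIM_zero_iff)
  qed
qed

text \<open>The uniform tail bound allows the expectation to be compared with finite sums directly,
  along the net of finite sets.\<close>

lemma (in prob_space) expectation_infsum_weighted:
  fixes w :: "'s \<Rightarrow> real" and g :: "'s \<Rightarrow> 'a \<Rightarrow> real"
  assumes w: "\<And>y. 0 \<le> w y" "w summable_on UNIV" and g: "\<And>y \<omega>. 0 \<le> g y \<omega>" "\<And>y \<omega>. g y \<omega> \<le> 1"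
    and meas: "\<And>y. g y \<in> borel_measurable M"
  shows "expectation (\<lambda>\<omega>. \<Sum>\<^sub>\<infinity>y. w y * g y \<omega>) = (\<Sum>\<^sub>\<infinity>y. w y * expectation (g y))"
proof (rule infsumI[symmetric])
  let ?G = "\<lambda>\<omega>. \<Sum>\<^sub>\<infinity>y. w y * g y \<omega>"
  have int_g: "integrable M (g y)" for y
    by (rule integrable_const_bound[of _ 1]) (auto simp: g meas)
  have G_meas: "?G \<in> borel_measurable M"
    by (rule borel_measurable_infsum_weighted[OF w g meas])
  have "0 \<le> ?G \<omega>" "?G \<omega> \<le> (\<Sum>\<^sub>\<infinity>y. w y)" for \<omega>
  proof -
    show "0 \<le> ?G \<omega>"
      by (intro infsum_nonneg mult_nonneg_nonneg w g)
    show "?G \<omega> \<le> (\<Sum>\<^sub>\<infinity>y. w y)"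
      using infsum_weighted_tail[where g="\<lambda>y. g y \<omega>", OF w g finite.emptyI] by simp
  qed
  then have int_G: "integrable M ?G"
    by (intro integrable_const_bound[of _ "\<Sum>\<^sub>\<infinity>y. w y"] G_meas) simp
  have "((\<lambda>F. (\<Sum>y\<in>F. w y * expectation (g y)) - expectation ?G) \<longlongrightarrow> 0) (finite_subsets_at_top UNIV)"
  proof (rule Lim_null_comparison)
    show "\<forall>\<^sub>F F in finite_subsets_at_top UNIV.
        norm ((\<Sum>y\<in>F. w y * expectation (g y)) - expectation ?G) \<le> (\<Sum>\<^sub>\<infinity>y. w y) - (\<Sum>y\<in>F. w y)"
    proof (rule eventually_finite_subsets_at_top_weakI)
      fix F :: "'s set" assume F: "finite F"
      have "(\<Sum>y\<in>F. w y * expectation (g y)) - expectation ?G =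
          expectation (\<lambda>\<omega>. (\<Sum>y\<in>F. w y * g y \<omega>) - ?G \<omega>)"
        using int_g int_G by simp
      also have "norm \<dots> \<le> expectation (\<lambda>\<omega>. norm ((\<Sum>y\<in>F. w y * g y \<omega>) - ?G \<omega>))"
        by (rule integral_norm_bound)
      also have "\<dots> \<le> expectation (\<lambda>\<omega>. (\<Sum>\<^sub>\<infinity>y. w y) - (\<Sum>y\<in>F. w y))"
      proof (rule integral_mono)
        show "norm ((\<Sum>y\<in>F. w y * g y \<omega>) - ?G \<omega>) \<le> (\<Sum>\<^sub>\<infinity>y. w y) - (\<Sum>y\<in>F. w y)" for \<omega>
          using infsum_weighted_tail[where g="\<lambda>y. g y \<omega>", OF w g F]
          unfolding real_norm_def abs_minus_commute[of "\<Sum>y\<in>F. w y * g y \<omega>"] .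
      qed (use int_g int_G in auto)
      also have "\<dots> = (\<Sum>\<^sub>\<infinity>y. w y) - (\<Sum>y\<in>F. w y)"
        by (simp add: prob_space)
      finally show "norm ((\<Sum>y\<in>F. w y * expectation (g y)) - expectation ?G) \<le> (\<Sum>\<^sub>\<infinity>y. w y) - (\<Sum>y\<in>F. w y)" .
    qed
    have "(sum w \<longlongrightarrow> (\<Sum>\<^sub>\<infinity>y. w y)) (finite_subsets_at_top UNIV)"
      using has_sum_infsum[OF w(2)] by (simp add: has_sum_def)
    from tendsto_diff[OF tendsto_const this]
    show "((\<lambda>F. (\<Sum>\<^sub>\<infinity>y. w y) - (\<Sum>y\<in>F. w y)) \<longlongrightarrow> 0) (finite_subsets_at_top UNIV)"
      by (metis cancel_comm_monoid_add_class.diff_cancel)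
  qed
  then show "((\<lambda>y. w y * expectation (g y)) has_sum expectation ?G) UNIV"
    unfolding has_sum_def by (simp add: LIM_zero_iff)
qed

section \<open>Kernels of the symmetric walk, the absorbing walk and the lamplighter\<close>

locale symmetric_walk =
  fixes adj :: "'v \<Rightarrow> 'v \<Rightarrow> bool" and p :: "'v \<Rightarrow> 'v \<Rightarrow> real"
  assumes graph: "simple_graph adj" and walk: "nearest_neighbour_walk adj p"
    and p_sym: "p x y = p y x"
begin

lemma p_nonneg: "0 \<le> p x y" and p_has_sum: "(p x has_sum 1) UNIV"
  using walk by (auto simp: nearest_neighbour_walk_def)

lemma p_nonzeroD: "p x y \<noteq> 0 \<Longrightarrow> adj x y" "p x y \<noteq> 0 \<Longrightarrow> x \<noteq> y"
  using walk graph unfolding nearest_neighbour_walk_def simple_graph_def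
  by (metis sympD, metis irreflpD)

lemma p_summable: "p x summable_on UNIV"
  using p_has_sum has_sum_imp_summable by blast

lemma p_infsum: "(\<Sum>\<^sub>\<infinity>y. p x y) = 1"
  using p_has_sum infsumI by blast

lemma symmetric_kernel_absorbing: "symmetric_kernel (absorbing p C)"
proof
  fix x y
  have le: "absorbing p C x y \<le> p x y" "0 \<le> absorbing p C x y" for x y
    by (auto simp: absorbing_def p_nonneg)
  show "0 \<le> absorbing p C x y" by (rule le)
  show s: "absorbing p C x summable_on UNIV"
    by (rule summable_on_comparison_test[OF p_summable[of x]]) (use le in auto)
  have "(\<Sum>\<^sub>\<infinity>y. absorbing p C x y) \<le> (\<Sum>\<^sub>\<infinity>y. p x y)"
    by (intro infsum_mono s p_summable le)
  then show "(\<Sum>\<^sub>\<infinity>y. absorbing p C x y) \<le> 1"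
    by (simp add: p_infsum)
  show "absorbing p C x y = absorbing p C y x"
    by (auto simp: absorbing_def p_sym)
qed

text \<open>The adjacency test disappears because \<open>p x y\<close> vanishes off the
  edges.\<close>

lemma lamplighter_eq:
  fixes \<xi> \<eta> :: "'v \<Rightarrow>\<^sub>0 'h::{finite,zero}"
  shows "lamplighter adj p (\<xi>, x) (\<eta>, y) =
    (if \<eta> \<in> agree_off {x, y} \<xi> then p x y / (real CARD('h))\<^sup>2 else 0)"
proof (cases "adj y x")
  case True
  then show ?thesis by (auto simp: lamplighter_def agree_off_def)
next
  case False
  then have "p x y = 0"
    using p_nonzeroD[of y x] p_sym by metis
  then show ?thesis by (auto simp: lamplighter_def)
qed

text \<open>For a fixed target vertex only finitely many configurations contribute, so the sum over
  pairs becomes a sum over vertices of finite lamp averages.\<close>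

lemma lamplighter_has_sum:
  fixes F :: "('v \<Rightarrow>\<^sub>0 'h::{finite,zero}) \<times> 'v \<Rightarrow> real"
  assumes F: "\<And>s. 0 \<le> F s" "\<And>s. F s \<le> 1"
  shows "((\<lambda>s. lamplighter adj p (\<xi>, x) s * F s) has_sum
      (\<Sum>\<^sub>\<infinity>y. p x y * ((\<Sum>\<eta>\<in>agree_off {x, y} \<xi>. F (\<eta>, y)) / (real CARD('h))\<^sup>2))) UNIV"
    "(\<Sum>\<^sub>\<infinity>y. p x y * ((\<Sum>\<eta>\<in>agree_off {x, y} \<xi>. F (\<eta>, y)) / (real CARD('h))\<^sup>2)) \<le> 1"
    "(\<lambda>y. p x y * ((\<Sum>\<eta>\<in>agree_off {x, y} \<xi>. F (\<eta>, y)) / (real CARD('h))\<^sup>2)) summable_on UNIV"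
proof -
  let ?m = "real CARD('h)"
  define G where "G y = (\<Sum>\<eta>\<in>agree_off {x, y} \<xi>. F (\<eta>, y)) / ?m\<^sup>2" for y
  have G: "0 \<le> G y" "G y \<le> 1" for y
  proof -
    show "0 \<le> G y" by (simp add: G_def sum_nonneg F)
    \<comment> \<open>The case \<open>y = x\<close> is not excluded here, hence an
      inequality.\<close>
    have "card {x, y} \<le> 2"
      by (simp add: card_insert_if)
    then have "card (agree_off {x, y} \<xi>) \<le> CARD('h)\<^sup>2"
      by (simp add: agree_off_card(2) power_increasing Suc_leI)
    then have "real (card (agree_off {x, y} \<xi>)) \<le> ?m\<^sup>2"
      by (metis of_nat_le_iff of_nat_power)
    moreover have "(\<Sum>\<eta>\<in>agree_off {x, y} \<xi>. F (\<eta>, y)) \<le> real (card (agree_off {x, y} \<xi>))"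
      using sum_bounded_above[of "agree_off {x, y} \<xi>" "\<lambda>\<eta>. F (\<eta>, y)" 1] F by simp
    ultimately have "(\<Sum>\<eta>\<in>agree_off {x, y} \<xi>. F (\<eta>, y)) \<le> ?m\<^sup>2"
      by linarith
    then show "G y \<le> 1"
      by (simp add: G_def divide_le_eq)
  qed
  have s: "(\<lambda>y. p x y * G y) summable_on UNIV"
    by (rule summable_on_comparison_test[OF p_summable[of x]])
      (auto intro: mult_left_le mult_nonneg_nonneg p_nonneg G)
  then show "(\<lambda>y. p x y * ((\<Sum>\<eta>\<in>agree_off {x, y} \<xi>. F (\<eta>, y)) / ?m\<^sup>2)) summable_on UNIV"
    by (simp add: G_def)
  let ?f = "\<lambda>(y, \<eta>). lamplighter adj p (\<xi>, x) (\<eta>, y) * F (\<eta>, y)"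
  have inner: "((\<lambda>\<eta>. ?f (y, \<eta>)) has_sum p x y * G y) UNIV" for y
    by (rule has_sum_finite_neutralI[of "agree_off {x, y} \<xi>"])
      (auto simp: lamplighter_eq agree_off_card G_def sum_divide_distrib sum_distrib_left)
  have "?f summable_on UNIV \<times> UNIV"
    by (rule summable_on_SigmaI[OF inner s])
      (auto simp: lamplighter_eq intro!: mult_nonneg_nonneg divide_nonneg_nonneg p_nonneg F)
  then have "(?f has_sum (\<Sum>\<^sub>\<infinity>y. p x y * G y)) (UNIV \<times> UNIV)"
    by (rule has_sum_SigmaI[OF inner has_sum_infsum[OF s]])
  then show "((\<lambda>s. lamplighter adj p (\<xi>, x) s * F s) has_sum
      (\<Sum>\<^sub>\<infinity>y. p x y * ((\<Sum>\<eta>\<in>agree_off {x, y} \<xi>. F (\<eta>, y)) / ?m\<^sup>2))) UNIV"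
    unfolding G_def
    by (subst has_sum_reindex_bij_witness[where j="\<lambda>(\<eta>, y). (y, \<eta>)" and i="\<lambda>(y, \<eta>). (\<eta>, y)"
          and T="UNIV \<times> UNIV" and h="?f"]) auto
  have "(\<Sum>\<^sub>\<infinity>y. p x y * G y) \<le> (\<Sum>\<^sub>\<infinity>y. p x y)"
    by (intro infsum_mono s p_summable) (auto intro: mult_left_le p_nonneg G)
  then show "(\<Sum>\<^sub>\<infinity>y. p x y * ((\<Sum>\<eta>\<in>agree_off {x, y} \<xi>. F (\<eta>, y)) / ?m\<^sup>2)) \<le> 1"
    by (simp add: p_infsum G_def)
qed

lemma symmetric_kernel_lamplighter:
  "symmetric_kernel (lamplighter adj p :: ('v \<Rightarrow>\<^sub>0 'h::{finite,zero}) \<times> 'v \<Rightarrow> _)"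
proof
  fix s t :: "('v \<Rightarrow>\<^sub>0 'h) \<times> 'v"
  obtain \<xi> x \<eta> y where st: "s = (\<xi>, x)" "t = (\<eta>, y)" by (cases s, cases t)
  show "0 \<le> lamplighter adj p s t"
    by (simp add: st lamplighter_eq p_nonneg)
  show "lamplighter adj p s t = lamplighter adj p t s"
    by (simp add: st lamplighter_eq agree_off_sym[of \<eta>] p_sym[of x y] insert_commute)
  have hs: "(lamplighter adj p s has_sum
      (\<Sum>\<^sub>\<infinity>y. p x y * ((\<Sum>\<eta>\<in>agree_off {x, y} \<xi>. 1) / (real CARD('h))\<^sup>2))) UNIV"
    using lamplighter_has_sum(1)[of "\<lambda>_. 1" \<xi> x] by (simp add: st)
  then show "lamplighter adj p s summable_on UNIV"
    by (rule has_sum_imp_summable)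
  show "(\<Sum>\<^sub>\<infinity>t. lamplighter adj p s t) \<le> 1"
    unfolding infsumI[OF hs] by (rule lamplighter_has_sum(2)) simp_all
qed

text \<open>A walk that starts at \<open>x\<close> and stays open never leaves the cluster of \<open>x\<close>.\<close>

lemma n_step_cluster:
  "n_step (absorbing p (cluster adj x \<omega>)) n x z = n_step (absorbing p {v. \<omega> v}) n x z"
proof (cases "\<omega> x")
  case True
  let ?C = "cluster adj x \<omega>"
  have x: "x \<in> ?C" using True by (simp add: cluster_def)
  have C_open: "\<omega> y" if "y \<in> ?C" for y
  proof -
    have "(\<lambda>u v. adj u v \<and> \<omega> u \<and> \<omega> v)\<^sup>*\<^sup>* x y"
      using that by (simp add: cluster_def)
    then show ?thesis
      by (cases rule: rtranclp.cases) (use True in auto)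
  qed
  have C_step: "v \<in> ?C" if "y \<in> ?C" "\<omega> v" "adj y v" for y v
    using that C_open[OF that(1)] unfolding cluster_def
    by (auto intro: rtranclp.rtrancl_into_rtrancl)
  have "n_step (absorbing p ?C) n y z = n_step (absorbing p {v. \<omega> v}) n y z" if "y \<in> ?C" for y
    using that
  proof (induction n arbitrary: y)
    case (Suc n)
    have "absorbing p ?C y v * n_step (absorbing p ?C) n v z =
        absorbing p {v. \<omega> v} y v * n_step (absorbing p {v. \<omega> v}) n v z" for v
    proof (cases "v \<in> ?C")
      case True
      then have "absorbing p ?C y v = absorbing p {v. \<omega> v} y v"
        using Suc.prems C_open by (simp add: absorbing_def)
      with Suc.IH[OF True] show ?thesis by simp
    next
      case False
      then have "\<not> \<omega> v \<or> p y v = 0"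
        using C_step[OF Suc.prems, of v] p_nonzeroD(1)[of y v] by blast
      with False show ?thesis by (auto simp: absorbing_def)
    qed
    then show ?case by simp
  qed simp
  then show ?thesis using x by blast
next
  case False
  \<comment> \<open>From a closed vertex both walks are killed at once: for \<open>n = 0\<close>
    both matrices are the identity, and for positive \<open>n\<close> no transition leaves
    \<open>x\<close>.\<close>
  then have "cluster adj x \<omega> = {}" by (simp add: cluster_def)
  then show ?thesis
    using False by (cases n) (simp_all add: absorbing_def)
qed

end

section \<open>Expected return probabilities\<close>

text \<open>Measurability is passed on by pointwise limits: from moments to polynomials, to
  continuous functions, to half-lines through continuous steps. Half-lines are an
  intersection-stable generator of the Borel sets.\<close>

lemma measurable_prob_algebra_moments:
  fixes \<kappa> :: "'w \<Rightarrow> real measure"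
  assumes prob: "\<And>\<omega>. \<omega> \<in> space N \<Longrightarrow> prob_space (\<kappa> \<omega>)"
    and supp: "\<And>\<omega>. \<omega> \<in> space N \<Longrightarrow> supported_measure a (\<kappa> \<omega>)"
    and moments: "\<And>n. (\<lambda>\<omega>. \<integral>t. t ^ n \<partial>\<kappa> \<omega>) \<in> borel_measurable N"
  shows "\<kappa> \<in> measurable N (prob_algebra borel)"
proof (rule measurable_prob_algebra_generated[where \<Omega>=UNIV and G="range (\<lambda>c::real. {..c})"])
  show "sets borel = sigma_sets UNIV (range (\<lambda>c::real. {..c}))"
    by (simp add: borel_eq_atMost)
  show "Int_stable (range (\<lambda>c::real. {..c}))"
    by (auto simp: Int_stable_def)
  show "sets (\<kappa> \<omega>) = sets borel" if "\<omega> \<in> space N" for \<omega>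
    by (rule supported_measureD(2)[OF supp[OF that]])
  have poly: "(\<lambda>\<omega>. \<integral>t. poly q t \<partial>\<kappa> \<omega>) \<in> borel_measurable N" for q
  proof -
    have "(\<lambda>\<omega>. \<Sum>i\<le>degree q. coeff q i * (\<integral>t. t ^ i \<partial>\<kappa> \<omega>)) \<in> borel_measurable N"
      by (intro borel_measurable_sum borel_measurable_times borel_measurable_const moments)
    then show ?thesis
      by (rule measurable_cong[THEN iffD1, rotated]) (simp add: integral_poly_moments[OF supp])
  qed
  have continuous: "(\<lambda>\<omega>. \<integral>t. h t \<partial>\<kappa> \<omega>) \<in> borel_measurable N" if h: "continuous_on UNIV h" for h :: "real \<Rightarrow> real"
  proof -
    obtain q where q: "\<And>M. supported_measure a M \<Longrightarrow> (\<lambda>k. \<integral>t. (poly (q k) t - h t)\<^sup>2 \<partial>M) \<longlonglongrightarrow> 0"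
      using continuous_poly_seq[OF h] by blast
    show ?thesis
    proof (rule borel_measurable_LIMSEQ_real)
      show "(\<lambda>\<omega>. \<integral>t. poly (q k) t \<partial>\<kappa> \<omega>) \<in> borel_measurable N" for k
        by (rule poly)
      fix \<omega> assume "\<omega> \<in> space N"
      note M = supp[OF this]
      have "(\<lambda>k. \<integral>t. 1 * poly (q k) t \<partial>\<kappa> \<omega>) \<longlonglongrightarrow> (\<integral>t. 1 * h t \<partial>\<kappa> \<omega>)"
        by (rule tendsto_integral_mult_L2[OF M _ _ _ q[OF M]])
          (intro bounded_borel_on_poly bounded_borel_on_const bounded_borel_on_continuous h)+
      then show "(\<lambda>k. \<integral>t. poly (q k) t \<partial>\<kappa> \<omega>) \<longlonglongrightarrow> (\<integral>t. h t \<partial>\<kappa> \<omega>)" by simp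
    qed
  qed
  fix A :: "real set" assume "A \<in> range (\<lambda>c. {..c})"
  then obtain c where A: "A = {..c}" by auto
  have "(\<lambda>\<omega>. measure (\<kappa> \<omega>) A) \<in> borel_measurable N"
  proof (rule borel_measurable_LIMSEQ_real)
    let ?h = "\<lambda>k. cts_step c (c + inverse (real (Suc k)))"
    show "(\<lambda>\<omega>. \<integral>t. ?h k t \<partial>\<kappa> \<omega>) \<in> borel_measurable N" for k
      by (intro continuous continuous_on_cts_step) simp
    fix \<omega> assume \<omega>: "\<omega> \<in> space N"
    note M = supp[OF this]
    interpret prob_space "\<kappa> \<omega>" by (rule prob[OF \<omega>])
    have meas: "h \<in> borel_measurable (\<kappa> \<omega>)" if "h \<in> borel_measurable borel" for h :: "real \<Rightarrow> real"
      using that by (subst measurable_cong_sets[OF supported_measureD(2)[OF M] refl])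
    have "(\<lambda>k. \<integral>t. ?h k t \<partial>\<kappa> \<omega>) \<longlonglongrightarrow> (\<integral>t. indicator {..c} t \<partial>\<kappa> \<omega>)"
    proof (rule integral_dominated_convergence[where w="\<lambda>_. 1"])
      show "AE t in \<kappa> \<omega>. (\<lambda>k. ?h k t) \<longlonglongrightarrow> indicator {..c} t"
        by (intro AE_I2 tendsto_cts_step)
      show "AE t in \<kappa> \<omega>. norm (?h k t) \<le> 1" for k
        unfolding real_norm_def by (intro AE_I2 cts_step_bounded) simp
      show "?h k \<in> borel_measurable (\<kappa> \<omega>)" for k
        by (intro meas borel_measurable_continuous_onI continuous_on_cts_step) simp
    qed (auto intro: meas)
    then show "(\<lambda>k. \<integral>t. ?h k t \<partial>\<kappa> \<omega>) \<longlonglongrightarrow> measure (\<kappa> \<omega>) A"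
      using supported_measureD(2,4)[OF M] by (simp add: A)
  qed
  then have "(\<lambda>\<omega>. ennreal (measure (\<kappa> \<omega>) A)) \<in> borel_measurable N"
    by measurable
  then show "(\<lambda>\<omega>. emeasure (\<kappa> \<omega>) A) \<in> borel_measurable N"
  proof (rule measurable_cong[THEN iffD1, rotated])
    fix \<omega> assume \<omega>: "\<omega> \<in> space N"
    interpret prob_space "\<kappa> \<omega>" by (rule prob[OF \<omega>])
    show "ennreal (measure (\<kappa> \<omega>) A) = emeasure (\<kappa> \<omega>) A"
      by (simp add: emeasure_eq_measure)
  qed
qed (use prob in auto)

text \<open>The iterated integral is taken for nonnegative functions: a bound \<open>C\<close> on
  \<open>{-a..a}\<close> shifts the polynomial to one that is nonnegative there, and since all
  measures have mass 1 the shift is \<open>C\<close> on both sides and cancels.\<close>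

lemma (in prob_space) bind_supported:
  fixes \<kappa> :: "'a \<Rightarrow> real measure"
  assumes \<kappa>: "\<kappa> \<in> measurable M (prob_algebra borel)"
    and supp: "\<And>\<omega>. \<omega> \<in> space M \<Longrightarrow> supported_measure a (\<kappa> \<omega>)"
  shows "supported_measure a (M \<bind> \<kappa>)"
    "(\<lambda>\<omega>. \<integral>t. poly q t \<partial>\<kappa> \<omega>) \<in> borel_measurable M \<Longrightarrow>
      (\<integral>t. poly q t \<partial>(M \<bind> \<kappa>)) = expectation (\<lambda>\<omega>. \<integral>t. poly q t \<partial>\<kappa> \<omega>)"
proof -
  have \<kappa>': "\<kappa> \<in> measurable M (subprob_algebra borel)"
    by (rule measurable_prob_algebraD[OF \<kappa>])
  have prob: "prob_space (\<kappa> \<omega>)" if "\<omega> \<in> space M" for \<omega>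
    using measurable_space[OF \<kappa> that] by (simp add: space_prob_algebra)
  interpret B: prob_space "M \<bind> \<kappa>"
    by (rule prob_space_bind[OF _ \<kappa>']) (use prob in auto)
  show S: "supported_measure a (M \<bind> \<kappa>)"
    unfolding supported_measure_def
  proof (intro conjI B.finite_measure_axioms)
    show "sets (M \<bind> \<kappa>) = sets borel"
      by (rule sets_bind[OF supported_measureD(2)[OF supp] not_empty])
    show "AE t in M \<bind> \<kappa>. \<bar>t\<bar> \<le> a"
      by (subst AE_bind[OF \<kappa>']) (use supp in \<open>auto intro: supported_measureD\<close>)
  qed
  assume meas: "(\<lambda>\<omega>. \<integral>t. poly q t \<partial>\<kappa> \<omega>) \<in> borel_measurable M"
  obtain C where C: "\<And>t. \<bar>t\<bar> \<le> a \<Longrightarrow> \<bar>poly q t\<bar> \<le> C"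
    using bounded_borel_on_poly[of a q] unfolding bounded_borel_on_def by blast
  have shift: "(\<integral>\<^sup>+t. ennreal (poly q t + C) \<partial>K) = ennreal ((\<integral>t. poly q t \<partial>K) + C)"
      "\<bar>\<integral>t. poly q t \<partial>K\<bar> \<le> C"
    if K: "prob_space K" "supported_measure a K" for K
  proof -
    interpret K: prob_space K by fact
    have int: "integrable K (poly q)"
      by (rule bounded_borel_on_integrable[OF K(2) bounded_borel_on_poly])
    have AE: "AE t in K. \<bar>poly q t\<bar> \<le> C"
      using supported_measureD(3)[OF K(2)] by eventually_elim (rule C)
    then have "AE t in K. 0 \<le> poly q t + C"
      by eventually_elim linarith
    then have "(\<integral>\<^sup>+t. ennreal (poly q t + C) \<partial>K) = ennreal (\<integral>t. poly q t + C \<partial>K)"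
      using int by (intro nn_integral_eq_integral) auto
    then show "(\<integral>\<^sup>+t. ennreal (poly q t + C) \<partial>K) = ennreal ((\<integral>t. poly q t \<partial>K) + C)"
      using int by (simp add: K.prob_space)
    have "\<bar>\<integral>t. poly q t \<partial>K\<bar> \<le> (\<integral>t. \<bar>poly q t\<bar> \<partial>K)"
      using integral_norm_bound[of K "poly q"] by simp
    also have "\<dots> \<le> (\<integral>t. C \<partial>K)"
      using int AE by (intro integral_mono_AE) auto
    finally show "\<bar>\<integral>t. poly q t \<partial>K\<bar> \<le> C"
      by (simp add: K.prob_space)
  qed
  have int: "integrable M (\<lambda>\<omega>. \<integral>t. poly q t \<partial>\<kappa> \<omega>)"
    by (rule integrable_const_bound[of _ C]) (use shift(2)[OF prob supp] meas in auto)
  have bound: "\<bar>expectation (\<lambda>\<omega>. \<integral>t. poly q t \<partial>\<kappa> \<omega>)\<bar> \<le> C"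
  proof -
    have "\<bar>expectation (\<lambda>\<omega>. \<integral>t. poly q t \<partial>\<kappa> \<omega>)\<bar> \<le> expectation (\<lambda>\<omega>. \<bar>\<integral>t. poly q t \<partial>\<kappa> \<omega>\<bar>)"
      using integral_norm_bound[of M "\<lambda>\<omega>. \<integral>t. poly q t \<partial>\<kappa> \<omega>"] by simp
    also have "\<dots> \<le> expectation (\<lambda>_. C)"
      using int by (intro integral_mono shift(2) prob supp) auto
    finally show ?thesis by (simp add: prob_space)
  qed
  have "ennreal ((\<integral>t. poly q t \<partial>(M \<bind> \<kappa>)) + C) = (\<integral>\<^sup>+t. ennreal (poly q t + C) \<partial>(M \<bind> \<kappa>))"
    by (rule shift(1)[OF B.prob_space_axioms S, symmetric])
  also have "\<dots> = (\<integral>\<^sup>+\<omega>. \<integral>\<^sup>+t. ennreal (poly q t + C) \<partial>\<kappa> \<omega> \<partial>M)"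
    by (rule nn_integral_bind[OF _ \<kappa>'])
      (intro measurable_compose[OF _ measurable_ennreal] borel_measurable_continuous_onI continuous_intros)
  also have "\<dots> = (\<integral>\<^sup>+\<omega>. ennreal ((\<integral>t. poly q t \<partial>\<kappa> \<omega>) + C) \<partial>M)"
    by (intro nn_integral_cong shift(1) prob supp)
  also have "\<dots> = ennreal (expectation (\<lambda>\<omega>. (\<integral>t. poly q t \<partial>\<kappa> \<omega>) + C))"
  proof (rule nn_integral_eq_integral)
    show "AE \<omega> in M. 0 \<le> (\<integral>t. poly q t \<partial>\<kappa> \<omega>) + C"
      using shift(2)[OF prob supp] by (intro AE_I2) (fastforce simp: abs_le_iff)
  qed (use int in auto)
  also have "\<dots> = ennreal (expectation (\<lambda>\<omega>. \<integral>t. poly q t \<partial>\<kappa> \<omega>) + C)"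
    using int by (simp add: prob_space)
  \<comment> \<open>By the bounds both arguments of \<open>ennreal\<close> are nonnegative, so that
    it is injective on them.\<close>
  finally show "(\<integral>t. poly q t \<partial>(M \<bind> \<kappa>)) = expectation (\<lambda>\<omega>. \<integral>t. poly q t \<partial>\<kappa> \<omega>)"
    using shift(2)[OF B.prob_space_axioms S] bound by (simp add: abs_le_iff)
qed

section \<open>Bernoulli site percolation\<close>

lemma measurable_site_percolation [measurable]:
  "Measurable.pred (site_percolation q) (\<lambda>\<omega>. \<omega> v)"
proof -
  have "(\<lambda>\<omega>. \<omega> v) \<in> measurable (site_percolation q) (measure_pmf (bernoulli_pmf q))"
    unfolding site_percolation_def by (rule measurable_component_singleton) simp
  then show ?thesis
    by (subst measurable_cong_sets[OF refl, of _ "measure_pmf (bernoulli_pmf q)"]) auto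
qed

lemma space_site_percolation [simp]: "space (site_percolation q) = UNIV"
  by (simp add: site_percolation_def space_PiM)

lemma prob_space_site_percolation: "prob_space (site_percolation q)"
  unfolding site_percolation_def by (intro prob_space_PiM measure_pmf.prob_space_axioms)

lemma site_percolation_open:
  assumes "finite A" "0 \<le> q" "q \<le> 1"
  shows "measure (site_percolation q) {\<omega>. \<forall>v\<in>A. \<omega> v} = q ^ card A"
proof -
  interpret P: product_prob_space "\<lambda>_::'a. measure_pmf (bernoulli_pmf q)" UNIV
    by (intro product_prob_spaceI measure_pmf.prob_space_axioms)
  have "emeasure (site_percolation q) {\<omega>. \<forall>v\<in>A. \<omega> v} = (\<Prod>v\<in>A. emeasure (measure_pmf (bernoulli_pmf q)) {True})"
    using P.emeasure_PiM_Collect[of A "\<lambda>_. {True}"] assms(1)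
    by (simp add: site_percolation_def space_PiM)
  also have "\<dots> = ennreal (q ^ card A)"
    using assms by (simp add: emeasure_pmf_single ennreal_power)
  finally show ?thesis
    using assms by (simp add: measure_def)
qed

section \<open>Matching recursions for percolation and the lamplighter\<close>

context symmetric_walk
begin

lemma n_step_open_bounds:
  "0 \<le> n_step (absorbing p C) n y z" "n_step (absorbing p C) n y z \<le> 1"
proof -
  interpret symmetric_kernel "absorbing p C" by (rule symmetric_kernel_absorbing)
  show "0 \<le> n_step (absorbing p C) n y z" "n_step (absorbing p C) n y z \<le> 1"
    by (rule n_step_bounds)+
qed

text \<open>Separates the deterministic weights \<open>p x y\<close> from a random factor in
  \<open>{0..1}\<close>, the form required for measurability and for exchanging sum and
  expectation.\<close>

lemma n_step_open_Suc:
  "n_step (absorbing p {v. \<omega> v}) (Suc n) x z =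
    (\<Sum>\<^sub>\<infinity>y. p x y * (of_bool (\<omega> x \<and> \<omega> y) * n_step (absorbing p {v. \<omega> v}) n y z))"
  unfolding n_step.simps by (rule infsum_cong) (auto simp: absorbing_def)

lemma measurable_n_step_open [measurable]:
  "(\<lambda>\<omega>. n_step (absorbing p {v. \<omega> v}) n y z) \<in> borel_measurable (site_percolation q)"
proof (induction n arbitrary: y)
  case 0
  show ?case by simp
next
  case (Suc n)
  note Suc [measurable]
  show ?case
    unfolding n_step_open_Suc
    by (rule borel_measurable_infsum_weighted[OF p_nonneg p_summable])
      (auto simp: n_step_open_bounds)
qed

text \<open>A step survives only if both of its end points are open, so they join the set of
  vertices required to be open.\<close>

lemma expectation_n_step_open_Suc:
  assumes "finite A"
  shows "(\<integral>\<omega>. of_bool (\<forall>v\<in>A. \<omega> v) * n_step (absorbing p {v. \<omega> v}) (Suc n) x z \<partial>site_percolation q) =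
    (\<Sum>\<^sub>\<infinity>y. p x y * (\<integral>\<omega>. of_bool (\<forall>v\<in>insert x (insert y A). \<omega> v) *
      n_step (absorbing p {v. \<omega> v}) n y z \<partial>site_percolation q))"
proof -
  interpret P: prob_space "site_percolation q :: ('v \<Rightarrow> bool) measure"
    by (rule prob_space_site_percolation)
  let ?g = "\<lambda>y \<omega>. of_bool (\<forall>v\<in>insert x (insert y A). \<omega> v) * n_step (absorbing p {v. \<omega> v}) n y z :: real"
  have "of_bool (\<forall>v\<in>A. \<omega> v) * n_step (absorbing p {v. \<omega> v}) (Suc n) x z = (\<Sum>\<^sub>\<infinity>y. p x y * ?g y \<omega>)" for \<omega>
    unfolding n_step_open_Suc infsum_cmult_right'[symmetric]
    by (rule infsum_cong) auto
  then have "(\<integral>\<omega>. of_bool (\<forall>v\<in>A. \<omega> v) * n_step (absorbing p {v. \<omega> v}) (Suc n) x z \<partial>site_percolation q) =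
      (\<integral>\<omega>. (\<Sum>\<^sub>\<infinity>y. p x y * ?g y \<omega>) \<partial>site_percolation q)"
    by simp
  also have "\<dots> = (\<Sum>\<^sub>\<infinity>y. p x y * (\<integral>\<omega>. ?g y \<omega> \<partial>site_percolation q))"
  proof (rule P.expectation_infsum_weighted[OF p_nonneg p_summable])
    have "Measurable.pred (site_percolation q) (\<lambda>\<omega>. \<forall>v\<in>insert x (insert y A). \<omega> v)" for y
      using assms by (intro pred_intros_finite measurable_site_percolation) simp
    then show "?g y \<in> borel_measurable (site_percolation q)" for y
      by measurable
  qed (auto simp: n_step_open_bounds)
  finally show ?thesis .
qed

lemma n_step_lamplighter_Suc:
  fixes s :: "('v \<Rightarrow>\<^sub>0 'h::{finite,zero}) \<times> 'v"
  shows "n_step (lamplighter adj p) (Suc n) (\<xi>, x) s =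
    (\<Sum>\<^sub>\<infinity>y. p x y * ((\<Sum>\<eta>\<in>agree_off {x, y} \<xi>. n_step (lamplighter adj p) n (\<eta>, y) s) / (real CARD('h))\<^sup>2))" (is ?step)
    "(\<lambda>y. p x y * ((\<Sum>\<eta>\<in>agree_off {x, y} \<xi>. n_step (lamplighter adj p) n (\<eta>, y) s) / (real CARD('h))\<^sup>2))
      summable_on UNIV" (is ?summable)
proof -
  interpret symmetric_kernel "lamplighter adj p :: ('v \<Rightarrow>\<^sub>0 'h) \<times> 'v \<Rightarrow> _"
    by (rule symmetric_kernel_lamplighter)
  show ?step
    unfolding n_step.simps
    by (rule infsumI, rule lamplighter_has_sum(1)) (rule n_step_bounds)+
  show ?summable
    by (rule lamplighter_has_sum(3)) (rule n_step_bounds)+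
qed

text \<open>Lamps on \<open>A\<close> that start uniformly distributed are all off at time \<open>n\<close> with the same probability
  with which the vertices of \<open>A\<close> and of the path are all open.\<close>

lemma lamplighter_average:
  fixes A :: "'v set"
  defines "m \<equiv> real CARD('h::{finite,zero})"
  assumes "finite A" "x \<in> A"
  shows "(1 / m) ^ card A * (\<Sum>\<xi>\<in>agree_off A 0. n_step (lamplighter adj p) n (\<xi> :: 'v \<Rightarrow>\<^sub>0 'h, x) (0, z)) =
    (\<integral>\<omega>. of_bool (\<forall>v\<in>A. \<omega> v) * n_step (absorbing p {v. \<omega> v}) n x z \<partial>site_percolation (1 / m))"
  using assms(2,3)
proof (induction n arbitrary: A x)
  case 0
  have m: "0 \<le> 1 / m" "1 / m \<le> 1"
    by (simp_all add: m_def Suc_leI)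
  \<comment> \<open>At time 0 only the all-off configuration contributes. Its uniform weight is the
    probability that \<open>A\<close> is open.\<close>
  have "0 \<in> agree_off A (0 :: 'v \<Rightarrow>\<^sub>0 'h)"
    by (simp add: agree_off_def)
  then have "(\<Sum>\<xi>\<in>agree_off A 0. n_step (lamplighter adj p) 0 (\<xi> :: 'v \<Rightarrow>\<^sub>0 'h, x) (0, z)) = of_bool (x = z)"
    using agree_off_card(1)[OF 0(1), of "0 :: 'v \<Rightarrow>\<^sub>0 'h"] by simp
  moreover have "(\<integral>\<omega>. of_bool (\<forall>v\<in>A. \<omega> v) \<partial>site_percolation (1 / m)) = (1 / m) ^ card A"
  proof -
    have "(\<lambda>\<omega>. of_bool (\<forall>v\<in>A. \<omega> v)) = (indicator {\<omega>. \<forall>v\<in>A. \<omega> v} :: _ \<Rightarrow> real)"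
      by (auto simp: indicator_def)
    then show ?thesis
      using site_percolation_open[OF 0(1) m] by simp
  qed
  ultimately show ?case by simp
next
  case (Suc n)
  let ?N = "n_step (lamplighter adj p :: ('v \<Rightarrow>\<^sub>0 'h) \<times> 'v \<Rightarrow> _)"
  define S where "S y \<xi> = (\<Sum>\<eta>\<in>agree_off {x, y} \<xi>. ?N n (\<eta>, y) (0, z)) / m\<^sup>2" for y \<xi>
  have summable: "(\<lambda>y. p x y * S y \<xi>) summable_on UNIV" for \<xi>
    unfolding S_def m_def by (rule n_step_lamplighter_Suc(2))
  have "(\<Sum>\<xi>\<in>agree_off A 0. ?N (Suc n) (\<xi>, x) (0, z)) = (\<Sum>\<xi>\<in>agree_off A 0. \<Sum>\<^sub>\<infinity>y. p x y * S y \<xi>)"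
    by (simp only: n_step_lamplighter_Suc(1) S_def m_def)
  also have "\<dots> = (\<Sum>\<^sub>\<infinity>y. \<Sum>\<xi>\<in>agree_off A 0. p x y * S y \<xi>)"
    using agree_off_card(1)[OF Suc.prems(1), of "0 :: 'v \<Rightarrow>\<^sub>0 'h"]
    by (intro conjunct1[OF sum_infsum_swap] summable)
  finally have "(1 / m) ^ card A * (\<Sum>\<xi>\<in>agree_off A 0. ?N (Suc n) (\<xi>, x) (0, z)) =
      (\<Sum>\<^sub>\<infinity>y. (1 / m) ^ card A * (\<Sum>\<xi>\<in>agree_off A 0. p x y * S y \<xi>))"
    by (simp only: infsum_cmult_right')
  also have "\<dots> = (\<Sum>\<^sub>\<infinity>y. p x y * (\<integral>\<omega>. of_bool (\<forall>v\<in>insert x (insert y A). \<omega> v) *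
      n_step (absorbing p {v. \<omega> v}) n y z \<partial>site_percolation (1 / m)))"
  proof (rule infsum_cong)
    fix y
    show "(1 / m) ^ card A * (\<Sum>\<xi>\<in>agree_off A 0. p x y * S y \<xi>) =
        p x y * (\<integral>\<omega>. of_bool (\<forall>v\<in>insert x (insert y A). \<omega> v) *
          n_step (absorbing p {v. \<omega> v}) n y z \<partial>site_percolation (1 / m))"
    proof (cases "p x y = 0")
      case False
      \<comment> \<open>Rerandomizing \<open>x\<close> and \<open>y\<close> involves two lamps only
        if they are distinct; loops carry weight 0.\<close>
      then have "x \<noteq> y" by (rule p_nonzeroD)
      have "(1 / m) ^ card A * (\<Sum>\<xi>\<in>agree_off A 0. p x y * S y \<xi>) =
          p x y * ((1 / m) ^ card A * (\<Sum>\<xi>\<in>agree_off A 0. S y \<xi>))"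
        by (simp add: sum_distrib_left[symmetric])
      also have "(1 / m) ^ card A * (\<Sum>\<xi>\<in>agree_off A 0. S y \<xi>) =
          (1 / m) ^ card (insert y A) * (\<Sum>\<eta>\<in>agree_off (insert y A) 0. ?N n (\<eta>, y) (0, z))"
        unfolding S_def m_def by (rule sum_agree_off_step[OF Suc.prems \<open>x \<noteq> y\<close>])
      also have "\<dots> = (\<integral>\<omega>. of_bool (\<forall>v\<in>insert y A. \<omega> v) *
          n_step (absorbing p {v. \<omega> v}) n y z \<partial>site_percolation (1 / m))"
        by (rule Suc.IH) (use Suc.prems in auto)
      \<comment> \<open>Since \<open>x \<in> A\<close>, the vertex \<open>x\<close> is already
        required to be open.\<close>
      also have "insert y A = insert x (insert y A)"
        using Suc.prems by auto
      finally show ?thesis .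
    qed simp
  qed
  also have "\<dots> = (\<integral>\<omega>. of_bool (\<forall>v\<in>A. \<omega> v) * n_step (absorbing p {v. \<omega> v}) (Suc n) x z \<partial>site_percolation (1 / m))"
    by (rule expectation_n_step_open_Suc[OF Suc.prems(1), symmetric])
  finally show ?case .
qed

text \<open>At the start the lamps are off instead of uniformly distributed, so
  \<open>lamplighter_average\<close> does not apply at once. The first step randomizes the lamps at
  \<open>x\<close> and \<open>y\<close>, after which it applies with \<open>A = {x, y}\<close>. For
  \<open>n = 0\<close> both sides are 1, since the zeroth power is the identity even when
  \<open>x\<close> is closed.\<close>

theorem lamplighter_return_probability:
  "n_step (lamplighter adj p) n (0 :: 'v \<Rightarrow>\<^sub>0 'h::{finite,zero}, x) (0, x) =
    (\<integral>\<omega>. n_step (absorbing p {v. \<omega> v}) n x x \<partial>site_percolation (1 / real CARD('h)))"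
proof (cases n)
  case 0
  interpret P: prob_space "site_percolation (1 / real CARD('h)) :: ('v \<Rightarrow> bool) measure"
    by (rule prob_space_site_percolation)
  show ?thesis using 0 P.prob_space by simp
next
  case (Suc k)
  let ?m = "real CARD('h)" and ?N = "n_step (lamplighter adj p :: ('v \<Rightarrow>\<^sub>0 'h) \<times> 'v \<Rightarrow> _)"
  have "?N n (0, x) (0, x) = (\<Sum>\<^sub>\<infinity>y. p x y * ((\<Sum>\<eta>\<in>agree_off {x, y} 0. ?N k (\<eta>, y) (0, x)) / ?m\<^sup>2))"
    by (simp only: Suc n_step_lamplighter_Suc(1))
  also have "\<dots> = (\<Sum>\<^sub>\<infinity>y. p x y * (\<integral>\<omega>. of_bool (\<forall>v\<in>insert x (insert y {}). \<omega> v) *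
      n_step (absorbing p {v. \<omega> v}) k y x \<partial>site_percolation (1 / ?m)))"
  proof (rule infsum_cong)
    fix y
    show "p x y * ((\<Sum>\<eta>\<in>agree_off {x, y} 0. ?N k (\<eta>, y) (0, x)) / ?m\<^sup>2) =
        p x y * (\<integral>\<omega>. of_bool (\<forall>v\<in>insert x (insert y {}). \<omega> v) *
          n_step (absorbing p {v. \<omega> v}) k y x \<partial>site_percolation (1 / ?m))"
    proof (cases "p x y = 0")
      case False
      then have "x \<noteq> y" by (rule p_nonzeroD)
      then have "(\<Sum>\<eta>\<in>agree_off {x, y} 0. ?N k (\<eta>, y) (0, x)) / ?m\<^sup>2 =
          (1 / ?m) ^ card {x, y} * (\<Sum>\<eta>\<in>agree_off {x, y} 0. ?N k (\<eta>, y) (0, x))"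
        by (simp add: power2_eq_square)
      also have "\<dots> = (\<integral>\<omega>. of_bool (\<forall>v\<in>insert x (insert y {}). \<omega> v) *
          n_step (absorbing p {v. \<omega> v}) k y x \<partial>site_percolation (1 / ?m))"
        by (rule lamplighter_average) auto
      finally show ?thesis by simp
    qed simp
  qed
  also have "\<dots> = (\<integral>\<omega>. of_bool (\<forall>v\<in>{}. \<omega> v) * n_step (absorbing p {v. \<omega> v}) (Suc k) x x \<partial>site_percolation (1 / ?m))"
    by (rule expectation_n_step_open_Suc[symmetric]) simp
  finally show ?thesis using Suc by simp
qed

end

text \<open>Selfadjointness is tested on two point masses; the kernel is real, so conjugation
  disappears.\<close>

lemma selfadjoint_transition_op_imp_sym:
  assumes sa: "selfadjoint_op (transition_op p)"
  shows "p x y = p y x"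
proof -
  have T: "transition_op p (indicator {z}) w = complex_of_real (p w z)" for z w
  proof -
    have "transition_op p (indicator {z}) w = (\<Sum>\<^sub>\<infinity>y\<in>{z}. complex_of_real (p w y) * indicator {z} y)"
      unfolding transition_op_def by (rule infsum_cong_neutral) auto
    then show ?thesis by simp
  qed
  have "ell2_inner (transition_op p (indicator {y})) (indicator {x}) =
      ell2_inner (indicator {y}) (transition_op p (indicator {x}))"
    using sa unfolding selfadjoint_op_def by (elim conjE ballE[of _ _ "indicator {y}"] ballE[of _ _ "indicator {x}"])
      (simp_all add: indicator_ell2)
  also have "\<dots> = cnj (ell2_inner (transition_op p (indicator {x})) (indicator {y}))"
    by (rule ell2_inner_commute)
  finally show ?thesis
    by (simp add: ell2_inner_indicator T)
qed

text \<open>Integrability and measurability belong to the conclusion: they ensure that the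
  expectation is not a default value and that the integrals over configurations have their usual
  meaning.\<close>

theorem theorem4p2:
  fixes adj :: "'v \<Rightarrow> 'v \<Rightarrow> bool" and p :: "'v \<Rightarrow> 'v \<Rightarrow> real"
  assumes "simple_graph adj"
    and "nearest_neighbour_walk adj p"
    and "selfadjoint_op (transition_op p)"
    and "CARD('h::{finite,zero}) \<ge> 2"
  shows "(\<forall>x n.
            integrable (site_percolation (1 / real CARD('h)))
              (\<lambda>\<omega>. n_step (absorbing p (cluster adj x \<omega>)) n x x) \<and>
            n_step (lamplighter adj p) n (0 :: 'v \<Rightarrow>\<^sub>0 'h, x) (0, x) =
              (\<integral>\<omega>. n_step (absorbing p (cluster adj x \<omega>)) n x x
                 \<partial>site_percolation (1 / real CARD('h)))) \<and>
         (\<forall>x.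
            (\<forall>B\<in>sets borel. (\<lambda>\<omega>. emeasure (cluster_spectral_measure adj p x \<omega>) B)
                \<in> borel_measurable (site_percolation (1 / real CARD('h)))) \<and>
            spectral_measure (transition_op (lamplighter adj p)) (indicator {(0 :: 'v \<Rightarrow>\<^sub>0 'h, x)}) =
              integrated_density_of_states adj p (1 / real CARD('h)) x)"
proof -
  interpret symmetric_walk adj p
    using assms selfadjoint_transition_op_imp_sym[OF assms(3)] by unfold_locales
  let ?P = "site_percolation (1 / real CARD('h)) :: ('v \<Rightarrow> bool) measure"
  interpret P: prob_space ?P
    by (rule prob_space_site_percolation)
  have meas: "(\<lambda>\<omega>. n_step (absorbing p (cluster adj x \<omega>)) n x x) \<in> borel_measurable ?P" for x n
    unfolding n_step_cluster by (rule measurable_n_step_open)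
  have int: "integrable ?P (\<lambda>\<omega>. n_step (absorbing p (cluster adj x \<omega>)) n x x)" for x n
    by (rule P.integrable_const_bound[of _ 1]) (auto simp: n_step_open_bounds meas)
  have return: "n_step (lamplighter adj p) n (0 :: 'v \<Rightarrow>\<^sub>0 'h, x) (0, x) =
      (\<integral>\<omega>. n_step (absorbing p (cluster adj x \<omega>)) n x x \<partial>?P)" for x n
    unfolding n_step_cluster by (rule lamplighter_return_probability)
  have spectral: "(\<forall>B\<in>sets borel. (\<lambda>\<omega>. emeasure (cluster_spectral_measure adj p x \<omega>) B) \<in> borel_measurable ?P) \<and>
      spectral_measure (transition_op (lamplighter adj p)) (indicator {(0 :: 'v \<Rightarrow>\<^sub>0 'h, x)}) =
      integrated_density_of_states adj p (1 / real CARD('h)) x" for x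
  proof -
    define \<kappa> where "\<kappa> = cluster_spectral_measure adj p x"
    define \<mu> where "\<mu> = spectral_measure (transition_op (lamplighter adj p)) (indicator {(0 :: 'v \<Rightarrow>\<^sub>0 'h, x)})"
    have supp: "supported_measure 1 (\<kappa> \<omega>)"
      and moment: "(\<integral>t. t ^ n \<partial>\<kappa> \<omega>) = n_step (absorbing p (cluster adj x \<omega>)) n x x" for \<omega> n
      unfolding \<kappa>_def cluster_spectral_measure_def
      using symmetric_kernel.spectral_measure_transition_op[OF symmetric_kernel_absorbing] by blast+
    have \<mu>: "supported_measure 1 \<mu>"
      "\<And>n. (\<integral>t. t ^ n \<partial>\<mu>) = n_step (lamplighter adj p) n (0 :: 'v \<Rightarrow>\<^sub>0 'h, x) (0, x)"
      unfolding \<mu>_def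
      using symmetric_kernel.spectral_measure_transition_op[OF symmetric_kernel_lamplighter] by blast+
    have prob: "prob_space (\<kappa> \<omega>)" for \<omega>
    proof -
      interpret finite_measure "\<kappa> \<omega>" by (rule supported_measureD(1)[OF supp])
      \<comment> \<open>The total mass is the zeroth moment, a diagonal entry of the identity
        matrix, and hence 1 even when \<open>x\<close> is closed.\<close>
      have "measure (\<kappa> \<omega>) (space (\<kappa> \<omega>)) = 1"
        using moment[of \<omega> 0] by simp
      then show ?thesis
        by (intro prob_spaceI) (simp add: emeasure_eq_measure)
    qed
    have \<kappa>: "\<kappa> \<in> measurable ?P (prob_algebra borel)"
      by (rule measurable_prob_algebra_moments[OF prob supp]) (simp add: moment meas)
    then have \<kappa>': "\<kappa> \<in> measurable ?P (subprob_algebra borel)"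
      by (rule measurable_prob_algebraD)
    have poly: "(\<lambda>\<omega>. \<integral>t. poly q t \<partial>\<kappa> \<omega>) \<in> borel_measurable ?P" for q
      unfolding integral_poly_moments[OF supp] moment
      by (intro borel_measurable_sum borel_measurable_times borel_measurable_const meas)
    \<comment> \<open>Writing the expected measure as a mixture makes it a genuine measure, since
      \<open>bind\<close> supplies countable additivity.\<close>
    have "integrated_density_of_states adj p (1 / real CARD('h)) x =
        measure_of UNIV (sets borel) (emeasure (?P \<bind> \<kappa>))"
      unfolding integrated_density_of_states_def
    proof (rule measure_of_eq)
      fix B :: "real set" assume "B \<in> sigma_sets UNIV (sets borel)"
      then have "B \<in> sets borel"
        using sets.sigma_sets_eq[of "borel :: real measure"] by simp
      then show "(\<integral>\<^sup>+\<omega>. emeasure (cluster_spectral_measure adj p x \<omega>) B \<partial>?P) = emeasure (?P \<bind> \<kappa>) B"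
        using emeasure_bind[OF P.not_empty \<kappa>'] by (simp add: \<kappa>_def)
    qed simp
    also have "\<dots> = ?P \<bind> \<kappa>"
      using measure_of_of_measure[of "?P \<bind> \<kappa>"] supported_measureD[OF P.bind_supported(1)[OF \<kappa> supp]] by simp
    also have "\<dots> = \<mu>"
    proof (rule supported_measure_eqI[OF P.bind_supported(1)[OF \<kappa> supp] \<mu>(1)])
      fix q
      have "(\<integral>t. poly q t \<partial>(?P \<bind> \<kappa>)) = (\<integral>\<omega>. \<integral>t. poly q t \<partial>\<kappa> \<omega> \<partial>?P)"
        by (rule P.bind_supported(2)[OF \<kappa> supp poly])
      also have "\<dots> = (\<Sum>i\<le>degree q. coeff q i * (\<integral>\<omega>. n_step (absorbing p (cluster adj x \<omega>)) i x x \<partial>?P))"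
        unfolding integral_poly_moments[OF supp] moment using int by simp
      also have "\<dots> = (\<integral>t. poly q t \<partial>\<mu>)"
        by (simp only: integral_poly_moments[OF \<mu>(1)] \<mu>(2) return)
      finally show "(\<integral>t. poly q t \<partial>(?P \<bind> \<kappa>)) = (\<integral>t. poly q t \<partial>\<mu>)" .
    qed
    finally have "integrated_density_of_states adj p (1 / real CARD('h)) x = \<mu>" .
    moreover have "(\<lambda>\<omega>. emeasure (\<kappa> \<omega>) B) \<in> borel_measurable ?P" if "B \<in> sets borel" for B
      using measurable_compose[OF \<kappa>' measurable_emeasure_subprob_algebra[OF that]] .
    ultimately show ?thesis
      by (simp add: \<kappa>_def \<mu>_def)
  qed
  show ?thesis
    using int return spectral by blast
qed

end
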